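(* Let $q$ be a prime power with $q\equiv 5$ or $9\pmod{12}$. Let $E=\mathbb{F}_{q^3}$, $F=\mathbb{F}_q$, let $\mathrm{Tr}:E\to F$ be the relative trace, let $\omega$ be a primitive element of $E$, let $N=q^2+q+1$, and let $w_1\in E$ have multiplicative order $N$. Put $I_{\mathcal Q}=\{i:0\le i\le N-1,\ \mathrm{Tr}(w_1^{2i})=0\}=\{d_0,d_1,\dots,d_q\}$ (numbered in any order), let $\beta$ be any nonzero square in $F$, and let $$X=\{w_1^{d_i}\,\mathrm{Tr}(w_1^{d_0+d_i}):1\le i\le q\}\cup\{2\beta w_1^{d_0}\},\qquad \overline{X}=\{\log_\omega(x)\bmod 2N: x\in X\}\subseteq\mathbb{Z}_{2N}.$$ Write $\overline{X}=2A\cup(2B+N)\pmod{2N}$ with $A,B\subseteq\mathbb{Z}_N$, and let $I_X=4A\cup(4A+N)\cup(4B+2N)\cup(4B+3N)\subseteq\mathbb{Z}_{4N}$. Define $$D=\{(xy,\ xy^{-1}z\omega^{\ell}) : x\in F^*,\ y\in\langle\omega^{q-1}\rangle,\ z\in\langle\omega^{4N}\rangle,\ \ell\in I_X\}\subseteq E\times E,$$ and let $\mathcal M=\{\langle v\rangle: v\in D\}$, a set of points of $\mathrm{PG}(5,q)$ whose underlying $6$-dimensional $F$-space is $E\times E$. Then $\mathcal M$ is contained in the hyperbolic quadric $\mathcal{Q}^+(5,q)$ defined by the quadratic form $Q((x,y))=\mathrm{Tr}(xy)$, and the set $\mathcal L$ of lines of $\mathrm{PG}(3,q)$ corresponding to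 $\mathcal M$ under the Klein correspondence is a Cameron–Liebler line class with parameter $x=\frac{q^2-1}{2}$.
   Context: $\log_\omega(x)$ for $x\in E^*$ denotes the integer $0\le i\le q^3-2$ with $x=\omega^i$. Every element of $\overline X$ is congruent modulo $2N$ either to an even number or to an even number plus $N$, so the sets $A,B$ are determined (2 is invertible modulo $N$). The Klein correspondence is the standard bijection between lines of $\mathrm{PG}(3,q)$ and points of the hyperbolic quadric $\mathcal{Q}^+(5,q)$ (here identified with the quadric $\{\langle(x,y)\rangle:\mathrm{Tr}(xy)=0\}$). A set $\mathcal L$ of lines of $\mathrm{PG}(3,q)$ with $|\mathcal L|=x(q^2+q+1)$, $x$ a nonnegative integer, is a Cameron–Liebler line class with parameter $x$ if every spread of $\mathrm{PG}(3,q)$ contains exactly $x$ lines of $\mathcal L$. *)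

theory Defs
  imports
    "HOL-Analysis.Analysis"
    "HOL-Number_Theory.Prime_Powers"
begin

section \<open>The extension \<open>E/F\<close> of finite fields\<close>

definition field_embedding :: "('f::field \<Rightarrow> 'e::field) \<Rightarrow> bool" where
  "field_embedding \<iota> \<longleftrightarrow>
     \<iota> 1 = 1 \<and> (\<forall>x y. \<iota> (x + y) = \<iota> x + \<iota> y) \<and> (\<forall>x y. \<iota> (x * y) = \<iota> x * \<iota> y)"

text \<open>
  Relative trace of a cubic extension, the sum of the three conjugates. The sum lies in the
  image of \<open>F\<close> (lemma \<open>embed_rel_trace\<close> below), so it can be pulled back along \<open>\<iota>\<close>.
\<close>
definition rel_trace :: "('f::finite_field \<Rightarrow> 'e::finite_field) \<Rightarrow> 'e \<Rightarrow> 'f" where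
  "rel_trace \<iota> x = the_inv \<iota> (x + x ^ CARD('f) + x ^ (CARD('f)\<^sup>2))"

definition cyclic_subgroup :: "'e::field \<Rightarrow> 'e set" where
  "cyclic_subgroup g = range (\<lambda>i::int. g powi i)"

definition primitive_element :: "'e::finite_field \<Rightarrow> bool" where
  "primitive_element \<omega> \<longleftrightarrow> cyclic_subgroup \<omega> = UNIV - {0}"

definition has_mult_order :: "'e::field \<Rightarrow> nat \<Rightarrow> bool" where
  "has_mult_order w n \<longleftrightarrow> n > 0 \<and> w ^ n = 1 \<and> (\<forall>m. 0 < m \<and> m < n \<longrightarrow> w ^ m \<noteq> 1)"

definition dlog :: "'e::finite_field \<Rightarrow> 'e \<Rightarrow> nat" where
  "dlog \<omega> x = (THE i. i \<le> CARD('e) - 2 \<and> x = \<omega> ^ i)"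

lemma field_embedding_inj:
  assumes "field_embedding \<iota>"
  shows "inj \<iota>"
proof (rule injI, rule ccontr)
  fix x y assume eq: "\<iota> x = \<iota> y" and "x \<noteq> y"
  from assms have add: "\<iota> (a + b) = \<iota> a + \<iota> b" and mult: "\<iota> (a * b) = \<iota> a * \<iota> b"
    and one: "\<iota> 1 = 1" for a b
    by (auto simp: field_embedding_def)
  have "\<iota> x = \<iota> (x - y) + \<iota> y" by (simp flip: add)
  with eq have "\<iota> (x - y) = 0" by simp
  hence "\<iota> ((x - y) * inverse (x - y)) = 0" by (simp add: mult)
  with \<open>x \<noteq> y\<close> one show False by simp
qed

lemma field_embedding_range:
  fixes \<iota> :: "'f::finite_field \<Rightarrow> 'e::finite_field"
  assumes "field_embedding \<iota>"
  shows "range \<iota> = {x. x ^ CARD('f) = x}"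
proof -
  have inj: "inj \<iota>" using assms by (rule field_embedding_inj)
  have pow: "\<iota> (x ^ n) = \<iota> x ^ n" for x n
    using assms by (induction n) (auto simp: field_embedding_def)
  have sub: "range \<iota> \<subseteq> {x. x ^ CARD('f) = x}"
    by (auto simp flip: pow simp: finite_field_power_card_eq_same)
  have "CARD('f) \<noteq> 1"
  proof
    assume "CARD('f) = 1"
    then obtain a :: 'f where "UNIV = {a}" by (auto simp: card_1_singleton_iff)
    hence "(0::'f) = 1" by (metis UNIV_I singletonD)
    thus False by simp
  qed
  moreover have "CARD('f) \<noteq> 0" by simp
  ultimately have gt: "CARD('f) > 1" by linarith
  define P :: "'e poly" where "P = monom 1 CARD('f) - monom 1 1"
  have "coeff P CARD('f) = 1" using gt by (simp add: P_def)
  hence P0: "P \<noteq> 0" by auto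
  have "degree P \<le> CARD('f)"
    unfolding P_def using gt by (intro degree_diff_le order.trans[OF degree_monom_le]) auto
  moreover have "{x. poly P x = 0} = {x. x ^ CARD('f) = x}"
    by (auto simp: P_def poly_monom)
  ultimately have "card {x::'e. x ^ CARD('f) = x} \<le> CARD('f)"
    using card_poly_roots_bound[OF P0] by simp
  also have "\<dots> = card (range \<iota>)" using inj by (simp add: card_image)
  finally show ?thesis using sub by (intro card_seteq) auto
qed

lemma embed_rel_trace:
  fixes \<iota> :: "'f::finite_field \<Rightarrow> 'e::finite_field"
  assumes emb: "field_embedding \<iota>" and q: "CARD('f) = q" and card: "CARD('e) = q ^ 3"
    and pp: "primepow q"
  shows "\<iota> (rel_trace \<iota> x) = x + x ^ q + x ^ (q\<^sup>2)"
proof -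
  have pe: "prime CHAR('e)" using CHAR_pos_iff pos_char_exists prime_CHAR_semidom by blast
  have "of_nat (q ^ 3) = (0::'e)"
  proof -
    have "(\<Sum>y\<in>UNIV. y + 1) = (\<Sum>y\<in>(UNIV::'e set). y)"
      by (rule sum.reindex_bij_witness[of _ "\<lambda>y. y - 1" "\<lambda>y. y + 1"]) auto
    hence "of_nat (CARD('e)) = (0::'e)" by (simp add: sum.distrib)
    thus ?thesis by (simp add: card)
  qed
  hence "CHAR('e) dvd q ^ 3" by (simp only: of_nat_eq_0_iff_char_dvd)
  hence "CHAR('e) dvd q" using pe prime_dvd_power by blast
  obtain p k where p: "prime p" and k: "q = p ^ k"
    using pp by (auto simp: primepow_def)
  have "CHAR('e) dvd p" using \<open>CHAR('e) dvd q\<close> pe k prime_dvd_power by blast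
  hence "CHAR('e) = p" using pe p primes_dvd_imp_eq by blast
  hence k: "q = CHAR('e) ^ k" using k by simp
  have frob: "(a + b) ^ q = a ^ q + b ^ q" for a b :: 'e
    using pe k by (rule freshmans_dream')
  have "(x + x ^ q + x ^ (q\<^sup>2)) ^ q = x ^ q + (x ^ q) ^ q + (x ^ (q\<^sup>2)) ^ q"
    by (simp only: frob)
  moreover have "(x ^ q) ^ q = x ^ (q\<^sup>2)"
    by (simp only: power2_eq_square power_mult)
  moreover have "(x ^ (q\<^sup>2)) ^ q = x ^ (q ^ 3)"
    by (simp only: power2_eq_square power3_eq_cube power_mult)
  moreover have "x ^ (q ^ 3) = x"
    using finite_field_power_card_eq_same[of x] by (simp only: card)
  ultimately have "(x + x ^ q + x ^ (q\<^sup>2)) ^ q = x + x ^ q + x ^ (q\<^sup>2)"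
    by (simp only: ac_simps)
  hence "x + x ^ q + x ^ (q\<^sup>2) \<in> range \<iota>"
    by (simp add: field_embedding_range[OF emb] q)
  thus ?thesis
    unfolding rel_trace_def q using field_embedding_inj[OF emb] by (intro f_the_inv_into_f) auto
qed

section \<open>\<open>PG(5,q)\<close> on \<open>E \<times> E\<close> and its hyperbolic quadric\<close>

definition ext_scale :: "('f::field \<Rightarrow> 'e::field) \<Rightarrow> 'f \<Rightarrow> 'e \<times> 'e \<Rightarrow> 'e \<times> 'e" where
  "ext_scale \<iota> c v = (\<iota> c * fst v, \<iota> c * snd v)"

definition ext_point :: "('f::field \<Rightarrow> 'e::field) \<Rightarrow> 'e \<times> 'e \<Rightarrow> ('e \<times> 'e) set" where
  "ext_point \<iota> v = range (\<lambda>c. ext_scale \<iota> c v)"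

definition quad_form :: "('f::finite_field \<Rightarrow> 'e::finite_field) \<Rightarrow> 'e \<times> 'e \<Rightarrow> 'f" where
  "quad_form \<iota> v = rel_trace \<iota> (fst v * snd v)"

definition quadric :: "('f::finite_field \<Rightarrow> 'e::finite_field) \<Rightarrow> ('e \<times> 'e) set set" where
  "quadric \<iota> = {ext_point \<iota> v | v. v \<noteq> 0 \<and> quad_form \<iota> v = 0}"

section \<open>\<open>PG(3,q)\<close>, spreads and Cameron--Liebler line classes\<close>

definition pg_points :: "('f::field ^ 4) set set" where
  "pg_points = {P. vec.subspace P \<and> vec.dim P = 1}"

definition pg_lines :: "('f::field ^ 4) set set" where
  "pg_lines = {l. vec.subspace l \<and> vec.dim l = 2}"

definition is_spread :: "('f::field ^ 4) set set \<Rightarrow> bool" where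
  "is_spread S \<longleftrightarrow> S \<subseteq> pg_lines \<and> (\<forall>P\<in>pg_points. \<exists>!l. l \<in> S \<and> P \<subseteq> l)"

definition cameron_liebler :: "('f::finite_field ^ 4) set set \<Rightarrow> nat \<Rightarrow> bool" where
  "cameron_liebler L x \<longleftrightarrow>
     L \<subseteq> pg_lines \<and> card L = x * (CARD('f)\<^sup>2 + CARD('f) + 1) \<and>
     (\<forall>S. is_spread S \<longrightarrow> card (S \<inter> L) = x)"

section \<open>The Klein correspondence\<close>

text \<open>
  The Pluecker coordinates are listed as \<open>p\<^sub>1\<^sub>2, p\<^sub>1\<^sub>3, p\<^sub>1\<^sub>4, p\<^sub>2\<^sub>3, p\<^sub>2\<^sub>4, p\<^sub>3\<^sub>4\<close> with
  \<open>p\<^sub>i\<^sub>j = u\<^sub>i v\<^sub>j - u\<^sub>j v\<^sub>i\<close>.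
\<close>
definition pluecker :: "'f::field ^ 4 \<Rightarrow> 'f ^ 4 \<Rightarrow> 'f ^ 6" where
  "pluecker u v =
     vector [u$1 * v$2 - u$2 * v$1, u$1 * v$3 - u$3 * v$1, u$1 * v$4 - u$4 * v$1,
             u$2 * v$3 - u$3 * v$2, u$2 * v$4 - u$4 * v$2, u$3 * v$4 - u$4 * v$3]"

definition klein_form :: "'f::field ^ 6 \<Rightarrow> 'f" where
  "klein_form p = p$1 * p$6 - p$2 * p$5 + p$3 * p$4"

text \<open>
  For a line \<open>l = \<langle>u, v\<rangle>\<close> all vectors \<open>pluecker a b\<close> with \<open>a, b \<in> l\<close> are multiples of
  \<open>pluecker u v\<close>, so the span below is the point \<open>\<langle>pluecker u v\<rangle>\<close>, independently of a basis.
\<close>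
definition klein_point :: "('f::field ^ 4) set \<Rightarrow> ('f ^ 6) set" where
  "klein_point l = vec.span {pluecker u v | u v. u \<in> l \<and> v \<in> l}"

text \<open>
  An identification of the Klein quadric with \<open>quadric \<iota>\<close>: a projectivity from the ambient
  space of the Pluecker coordinates to \<open>PG(E \<times> E)\<close> that maps one quadric onto the other. Both
  quadrics are hyperbolic, so such identifications exist, but none of them is canonical.
\<close>
definition klein_identification ::
    "('f::finite_field \<Rightarrow> 'e::finite_field) \<Rightarrow> ('f ^ 6 \<Rightarrow> 'e \<times> 'e) \<Rightarrow> bool" where
  "klein_identification \<iota> \<phi> \<longleftrightarrow>
     Vector_Spaces.linear (*s) (ext_scale \<iota>) \<phi> \<and> bij \<phi> \<and>
     (\<forall>p. klein_form p = 0 \<longleftrightarrow> quad_form \<iota> (\<phi> p) = 0)"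

definition klein_lines :: "('f::field ^ 6 \<Rightarrow> 'e \<times> 'e) \<Rightarrow> ('e \<times> 'e) set set \<Rightarrow> ('f ^ 4) set set" where
  "klein_lines \<phi> M = {l \<in> pg_lines. \<phi> ` klein_point l \<in> M}"

lemma vector_6:
  "(vector [a, b, c, d, e, f] :: 'a::zero ^ 6) $ 1 = a"
  "(vector [a, b, c, d, e, f] :: 'a::zero ^ 6) $ 2 = b"
  "(vector [a, b, c, d, e, f] :: 'a::zero ^ 6) $ 3 = c"
  "(vector [a, b, c, d, e, f] :: 'a::zero ^ 6) $ 4 = d"
  "(vector [a, b, c, d, e, f] :: 'a::zero ^ 6) $ 5 = e"
  "(vector [a, b, c, d, e, f] :: 'a::zero ^ 6) $ 6 = f"
  unfolding vector_def by simp_all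

lemma klein_form_pluecker: "klein_form (pluecker u v) = 0"
  by (simp add: klein_form_def pluecker_def vector_6 algebra_simps)

end

(*
  Counting pairs of meeting lines, one from a spread and one from L, reduces the Cameron-Liebler property
  to the tight set property of M: every singular point is perpendicular to x (q + 1) points of M, and to
  q^2 more if it lies in M.

  To count, write E* as the direct product of F* and the group W of order N, and let Psi be a character
  of E* of order 4; it is trivial on W because N is 3 modulo 4. The elements of X are w h(w), where w
  runs over the q + 1 points of the conic T(w^2) = 0 in W, and
  D = {(x y, x y^-1 w^2 h(w)^2 r)} with r in the union R of two cosets of the fourth powers of F*.
  Expanding the indicator of R in Psi, the count becomes a sum over w of the correlation sums
    sum over t in W of Psi(T(m t)) * conj(Psi(T(m / t))),   m = w w',
  where w' is the conic point belonging to the given singular point. These equal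
  q Psi(-1) chi(2 T(m)) with chi = Psi^2, which is an elementary form of the Hasse-Davenport relation for
  the quadratic character: scale t by F*, substitute as in the evaluation of a Salie sum, and use that
  the sum of chi over the elements of trace s is q chi(s). Finally, chi(2 T(u v) T(v w) T(w u)) = 1 for
  distinct conic points, so the signs chi(h(w)) form an eigenvector of the matrix of the chi(2 T(w w')).
*)

theory Submission
  imports Defs
begin

section \<open>The multiplicative group of a cubic extension\<close>

text \<open>Of q = 5 or 9 mod 12 two things are used: q = 1 mod 4 lets \<open>Psi\<close> have order
  4 on F*, and q not 1 mod 3 makes q - 1 and N coprime. The set h is squared in D, and
  \<open>Psi\<close> of a square is \<open>chi\<close> of the root, so only the signs chi(h(w))
  matter. The value T(w0 w) vanishes on the conic only at w = w0, where X puts 2 beta instead: the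
  eigenvector relation between w0 and another point w reads chi(h(w0)) chi(2 T(w0 w)) = chi(T(w0 w))
  and forces chi(h(w0)) = chi(2). The eigenvalue is q, because every conic point has q others;
  together with the factor q of each correlation sum it produces the q^2 extra perpendicular points
  of a point of M. The two cosets in R are adjacent, so its indicator has no \<open>chi\<close>
  component and one family of correlation sums suffices. Such sums are usually evaluated by Gauss
  sums; here the indicator of trace zero takes the place of an additive character, and the sums of
  chi over trace fibres come from a direct count of the q^2 + q solutions of T(y^2) = 1.\<close>

locale cubic_trace =
  fixes q N :: nat and \<omega> :: "'e::finite_field"
  assumes card_E: "CARD('e) = q ^ 3" and q_mod_4: "q mod 4 = 1" and q_mod_3: "q mod 3 \<noteq> 1"
    and q_gt_1: "q > 1"
    and frobenius_add: "\<And>a b :: 'e. (a + b) ^ q = a ^ q + b ^ q"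
    and primitive: "primitive_element \<omega>" and N_def: "N = q\<^sup>2 + q + 1"
begin

lemma q_ge_5: "q \<ge> 5"
proof (rule ccontr)
  assume "\<not> q \<ge> 5"
  hence "q = 2 \<or> q = 3 \<or> q = 4" using q_gt_1 by auto
  thus False using q_mod_4 by auto
qed

lemma unit_group_card: "q ^ 3 - 1 = (q - 1) * N"
proof -
  have "int (q ^ 3 - 1) = int ((q - 1) * N)"
    using q_gt_1 by (simp add: of_nat_diff N_def algebra_simps power2_eq_square power3_eq_cube)
  thus ?thesis by (simp only: of_nat_eq_iff)
qed

lemma N_pos: "N > 0" by (simp add: N_def)

lemma N_mod_4: "N mod 4 = 3"
proof -
  obtain k where "q = 4 * k + 1" using q_mod_4 by (metis mod_div_mult_eq add.commute mult.commute)
  hence "N = 3 + 4 * (4 * k * k + 3 * k)" by (simp add: N_def power2_eq_square algebra_simps)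
  thus ?thesis by (simp only: mod_mult_self2) simp
qed

lemma odd_N: "odd N"
  using N_mod_4 by presburger

text \<open>The group of order N therefore has no element of order 3, on which
  \<open>conic_trace_nonzero\<close> depends.\<close>

lemma N_mod_3: "N mod 3 = 1"
proof -
  have "q mod 3 = 0 \<or> q mod 3 = 2" using q_mod_3 by presburger
  then consider k where "q = 3 * k" | k where "q = 3 * k + 2"
    by (metis mod_div_mult_eq add.commute mult.commute add_0)
  thus ?thesis
  proof cases
    case 1
    hence "N = 1 + 3 * (3 * k * k + k)" by (simp add: N_def power2_eq_square algebra_simps)
    thus ?thesis by (simp only: mod_mult_self2) simp
  next
    case 2
    hence "N = 1 + 3 * (3 * k * k + 5 * k + 2)" by (simp add: N_def power2_eq_square algebra_simps)
    thus ?thesis by (simp only: mod_mult_self2) simp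
  qed
qed

lemma four_dvd: "4 dvd q - 1"
  using q_mod_4 q_gt_1 by presburger

text \<open>A common divisor divides N - (q - 1) (q + 2) = 3, and 3 does not divide q - 1. This is
  what makes E* the direct product of F* and the group of order N.\<close>

lemma coprime_q1_N: "coprime (q - 1) N"
proof -
  have "N = (q - 1) * (q + 2) + 3"
  proof -
    obtain r where "q = Suc r" using q_gt_1 by (cases q) auto
    thus ?thesis by (simp add: N_def power2_eq_square)
  qed
  moreover have "coprime (q - 1) 3"
  proof -
    have "\<not> 3 dvd q - 1" using q_mod_3 q_gt_1 by presburger
    thus ?thesis by (simp add: coprime_commute prime_imp_coprime)
  qed
  ultimately show ?thesis
    by (metis coprime_iff_gcd_eq_1 gcd_add_mult mult.commute add.commute gcd.commute)
qed

lemma pow_card [simp]: "x ^ (q ^ 3) = (x :: 'e)"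
  using finite_field_power_card_eq_same[of x] by (simp only: card_E)

lemma pow_card_minus_1: "x \<noteq> 0 \<Longrightarrow> x ^ (q ^ 3 - 1) = (1 :: 'e)"
proof -
  assume "x \<noteq> 0"
  have "x ^ (q ^ 3 - 1) * x = x ^ Suc (q ^ 3 - 1)" by simp
  also have "Suc (q ^ 3 - 1) = q ^ 3" using q_gt_1 by simp
  finally show ?thesis using \<open>x \<noteq> 0\<close> by simp
qed

lemma omega_nonzero: "\<omega> \<noteq> 0"
proof
  assume "\<omega> = 0"
  hence "cyclic_subgroup \<omega> \<subseteq> {0, 1}" by (auto simp: cyclic_subgroup_def power_int_def)
  moreover have "cyclic_subgroup \<omega> = UNIV - {0}" using primitive by (simp add: primitive_element_def)
  ultimately have "(UNIV :: 'e set) \<subseteq> {0, 1}" by auto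
  hence "CARD('e) \<le> card {0, 1 :: 'e}" by (intro card_mono) auto
  also have "\<dots> \<le> 2" by (simp add: card_insert_if)
  also have "\<dots> < q ^ 3" using q_ge_5 power_increasing[of 1 3 q] by auto
  finally show False by (simp add: card_E)
qed

text \<open>Integer exponents come in through \<open>cyclic_subgroup\<close>; reduced modulo the
  group order they become natural exponents, the form used everywhere else.\<close>

lemma powi_eq_pow:
  assumes "(g :: 'e) \<noteq> 0"
  shows "g powi i = g ^ nat (i mod int (q ^ 3 - 1))"
proof -
  define n where "n = int (q ^ 3 - 1)"
  have n: "n > 0" using unit_group_card N_pos q_gt_1 by (simp add: n_def)
  have g1: "g powi n = 1"
    unfolding n_def power_int_of_nat by (rule pow_card_minus_1[OF assms])
  have "g powi i = g powi (n * (i div n) + i mod n)" by simp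
  also have "\<dots> = (g powi n) powi (i div n) * g powi (i mod n)"
    using assms by (subst power_int_add) (auto simp: power_int_mult)
  also have "\<dots> = g powi (i mod n)" by (simp add: g1)
  also have "\<dots> = g ^ nat (i mod n)" using n by (simp add: power_int_def)
  finally show ?thesis by (simp add: n_def)
qed

lemma cyclic_subgroup_pow: "(g :: 'e) \<noteq> 0 \<Longrightarrow> cyclic_subgroup g = range (\<lambda>k::nat. g ^ k)"
  unfolding cyclic_subgroup_def
proof (intro equalityI image_subsetI)
  show "g powi i \<in> range (\<lambda>k::nat. g ^ k)" if "g \<noteq> 0" for i
    unfolding powi_eq_pow[OF that] by (rule rangeI)
  show "g ^ k \<in> range (\<lambda>i. g powi i)" for k
    unfolding power_int_of_nat[symmetric] by (rule rangeI)
qed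

text \<open>Primitivity gives surjectivity; injectivity follows because both sides have q^3 - 1
  elements.\<close>

lemma omega_pow_bij: "bij_betw (\<lambda>i. \<omega> ^ i) {..<q ^ 3 - 1} (UNIV - {0})"
proof -
  have n: "int (q ^ 3 - 1) > 0" using unit_group_card N_pos q_gt_1 by simp
  have "(\<lambda>i. \<omega> ^ i) ` {..<q ^ 3 - 1} = UNIV - {0}"
  proof (intro equalityI subsetI)
    fix x :: 'e assume "x \<in> UNIV - {0}"
    then obtain i where "x = \<omega> powi i"
      using primitive by (auto simp: primitive_element_def cyclic_subgroup_def)
    moreover have "nat (i mod int (q ^ 3 - 1)) < q ^ 3 - 1"
      using pos_mod_bound[OF n, of i] pos_mod_sign[OF n, of i] by linarith
    ultimately show "x \<in> (\<lambda>i. \<omega> ^ i) ` {..<q ^ 3 - 1}"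
      using powi_eq_pow[OF omega_nonzero, of i] by (metis image_eqI lessThan_iff)
  qed (use omega_nonzero in auto)
  moreover have "card (UNIV - {0 :: 'e}) = q ^ 3 - 1" by (simp add: card_Diff_subset card_E)
  ultimately show ?thesis
    by (simp add: bij_betw_def eq_card_imp_inj_on)
qed

lemma dlog:
  assumes "x \<noteq> 0"
  shows "dlog \<omega> x < q ^ 3 - 1" "\<omega> ^ dlog \<omega> x = x"
proof -
  have n: "q ^ 3 - 1 > 1" using unit_group_card q_ge_5 by (simp add: N_def)
  \<comment> \<open>The bound in \<open>dlog\<close> is inclusive, so it describes exactly the
    exponents below q^3 - 1.\<close>
  have 1: "i \<le> CARD('e) - 2 \<longleftrightarrow> i \<in> {..<q ^ 3 - 1}" for i
    using n by (auto simp: card_E)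
  have "x \<in> (\<lambda>i. \<omega> ^ i) ` {..<q ^ 3 - 1}"
    unfolding bij_betw_imp_surj_on[OF omega_pow_bij] using assms by simp
  then obtain i where i: "i \<in> {..<q ^ 3 - 1}" "x = \<omega> ^ i" by blast
  have "\<exists>!i. i \<le> CARD('e) - 2 \<and> x = \<omega> ^ i"
    unfolding 1
  proof (rule ex1I[of _ i])
    show "i \<in> {..<q ^ 3 - 1} \<and> x = \<omega> ^ i" by (rule conjI[OF i])
  next
    fix j assume j: "j \<in> {..<q ^ 3 - 1} \<and> x = \<omega> ^ j"
    hence "\<omega> ^ j = \<omega> ^ i" using i(2) by (rule_tac trans[OF sym]) auto
    thus "j = i" using i(1) j by (intro inj_onD[OF bij_betw_imp_inj_on[OF omega_pow_bij]]) blast+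
  qed
  from theI'[OF this] show "dlog \<omega> x < q ^ 3 - 1" "\<omega> ^ dlog \<omega> x = x"
    unfolding dlog_def 1 by auto
qed

lemma omega_pow_eq_iff: "\<omega> ^ i = \<omega> ^ j \<longleftrightarrow> i mod (q ^ 3 - 1) = j mod (q ^ 3 - 1)"
proof -
  have n: "q ^ 3 - 1 > 0" using unit_group_card N_pos q_gt_1 by simp
  have "\<omega> ^ i = \<omega> ^ (i mod (q ^ 3 - 1))" for i
  proof -
    have "\<omega> ^ i = \<omega> ^ ((q ^ 3 - 1) * (i div (q ^ 3 - 1)) + i mod (q ^ 3 - 1))" by simp
    also have "\<dots> = \<omega> ^ (i mod (q ^ 3 - 1))"
      unfolding power_add power_mult by (simp only: pow_card_minus_1[OF omega_nonzero] power_one mult_1)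
    finally show ?thesis .
  qed
  thus ?thesis
    using inj_onD[OF bij_betw_imp_inj_on[OF omega_pow_bij], of "i mod (q ^ 3 - 1)" "j mod (q ^ 3 - 1)"] n
    by (metis lessThan_iff mod_less_divisor)
qed

text \<open>With q^3 - 1 = d e the solutions are the powers of \<open>\<omega> ^ e\<close>. The
  cases d = N and d = q - 1 give the orders of the two factors of E*.\<close>

lemma card_roots_of_unity:
  assumes "d dvd q ^ 3 - 1"
  shows "card {x :: 'e. x ^ d = 1} = d"
proof -
  define n where "n = q ^ 3 - 1"
  have n: "n > 0" using unit_group_card N_pos q_gt_1 by (simp add: n_def)
  obtain e where e: "n = d * e" using assms by (auto simp: n_def)
  have pos: "d > 0" "e > 0" using n e by (auto intro: Nat.gr0I)
  have "{x :: 'e. x ^ d = 1} = (\<lambda>k. \<omega> ^ (e * k)) ` {..<d}"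
  proof (intro equalityI subsetI)
    fix x :: 'e assume "x \<in> {x. x ^ d = 1}"
    hence x: "x ^ d = 1" by simp
    hence "x \<noteq> 0" using pos by (auto simp: power_0_left)
    note l = dlog[OF this]
    have "\<omega> ^ (dlog \<omega> x * d) = \<omega> ^ 0" using x l by (simp add: power_mult)
    hence "n dvd dlog \<omega> x * d" unfolding omega_pow_eq_iff by (simp add: n_def mod_eq_0_iff_dvd)
    hence "d * e dvd d * dlog \<omega> x" by (simp only: e mult.commute)
    hence "e dvd dlog \<omega> x" using pos by (simp only: dvd_mult_cancel1 nat_mult_dvd_cancel1)
    then obtain k where k: "dlog \<omega> x = e * k" by blast
    moreover have "k < d"
    proof -
      have "e * k < e * d" using l(1) e unfolding n_def k by (simp only: mult.commute)
      thus ?thesis by simp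
    qed
    ultimately show "x \<in> (\<lambda>k. \<omega> ^ (e * k)) ` {..<d}"
      using l(2) by (intro image_eqI[of _ _ k]) auto
  next
    fix x assume "x \<in> (\<lambda>k. \<omega> ^ (e * k)) ` {..<d}"
    then obtain k where "x = \<omega> ^ (e * k)" by auto
    hence "x ^ d = (\<omega> ^ n) ^ k" by (simp only: e flip: power_mult) (simp only: ac_simps)
    thus "x \<in> {x. x ^ d = 1}" using pow_card_minus_1[OF omega_nonzero] by (simp add: n_def)
  qed
  moreover have "inj_on (\<lambda>k. \<omega> ^ (e * k)) {..<d}"
  proof (rule inj_onI)
    fix j k assume "j \<in> {..<d}" "k \<in> {..<d}" "\<omega> ^ (e * j) = \<omega> ^ (e * k)"
    moreover have "e * j < n" "e * k < n" using calculation pos by (auto simp: e mult.commute)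
    ultimately show "j = k" unfolding omega_pow_eq_iff using pos by (simp add: n_def)
  qed
  ultimately show ?thesis by (simp add: card_image)
qed

section \<open>The decomposition of E* into F* and the subgroup of order N\<close>

definition W :: "'e set" where "W = {x. x ^ N = 1}"
text \<open>The base field appears as the fixed set of the Frobenius map inside E. This keeps the
  type of F and the embedding out of the locale; they return only in
  \<open>theorem4p1\<close>.\<close>

definition Fs :: "'e set" where "Fs = {x. x ^ q = x}"
definition Fu :: "'e set" where "Fu = Fs - {0}"

lemma Fu_alt: "Fu = {x. x ^ (q - 1) = 1}"
proof -
  have "x ^ q = x * x ^ (q - 1)" for x :: 'e
    using q_gt_1 by (metis One_nat_def Suc_pred less_trans power_Suc zero_less_one)
  moreover have "0 ^ (q - 1) \<noteq> (1 :: 'e)" using q_gt_1 by (simp add: power_0_left)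
  ultimately show ?thesis by (auto simp: Fu_def Fs_def)
qed

lemma card_W: "card W = N"
  unfolding W_def by (rule card_roots_of_unity) (simp only: unit_group_card dvd_triv_left dvd_triv_right)

lemma card_Fu: "card Fu = q - 1"
  unfolding Fu_alt by (rule card_roots_of_unity) (simp only: unit_group_card dvd_triv_left dvd_triv_right)

lemma Fs_eq: "Fs = insert 0 Fu"
  using q_gt_1 by (auto simp: Fu_def Fs_def power_0_left)

lemma card_Fs: "card Fs = q"
  unfolding Fs_eq using card_Fu q_gt_1 by (subst card_insert_disjoint) (auto simp: Fu_def)

lemma Fs_add: "x \<in> Fs \<Longrightarrow> y \<in> Fs \<Longrightarrow> x + y \<in> Fs"
  by (simp add: Fs_def frobenius_add)
lemma Fs_mult: "x \<in> Fs \<Longrightarrow> y \<in> Fs \<Longrightarrow> x * y \<in> Fs"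
  by (simp add: Fs_def power_mult_distrib)
lemma Fs_0: "0 \<in> Fs" and Fs_1: "1 \<in> Fs"
  using q_gt_1 by (auto simp: Fs_def power_0_left)
lemma odd_q: "odd q" using q_mod_4 by presburger
lemma frobenius_minus: "(- x) ^ q = - ((x :: 'e) ^ q)"
  using odd_q by simp
lemma frobenius_diff: "(x - y) ^ q = (x :: 'e) ^ q - y ^ q"
  using frobenius_add[of x "- y"] frobenius_minus[of y] by simp
lemma Fs_minus: "x \<in> Fs \<Longrightarrow> - x \<in> Fs"
  by (simp add: Fs_def frobenius_minus)
lemma Fs_diff: "x \<in> Fs \<Longrightarrow> y \<in> Fs \<Longrightarrow> x - y \<in> Fs"
  by (simp add: Fs_def frobenius_diff)
lemma Fs_2: "2 \<in> Fs"
  using Fs_add[OF Fs_1 Fs_1] by simp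
lemma Fs_inverse: "x \<in> Fs \<Longrightarrow> inverse x \<in> Fs"
  by (simp add: Fs_def power_inverse)
lemma Fs_divide: "x \<in> Fs \<Longrightarrow> y \<in> Fs \<Longrightarrow> x / y \<in> Fs"
  by (simp add: Fs_def power_divide)

lemma Fu_I: "x \<in> Fs \<Longrightarrow> x \<noteq> 0 \<Longrightarrow> x \<in> Fu" by (simp add: Fu_def)
lemma Fu_Fs: "x \<in> Fu \<Longrightarrow> x \<in> Fs" and Fu_nonzero: "x \<in> Fu \<Longrightarrow> x \<noteq> 0" by (auto simp: Fu_def)
lemma Fu_mult: "x \<in> Fu \<Longrightarrow> y \<in> Fu \<Longrightarrow> x * y \<in> Fu"
  by (simp add: Fu_def Fs_mult)
lemma Fu_divide: "x \<in> Fu \<Longrightarrow> y \<in> Fu \<Longrightarrow> x / y \<in> Fu"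
  by (simp add: Fu_def Fs_divide)
lemma Fu_minus: "x \<in> Fu \<Longrightarrow> - x \<in> Fu"
  by (simp add: Fu_def Fs_minus)
lemma Fu_inverse: "x \<in> Fu \<Longrightarrow> inverse x \<in> Fu"
  by (simp add: Fu_def Fs_inverse)
lemma Fu_1: "1 \<in> Fu" by (simp add: Fu_def Fs_1)
lemma Fu_power: "x \<in> Fu \<Longrightarrow> x ^ k \<in> Fu"
  by (induction k) (auto simp: Fu_1 Fu_mult)

text \<open>The group order is even, so a half power of \<omega> is a square root of 1 different
  from 1; in characteristic 2 the only square root of 1 is 1.\<close>

lemma two_nonzero: "(2 :: 'e) \<noteq> 0"
proof
  assume 2: "(2 :: 'e) = 0"
  have "(\<omega> ^ ((q ^ 3 - 1) div 2) - 1) * (\<omega> ^ ((q ^ 3 - 1) div 2) + 1) = \<omega> ^ ((q ^ 3 - 1) div 2 * 2) - 1"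
    by (simp add: algebra_simps power_mult power2_eq_square)
  also have "(q ^ 3 - 1) div 2 * 2 = q ^ 3 - 1" using odd_q by simp
  also have "\<omega> ^ (q ^ 3 - 1) - 1 = 0" using pow_card_minus_1[OF omega_nonzero] by simp
  finally have "\<omega> ^ ((q ^ 3 - 1) div 2) = 1 \<or> \<omega> ^ ((q ^ 3 - 1) div 2) = - 1"
    by (auto simp: add_eq_0_iff2)
  moreover have "(- 1 :: 'e) = 1" using 2 by (metis add.inverse_unique one_add_one)
  ultimately have "\<omega> ^ ((q ^ 3 - 1) div 2) = \<omega> ^ 0" by auto
  hence "(q ^ 3 - 1) div 2 mod (q ^ 3 - 1) = 0" unfolding omega_pow_eq_iff by simp
  moreover have "q ^ 3 - 1 > 1" using unit_group_card q_ge_5 by (simp add: N_def)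
  ultimately show False by (simp add: mod_eq_0_iff_dvd)
qed

lemma W_1: "1 \<in> W" by (simp add: W_def)
lemma W_mult: "x \<in> W \<Longrightarrow> y \<in> W \<Longrightarrow> x * y \<in> W"
  by (simp add: W_def power_mult_distrib)
lemma W_inverse: "x \<in> W \<Longrightarrow> inverse x \<in> W"
  by (simp add: W_def power_inverse)
lemma W_divide: "x \<in> W \<Longrightarrow> y \<in> W \<Longrightarrow> x / y \<in> W"
  by (simp add: W_def power_divide)
lemma W_nonzero: "x \<in> W \<Longrightarrow> x \<noteq> 0"
  using N_pos by (auto simp: W_def power_0_left)
lemma W_power: "x \<in> W \<Longrightarrow> x ^ k \<in> W"
  by (induction k) (auto simp: W_1 W_mult)

lemma Fu_W_trivial: assumes "x \<in> Fu" "x \<in> W" shows "x = 1"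
proof -
  have x: "x \<noteq> 0" "x ^ (q - 1) = 1" "x ^ N = 1" using assms by (auto simp: Fu_alt W_def Fu_nonzero)
  obtain a b where "a * (q - 1) = b * N + 1"
    using bezout_nat[of "q - 1" N] q_gt_1 coprime_q1_N
    by (auto simp: coprime_iff_gcd_eq_1 mult.commute)
  hence "x ^ (a * (q - 1)) = x ^ (b * N + 1)" by simp
  thus ?thesis using x by (simp add: power_add mult.commute[of a] mult.commute[of b] power_mult)
qed

lemma W_eq_of_ratio: "x \<in> W \<Longrightarrow> y \<in> W \<Longrightarrow> x / y \<in> Fs \<Longrightarrow> x = y"
  using Fu_W_trivial[OF Fu_I[of "x / y"] W_divide] W_nonzero by simp

lemma Fu_W_unique:
  assumes "f \<in> Fu" "w \<in> W" "f' \<in> Fu" "w' \<in> W" "f * w = f' * w'"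
  shows "f = f'" "w = w'"
proof -
  have "w / w' = f' / f" using assms by (simp add: field_simps W_nonzero Fu_nonzero)
  hence "w / w' \<in> Fs" using Fu_Fs[OF Fu_divide[OF assms(3,1)]] by simp
  thus "w = w'" using W_eq_of_ratio assms by blast
  thus "f = f'" using assms W_nonzero by auto
qed

lemma Fu_W_bij: "bij_betw (\<lambda>(f, w). f * w) (Fu \<times> W) (UNIV - {0})"
proof -
  have inj: "inj_on (\<lambda>(f, w). f * w) (Fu \<times> W)"
    by (rule inj_onI) (use Fu_W_unique in auto)
  have "card ((\<lambda>(f, w). f * w) ` (Fu \<times> W)) = (q - 1) * N"
    by (simp add: card_image[OF inj] card_cartesian_product card_Fu card_W)
  moreover have "card (UNIV - {0 :: 'e}) = (q - 1) * N"
    unfolding unit_group_card[symmetric] by (simp add: card_Diff_subset card_E)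
  ultimately have "(\<lambda>(f, w). f * w) ` (Fu \<times> W) = UNIV - {0}"
    by (intro card_seteq) (auto simp: Fu_nonzero W_nonzero)
  thus ?thesis using inj by (simp add: bij_betw_def)
qed

lemma Fu_W_decomp:
  assumes "x \<noteq> 0" obtains f w where "f \<in> Fu" "w \<in> W" "x = f * w"
proof -
  have "x \<in> (\<lambda>(f, w). f * w) ` (Fu \<times> W)"
    using bij_betw_imp_surj_on[OF Fu_W_bij] assms by simp
  thus ?thesis using that by auto
qed

lemma W_square_inj: "inj_on (\<lambda>w. w\<^sup>2) W"
proof (rule inj_onI)
  fix x y assume xy: "x \<in> W" "y \<in> W" "x\<^sup>2 = y\<^sup>2"
  define z where "z = x / y"
  have z: "z ^ N = 1" "z\<^sup>2 = 1"
    using xy W_divide[of x y] W_nonzero[of y] by (auto simp: z_def power_divide W_def)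
  obtain k where k: "N = 2 * k + 1" using odd_N by (rule oddE)
  have "z ^ N = (z\<^sup>2) ^ k * z" unfolding k by (simp add: power_mult)
  hence "z = 1" using z by simp
  thus "x = y" using xy W_nonzero by (simp add: z_def)
qed

lemma W_square_bij: "bij_betw (\<lambda>w. w\<^sup>2) W W"
proof -
  have "(\<lambda>w. w\<^sup>2) ` W \<subseteq> W" by (auto simp: W_power)
  thus ?thesis using W_square_inj by (simp add: bij_betw_def endo_inj_surj)
qed

lemma W_sqrt:
  assumes "u \<in> W" obtains w where "w \<in> W" "u = w\<^sup>2"
proof -
  have "u \<in> (\<lambda>w. w\<^sup>2) ` W" using bij_betw_imp_surj_on[OF W_square_bij] assms by simp
  thus ?thesis using that by blast
qed

section \<open>The quartic character and the trace\<close>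

text \<open>The value 0 at 0 makes the terms with a vanishing trace drop out of the character sums
  by themselves.\<close>

definition Psi :: "'e \<Rightarrow> complex" where
  "Psi x = (if x = 0 then 0 else \<i> ^ dlog \<omega> x)"

definition chi :: "'e \<Rightarrow> complex" where
  "chi x = (Psi x)\<^sup>2"

lemma i_power_mod_4: "\<i> ^ k = \<i> ^ (k mod 4)"
proof -
  have "\<i> ^ k = \<i> ^ (4 * (k div 4) + k mod 4)" by simp
  also have "\<dots> = (\<i> ^ 4) ^ (k div 4) * \<i> ^ (k mod 4)" by (simp only: power_add power_mult)
  also have "\<i> ^ 4 = 1" by (simp add: power4_eq_xxxx)
  finally show ?thesis by simp
qed

lemma Psi_0 [simp]: "Psi 0 = 0" and chi_0 [simp]: "chi 0 = 0"
  by (simp_all add: Psi_def chi_def)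

lemma Psi_omega: "Psi (\<omega> ^ k) = \<i> ^ k"
proof -
  have nz: "\<omega> ^ k \<noteq> 0" using omega_nonzero by simp
  have "dlog \<omega> (\<omega> ^ k) mod (q ^ 3 - 1) = k mod (q ^ 3 - 1)"
    using dlog(2)[OF nz] by (simp only: omega_pow_eq_iff)
  moreover have "4 dvd q ^ 3 - 1"
    unfolding unit_group_card using four_dvd by (rule dvd_mult2)
  ultimately have "dlog \<omega> (\<omega> ^ k) mod 4 = k mod 4"
    by (metis mod_mod_cancel)
  thus ?thesis
    using nz i_power_mod_4[of k] i_power_mod_4[of "dlog \<omega> (\<omega> ^ k)"] by (simp add: Psi_def)
qed

lemma Psi_mult: "Psi (x * y) = Psi x * Psi y"
proof (cases "x = 0 \<or> y = 0")
  case False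
  hence "Psi (x * y) = Psi (\<omega> ^ dlog \<omega> x * \<omega> ^ dlog \<omega> y)" by (simp add: dlog)
  also have "\<dots> = Psi x * Psi y"
    using False by (subst power_add [symmetric], subst Psi_omega) (simp add: Psi_def power_add)
  finally show ?thesis .
qed auto

lemma Psi_1 [simp]: "Psi 1 = 1"
  using Psi_omega[of 0] by simp

lemma chi_mult: "chi (x * y) = chi x * chi y"
  by (simp add: chi_def Psi_mult power_mult_distrib)

lemma chi_1 [simp]: "chi 1 = 1" by (simp add: chi_def)

lemma Psi_cases: assumes "x \<noteq> 0" shows "Psi x = 1 \<or> Psi x = \<i> \<or> Psi x = - 1 \<or> Psi x = - \<i>"
proof -
  define k where "k = dlog \<omega> x mod 4"
  have "k < 4" by (simp add: k_def)
  hence "k = 0 \<or> k = 1 \<or> k = 2 \<or> k = 3" by linarith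
  moreover have "Psi x = \<i> ^ k"
    using assms i_power_mod_4[of "dlog \<omega> x"] by (simp add: Psi_def k_def)
  ultimately show ?thesis by (auto simp: power3_eq_cube power2_eq_square)
qed

lemma chi_cases: "x \<noteq> 0 \<Longrightarrow> chi x = 1 \<or> chi x = - 1"
  using Psi_cases[of x] by (auto simp: chi_def)

lemma chi_self: "x \<noteq> 0 \<Longrightarrow> chi x * chi x = 1"
  using chi_cases[of x] by auto

lemma cnj_chi: "cnj (chi x) = chi x"
  using chi_cases[of x] by (cases "x = 0") auto

lemma Psi_cnj_self: "x \<noteq> 0 \<Longrightarrow> Psi x * cnj (Psi x) = 1"
  using Psi_cases[of x] by auto

lemma chi_square: "y \<noteq> 0 \<Longrightarrow> chi (y\<^sup>2) = 1"
  by (simp add: power2_eq_square chi_mult chi_self)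

lemma Psi_square: "Psi (y\<^sup>2) = chi y"
  by (simp add: power2_eq_square chi_def Psi_mult)

lemma Psi_inverse: "Psi (inverse x) = cnj (Psi x)"
proof (cases "x = 0")
  case False
  hence "Psi x * Psi (inverse x) = 1" by (simp flip: Psi_mult)
  moreover have "Psi x * cnj (Psi x) = 1" using False by (rule Psi_cnj_self)
  ultimately show ?thesis by (metis mult_left_cancel mult_zero_left zero_neq_one)
qed auto

lemma Psi_divide: "Psi (x / y) = Psi x * cnj (Psi y)"
  by (simp add: divide_inverse Psi_mult Psi_inverse)

lemma chi_inverse: "chi (inverse x) = chi x"
  by (simp add: chi_def Psi_inverse flip: complex_cnj_power) (simp add: cnj_chi flip: chi_def)

lemma chi_divide: "chi (x / y) = chi x * chi y"
  by (simp add: divide_inverse chi_mult chi_inverse)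

text \<open>By \<open>Psi_square\<close> this is \<open>Psi\<close> of the square of -1. In
  contrast, Psi(-1) is -1 for some q and has to be carried through the correlation sums.\<close>

lemma chi_neg_1: "chi (- 1) = 1"
  by (simp flip: Psi_square)

lemma chi_minus: "chi (- x) = chi x"
  using chi_mult[of "- 1" x] by (simp add: chi_neg_1)

lemma Psi_minus: "Psi (- x) = Psi (- 1) * Psi x"
  using Psi_mult[of "- 1" x] by simp

lemma Psi_neg_1_self: "Psi (- 1) * Psi (- 1) = 1"
  by (simp flip: Psi_mult)

lemma chi_eq_1_imp_square: assumes "chi x = 1" obtains y where "y \<noteq> 0" "x = y\<^sup>2"
proof -
  have x: "x \<noteq> 0" using assms by auto
  have "\<i> ^ (2 * dlog \<omega> x) = 1"
    using assms x by (simp add: chi_def Psi_def mult.commute power_mult)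
  hence "(- 1 :: complex) ^ dlog \<omega> x = 1" by (simp add: power_mult)
  hence "even (dlog \<omega> x)" by (cases "even (dlog \<omega> x)") auto
  then obtain k where "dlog \<omega> x = 2 * k" by blast
  hence "x = (\<omega> ^ k)\<^sup>2" using dlog(2)[OF x] by (simp add: mult.commute flip: power_mult)
  thus ?thesis using that[of "\<omega> ^ k"] omega_nonzero by simp
qed

lemma Psi_power: "Psi (x ^ k) = Psi x ^ k"
  by (induction k) (simp_all add: Psi_mult)

lemma Psi_W: assumes "w \<in> W" shows "Psi w = 1"
proof -
  have "Psi w ^ N = 1" using assms by (simp add: W_def flip: Psi_power)
  moreover have "Psi w ^ N = Psi w ^ 3"
  proof -
    obtain k where k: "N = 4 * k + 3" using N_mod_4 by (metis mod_div_mult_eq add.commute mult.commute)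
    have "Psi w ^ 4 = 1"
      using Psi_cases[OF W_nonzero[OF assms]] by (auto simp: power4_eq_xxxx)
    thus ?thesis unfolding k by (simp add: power_add power_mult)
  qed
  ultimately show ?thesis
    using Psi_cases[OF W_nonzero[OF assms]] by (auto simp: power3_eq_cube complex_eq_iff)
qed

lemma chi_W: "w \<in> W \<Longrightarrow> chi w = 1"
  by (simp add: chi_def Psi_W)

text \<open>A square root found in E can be replaced by its F* component, because the factorisation
  into F* and W is unique. So \<open>chi\<close> on F* is the quadratic character of F.\<close>

lemma Fu_sqrt: assumes "f \<in> Fu" "chi f = 1" obtains h where "h \<in> Fu" "f = h\<^sup>2"
proof -
  obtain y where y: "y \<noteq> 0" "f = y\<^sup>2" using chi_eq_1_imp_square assms(2) by blast
  obtain h w where hw: "h \<in> Fu" "w \<in> W" "y = h * w" using Fu_W_decomp y(1) by blast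
  have "f * 1 = h\<^sup>2 * w\<^sup>2" using y hw by (simp add: power_mult_distrib)
  hence "f = h\<^sup>2" using Fu_W_unique(1)[OF assms(1) W_1 Fu_power[OF hw(1)] W_power[OF hw(2)]] by blast
  thus ?thesis using that hw by blast
qed

lemma omega_N_Fu: "\<omega> ^ N \<in> Fu"
  using pow_card_minus_1[OF omega_nonzero] unfolding unit_group_card Fu_alt
  by (simp add: mult.commute flip: power_mult)

lemma Psi_omega_N: "Psi (\<omega> ^ N) = - \<i>"
  unfolding Psi_omega using i_power_mod_4[of N] by (simp add: N_mod_4 power3_eq_cube)

lemma chi_omega_N: "chi (\<omega> ^ N) = - 1"
  by (simp add: chi_def Psi_omega_N)

lemma Fu_scale_bij: "c \<in> Fu \<Longrightarrow> bij_betw (\<lambda>f. c * f) Fu Fu"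
  by (rule bij_betw_byWitness[where f' = "\<lambda>f. f / c"])
     (auto simp: Fu_nonzero intro: Fu_mult Fu_divide)

lemma sum_Psi_Fu: "(\<Sum>f\<in>Fu. Psi f) = 0"
proof -
  define s where "s = (\<Sum>f\<in>Fu. Psi f)"
  have "s = (\<Sum>f\<in>Fu. Psi (\<omega> ^ N * f))"
    unfolding s_def using sum.reindex_bij_betw[OF Fu_scale_bij[OF omega_N_Fu], of Psi] by (rule sym)
  also have "\<dots> = - \<i> * s" unfolding s_def sum_distrib_left by (simp add: Psi_mult Psi_omega_N)
  finally have "(1 + \<i>) * s = 0" by (metis distrib_right mult_1 mult_minus_left add.right_inverse add.commute)
  moreover have "1 + \<i> \<noteq> 0" by (simp add: complex_eq_iff)
  ultimately show ?thesis by (simp add: s_def)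
qed

text \<open>In \<open>I\<^sub>X\<close> every exponent occurs with and without an added N, and
  \<open>Psi\<close> of \<open>\<omega> ^ N\<close> is -\<i>. So these are the multipliers that z
  and the optional N contribute to D; see \<open>R_eq\<close>.\<close>

definition R :: "'e set" where "R = {z \<in> Fu. Psi z = 1 \<or> Psi z = - \<i>}"

text \<open>The set {1, -\<i>} has Fourier coefficient (1 + \<i>)/4 at \<open>Psi\<close>, and
  \<open>Psi\<close> and its conjugate combine to the real part. The coefficient at
  \<open>chi\<close> is (1 + (-\<i>)^2)/4 = 0.\<close>

lemma indicator_R: "z \<in> Fu \<Longrightarrow> of_bool (z \<in> R) = 1 / 2 + Re ((1 + \<i>) / 2 * Psi z)"
  using Psi_cases[OF Fu_nonzero, of z] by (auto simp: R_def complex_eq_iff)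

lemma R_Fu: "r \<in> R \<Longrightarrow> r \<in> Fu" by (simp add: R_def)

lemma card_R: "2 * card R = q - 1"
proof -
  have "real (card R) = (\<Sum>z\<in>Fu. of_bool (z \<in> R))"
    by (subst sum_of_bool_eq) (auto simp: Int_def R_Fu intro!: arg_cong[of _ _ card])
  also have "\<dots> = (\<Sum>z\<in>Fu. 1 / 2 + Re ((1 + \<i>) / 2 * Psi z))"
    by (rule sum.cong) (auto simp only: indicator_R)
  also have "\<dots> = real (q - 1) / 2 + Re ((1 + \<i>) / 2 * (\<Sum>z\<in>Fu. Psi z))"
    unfolding sum.distrib Re_sum sum_distrib_left by (simp add: card_Fu)
  finally have "real (2 * card R) = real (q - 1)" by (simp add: sum_Psi_Fu)
  thus ?thesis by (simp only: of_nat_eq_iff)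
qed

section \<open>The trace, and W as the point set of a projective plane\<close>

definition T :: "'e \<Rightarrow> 'e" where "T x = x + x ^ q + x ^ q\<^sup>2"

lemma pow_q_q: "((x :: 'e) ^ q) ^ q = x ^ q\<^sup>2"
  by (simp add: power2_eq_square power_mult)

lemma pow_q2_q: "((x :: 'e) ^ q\<^sup>2) ^ q = x"
proof -
  have "(x ^ q\<^sup>2) ^ q = x ^ (q ^ 3)" by (simp only: power2_eq_square power3_eq_cube power_mult)
  thus ?thesis by simp
qed

lemma pow_q_3: "(((x :: 'e) ^ q) ^ q) ^ q = x"
  by (simp add: pow_q_q pow_q2_q)

lemma frobenius2_add: "(a + b :: 'e) ^ q\<^sup>2 = a ^ q\<^sup>2 + b ^ q\<^sup>2"
  by (simp add: frobenius_add flip: pow_q_q)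

lemma Fs_pow: "x \<in> Fs \<Longrightarrow> x ^ q = x" and Fs_pow2: "x \<in> Fs \<Longrightarrow> x ^ q\<^sup>2 = x"
  by (simp_all add: Fs_def flip: pow_q_q)

lemma T_Fs: "T x \<in> Fs"
  by (simp add: Fs_def T_def frobenius_add pow_q_q pow_q2_q)

lemma T_add: "T (x + y) = T x + T y"
  by (simp add: T_def frobenius_add frobenius2_add)

lemma T_0 [simp]: "T 0 = 0" using q_gt_1 by (simp add: T_def power_0_left)

lemma T_minus: "T (- x) = - T x"
  using T_add[of x "- x"] by (simp add: minus_unique)

lemma T_diff: "T (x - y) = T x - T y"
  using T_add[of x "- y"] by (simp add: T_minus)

lemma T_scale: "f \<in> Fs \<Longrightarrow> T (f * x) = f * T x"
  by (simp add: T_def power_mult_distrib Fs_pow Fs_pow2 algebra_simps)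

text \<open>Otherwise a polynomial of degree q^2 would have q^3 roots.\<close>

lemma T_not_zero: "\<exists>x. T x \<noteq> 0"
proof (rule ccontr)
  assume "\<not> ?thesis"
  hence T0: "T x = 0" for x by simp
  define P :: "'e poly" where "P = monom 1 (q\<^sup>2) + monom 1 q + monom 1 1"
  have q: "1 < q" "q < q\<^sup>2" using q_gt_1 by (auto simp: power2_eq_square)
  have "coeff P (q\<^sup>2) = 1" using q by (simp add: P_def)
  hence P0: "P \<noteq> 0" by auto
  have "degree P \<le> q\<^sup>2" unfolding P_def
    using q by (intro degree_add_le order.trans[OF degree_monom_le]) auto
  moreover have "{x. poly P x = 0} = UNIV"
    using T0 by (auto simp: P_def poly_monom T_def algebra_simps)
  ultimately have "CARD('e) \<le> q\<^sup>2" using card_poly_roots_bound[OF P0] by simp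
  moreover have "q\<^sup>2 < q ^ 3" using q_gt_1 by (intro power_strict_increasing) auto
  ultimately show False by (simp add: card_E)
qed

lemma T_onto: assumes "s \<in> Fs" obtains x where "T x = s"
proof -
  obtain x where x: "T x \<noteq> 0" using T_not_zero by blast
  have "T (s / T x * x) = s" using x by (subst T_scale) (auto intro: Fs_divide assms T_Fs)
  thus ?thesis using that by blast
qed

lemma card_T_fiber_kernel: assumes "s \<in> Fs" shows "card {x. T x = s} = card {x. T x = 0}"
proof -
  obtain x\<^sub>0 where "T x\<^sub>0 = s" using T_onto assms by blast
  hence "bij_betw (\<lambda>x. x - x\<^sub>0) {x. T x = s} {x. T x = 0}"
    by (intro bij_betw_byWitness[where f' = "\<lambda>x. x + x\<^sub>0"]) (auto simp: T_add T_diff)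
  thus ?thesis by (rule bij_betw_same_card)
qed

lemma card_T_fiber: assumes "s \<in> Fs" shows "card {x. T x = s} = q\<^sup>2"
proof -
  have "q ^ 3 = card (\<Union>s\<in>Fs. {x. T x = s})"
    using T_Fs by (subst card_E[symmetric]) (auto intro!: arg_cong[of _ _ card])
  also have "\<dots> = (\<Sum>s\<in>Fs. card {x. T x = s})"
    by (rule card_UN_disjoint) auto
  also have "\<dots> = (\<Sum>s\<in>Fs. card {x. T x = 0})"
    by (rule sum.cong[OF refl card_T_fiber_kernel])
  also have "\<dots> = q * card {x. T x = 0}" by (simp add: card_Fs)
  finally have "q * q\<^sup>2 = q * card {x. T x = 0}" by (simp only: power2_eq_square power3_eq_cube mult.assoc)
  hence "card {x. T x = 0} = q\<^sup>2" using q_gt_1 by simp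
  thus ?thesis using card_T_fiber_kernel[OF assms] by simp
qed

lemma card_T_scaled_fiber: assumes "c \<noteq> 0" "s \<in> Fs" shows "card {x. T (c * x) = s} = q\<^sup>2"
proof -
  have "bij_betw (\<lambda>x. c * x) {x. T (c * x) = s} {x. T x = s}"
    using assms by (intro bij_betw_byWitness[where f' = "\<lambda>x. x / c"]) auto
  thus ?thesis using card_T_fiber[OF assms(2)] bij_betw_same_card by fastforce
qed

text \<open>Each one-dimensional F-subspace of E has exactly one generator in W, so W models the
  points of PG(2,q) and T(c y) = 0 is a line. The kernel without 0 has q^2 - 1 elements, q - 1 for
  each point.\<close>

lemma card_W_line: assumes "c \<noteq> 0" shows "card {y \<in> W. T (c * y) = 0} = q + 1"
proof -
  let ?L = "{y \<in> W. T (c * y) = 0}"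
  have "(\<lambda>(f, w). f * w) ` (Fu \<times> ?L) = {x. T (c * x) = 0} - {0}"
  proof (intro equalityI subsetI)
    fix x assume "x \<in> {x. T (c * x) = 0} - {0}"
    hence x: "T (c * x) = 0" "x \<noteq> 0" by auto
    obtain f w where fw: "f \<in> Fu" "w \<in> W" "x = f * w" using Fu_W_decomp x(2) by blast
    have "f * T (c * w) = T (c * x)"
      using T_scale[OF Fu_Fs[OF fw(1)], of "c * w"] fw(3) by (simp add: ac_simps)
    hence "T (c * w) = 0" using x fw(1) Fu_nonzero by auto
    thus "x \<in> (\<lambda>(f, w). f * w) ` (Fu \<times> ?L)" using fw by force
  next
    fix x assume "x \<in> (\<lambda>(f, w). f * w) ` (Fu \<times> ?L)"
    then obtain f w where fw: "f \<in> Fu" "w \<in> W" "T (c * w) = 0" "x = f * w" by auto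
    have "T (c * x) = f * T (c * w)"
      using T_scale[OF Fu_Fs[OF fw(1)], of "c * w"] fw(4) by (simp add: ac_simps)
    thus "x \<in> {x. T (c * x) = 0} - {0}" using fw by (auto simp: Fu_nonzero W_nonzero)
  qed
  moreover have "inj_on (\<lambda>(f, w). f * w) (Fu \<times> ?L)"
    by (rule inj_on_subset[OF bij_betw_imp_inj_on[OF Fu_W_bij]]) auto
  ultimately have "card (Fu \<times> ?L) = card ({x. T (c * x) = 0} - {0})"
    using card_image by fastforce
  hence "(q - 1) * card ?L = q\<^sup>2 - 1"
    using card_T_scaled_fiber[OF assms Fs_0]
    by (simp add: card_cartesian_product card_Fu card_Diff_subset)
  also have "q\<^sup>2 - 1 = (q - 1) * (q + 1)"
    by (cases q) (auto simp: power2_eq_square)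
  finally show ?thesis unfolding mult_cancel1 using q_gt_1 by simp
qed

text \<open>In the coordinates given by the three conjugates, T of a product is the dot product. The
  vectors of v and n are both orthogonal to (1,1,1) and to the vector of u, which are independent as
  u is not in F; so v and n are proportional, and the ratio is fixed by Frobenius.\<close>

lemma T_eq_0_parallel:
  assumes "T v = 0" "T (u * v) = 0" "T n = 0" "T (u * n) = 0" "u \<notin> Fs" "v \<noteq> 0" "n \<noteq> 0"
  shows "v / n \<in> Fs"
proof -
  define a b c where "a = v" "b = v ^ q" "c = v ^ q\<^sup>2"
  define l m k where "l = u" "m = u ^ q" "k = u ^ q\<^sup>2"
  define x y z where "x = n" "y = n ^ q" "z = n ^ q\<^sup>2"
  have eqs: "a + b + c = 0" "l * a + m * b + k * c = 0" "x + y + z = 0" "l * x + m * y + k * z = 0"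
    using assms(1-4) by (simp_all add: T_def power_mult_distrib a_b_c_def l_m_k_def x_y_z_def)
  have ne: "m \<noteq> k"
  proof
    assume "m = k"
    hence "m ^ q\<^sup>2 = k ^ q\<^sup>2" by simp
    hence "(m ^ q) ^ q = (k ^ q) ^ q" by (simp add: pow_q_q)
    hence "u = u ^ q" by (simp add: l_m_k_def pow_q_q pow_q2_q)
    thus False using assms(5) by (simp add: Fs_def)
  qed
  have "(m - k) * b = (k - l) * a" "(m - k) * y = (k - l) * x"
    using eqs by algebra+
  hence "(m - k) * (b * x - a * y) = 0" by algebra
  hence "b * x = a * y" using ne by simp
  thus ?thesis using assms(6,7)
    by (simp add: Fs_def a_b_c_def x_y_z_def power_divide frac_eq_eq)
qed

text \<open>In conjugate coordinates the element is, up to sign, the cross product of (1,1,1) and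
  the vector of n.\<close>

lemma T_perp: "T (n ^ q - n ^ q\<^sup>2) = 0" "T (n * (n ^ q - n ^ q\<^sup>2)) = 0"
  by (simp_all add: T_def power_mult_distrib frobenius_diff pow_q_3 algebra_simps flip: pow_q_q)

text \<open>Two distinct lines of the plane meet in one point: \<open>T_perp\<close> supplies it and
  \<open>T_eq_0_parallel\<close> makes it unique up to F*.\<close>

lemma card_W_two_lines:
  assumes "u \<notin> Fs" shows "card {v \<in> W. T v = 0 \<and> T (u * v) = 0} = 1"
proof -
  define n where "n = u ^ q - u ^ q\<^sup>2"
  have n: "T n = 0" "T (u * n) = 0" unfolding n_def by (rule T_perp)+
  have "n \<noteq> 0"
  proof
    assume "n = 0"
    hence "((u ^ q) ^ q) ^ q = ((u ^ q\<^sup>2) ^ q) ^ q" by (simp add: n_def)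
    hence "u = u ^ q" by (simp add: pow_q_q pow_q2_q)
    thus False using assms by (simp add: Fs_def)
  qed
  then obtain f w where fw: "f \<in> Fu" "w \<in> W" "n = f * w" using Fu_W_decomp by blast
  have "f * T w = 0" "f * T (u * w) = 0"
    using n T_scale[OF Fu_Fs[OF fw(1)], of w] T_scale[OF Fu_Fs[OF fw(1)], of "u * w"] fw(3)
    by (simp_all add: ac_simps)
  hence w: "T w = 0" "T (u * w) = 0" using fw(1) Fu_nonzero by auto
  have "v = w" if "v \<in> W" "T v = 0" "T (u * v) = 0" for v
    using T_eq_0_parallel[OF that(2,3) w assms] W_eq_of_ratio[OF that(1) fw(2)] W_nonzero that(1) fw(2)
    by blast
  hence "{v \<in> W. T v = 0 \<and> T (u * v) = 0} \<subseteq> {w}" by blast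
  hence "{v \<in> W. T v = 0 \<and> T (u * v) = 0} = {w}" using w fw(2) by blast
  thus ?thesis by simp
qed

section \<open>The conic \<open>T(w\<^sup>2) = 0\<close>\<close>

definition conic :: "'e set" where "conic = {w \<in> W. T (w\<^sup>2) = 0}"

lemma conic_W: "w \<in> conic \<Longrightarrow> w \<in> W" and conic_T: "w \<in> conic \<Longrightarrow> T (w\<^sup>2) = 0"
  by (simp_all add: conic_def)

text \<open>Squaring permutes W because N is odd, so it carries the conic to a line. This counts the
  conic and later turns pairs of conditions into pairs of lines.\<close>

lemma conic_square_bij: "bij_betw (\<lambda>w. w\<^sup>2) conic {v \<in> W. T v = 0}"
proof -
  have "(\<lambda>w. w\<^sup>2) ` conic = {v \<in> W. T v = 0}"
  proof (intro equalityI subsetI)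
    fix v assume v: "v \<in> {v \<in> W. T v = 0}"
    hence "v \<in> W" by simp
    then obtain w where "w \<in> W" "v = w\<^sup>2" by (rule W_sqrt)
    thus "v \<in> (\<lambda>w. w\<^sup>2) ` conic" using v by (auto simp: conic_def)
  qed (auto simp: conic_def W_power)
  moreover have "inj_on (\<lambda>w. w\<^sup>2) conic"
    by (rule inj_on_subset[OF W_square_inj]) (auto simp: conic_def)
  ultimately show ?thesis by (simp add: bij_betw_def)
qed

lemma card_conic: "card conic = q + 1"
  using bij_betw_same_card[OF conic_square_bij] card_W_line[of 1] by simp

text \<open>If the three inner products of two vectors with themselves and each other vanish, then
  so does every product of two coordinates of their cross product; the sum of squares is Lagrange's
  identity. Hence the conjugate vectors are proportional.\<close>

lemma conic_nonorthogonal: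
  assumes "w \<in> conic" "w' \<in> conic" "T (w * w') = 0" shows "w = w'"
proof -
  define a b c where "a = w" "b = w ^ q" "c = (w ^ q) ^ q"
  define x y z where "x = w'" "y = w' ^ q" "z = (w' ^ q) ^ q"
  have eqs: "a\<^sup>2 + b\<^sup>2 + c\<^sup>2 = 0" "x\<^sup>2 + y\<^sup>2 + z\<^sup>2 = 0" "a * x + b * y + c * z = 0"
    using assms(3) conic_T[OF assms(1)] conic_T[OF assms(2)]
    by (simp_all add: T_def power2_eq_square[of w] power2_eq_square[of w'] power_mult_distrib
        a_b_c_def x_y_z_def flip: pow_q_q) (simp_all add: power2_eq_square)
  define l m n where "l = b * z - c * y" "m = c * x - a * z" "n = a * y - b * x"
  have "l * n = 0" "m * n = 0" "l\<^sup>2 + m\<^sup>2 + n\<^sup>2 = 0"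
    unfolding l_m_n_def using eqs by algebra+
  hence "n = 0" by (cases "n = 0") auto
  hence "(w / w') ^ q = w / w'"
    using W_nonzero[OF conic_W[OF assms(2)]]
    by (simp add: l_m_n_def a_b_c_def x_y_z_def power_divide frac_eq_eq mult.commute)
  thus ?thesis using assms W_eq_of_ratio[of w w'] by (simp add: conic_def Fs_def)
qed

text \<open>The Gram determinant of three isotropic vectors is \<open>2 T(ab) T(bc) T(ca)\<close>, and it is the
  square of the determinant of their conjugates, which lies in the base field.\<close>
lemma conic_triple:
  assumes "w\<^sub>1 \<in> conic" "w\<^sub>2 \<in> conic" "w\<^sub>3 \<in> conic" "w\<^sub>1 \<noteq> w\<^sub>2" "w\<^sub>2 \<noteq> w\<^sub>3" "w\<^sub>3 \<noteq> w\<^sub>1"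
  shows "chi (2 * T (w\<^sub>1 * w\<^sub>2) * T (w\<^sub>2 * w\<^sub>3) * T (w\<^sub>3 * w\<^sub>1)) = 1"
proof -
  define a b c where "a = w\<^sub>1" "b = w\<^sub>1 ^ q" "c = (w\<^sub>1 ^ q) ^ q"
  define x y z where "x = w\<^sub>2" "y = w\<^sub>2 ^ q" "z = (w\<^sub>2 ^ q) ^ q"
  define r s t where "r = w\<^sub>3" "s = w\<^sub>3 ^ q" "t = (w\<^sub>3 ^ q) ^ q"
  define V where "V = a * (y * t - z * s) - b * (x * t - z * r) + c * (x * s - y * r)"
  have eqs: "a\<^sup>2 + b\<^sup>2 + c\<^sup>2 = 0" "x\<^sup>2 + y\<^sup>2 + z\<^sup>2 = 0" "r\<^sup>2 + s\<^sup>2 + t\<^sup>2 = 0"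
    using assms(1-3)[THEN conic_T]
    by (simp_all add: T_def power2_eq_square[of w\<^sub>1] power2_eq_square[of w\<^sub>2] power2_eq_square[of w\<^sub>3]
        power_mult_distrib a_b_c_def x_y_z_def r_s_t_def flip: pow_q_q) (simp_all add: power2_eq_square)
  have Ts: "T (w\<^sub>1 * w\<^sub>2) = a * x + b * y + c * z" "T (w\<^sub>2 * w\<^sub>3) = x * r + y * s + z * t"
    "T (w\<^sub>3 * w\<^sub>1) = r * a + s * b + t * c"
    by (simp_all add: T_def power_mult_distrib a_b_c_def x_y_z_def r_s_t_def flip: pow_q_q)
  have "2 * T (w\<^sub>1 * w\<^sub>2) * T (w\<^sub>2 * w\<^sub>3) * T (w\<^sub>3 * w\<^sub>1) = V\<^sup>2"
    unfolding Ts V_def using eqs by algebra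
  moreover have "T (w\<^sub>1 * w\<^sub>2) \<noteq> 0" "T (w\<^sub>2 * w\<^sub>3) \<noteq> 0" "T (w\<^sub>3 * w\<^sub>1) \<noteq> 0"
    using conic_nonorthogonal assms by blast+
  ultimately show ?thesis using two_nonzero chi_square[of V]
    by (metis mult_eq_0_iff power2_eq_square)
qed

section \<open>Sums of the quadratic character over the elements of given trace\<close>

lemma sum_chi_Fu: "(\<Sum>f\<in>Fu. chi f) = 0"
proof -
  define s where "s = (\<Sum>f\<in>Fu. chi f)"
  have "s = (\<Sum>f\<in>Fu. chi (\<omega> ^ N * f))"
    unfolding s_def using sum.reindex_bij_betw[OF Fu_scale_bij[OF omega_N_Fu], of chi] by (rule sym)
  also have "\<dots> = - s" unfolding s_def by (simp add: chi_mult chi_omega_N sum_negf)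
  finally show ?thesis by (simp add: s_def)
qed

lemma card_sqrt: "of_nat (card {y :: 'e. y\<^sup>2 = x}) = 1 + chi x"
proof (cases "x = 0 \<or> chi x = - 1")
  case True
  show ?thesis
  proof (cases "x = 0")
    case False
    have "{y :: 'e. y\<^sup>2 = x} = {}"
    proof (intro equals0I)
      fix y assume y: "y \<in> {y :: 'e. y\<^sup>2 = x}"
      hence "y \<noteq> 0" using False by auto
      hence "chi x = 1" using chi_square[of y] y by simp
      thus False using True False by simp
    qed
    thus ?thesis using True False by simp
  qed simp
next
  case False
  hence 1: "chi x = 1" using chi_cases[of x] by blast
  then obtain h where h: "h \<noteq> 0" "x = h\<^sup>2" using chi_eq_1_imp_square by blast
  have "{y. y\<^sup>2 = x} = {h, - h}" unfolding h(2) by (auto simp: power2_eq_iff)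
  moreover have "h \<noteq> - h" using h(1) two_nonzero
    by (metis add.right_inverse mult_2 mult_eq_0_iff)
  ultimately show ?thesis using 1 by simp
qed

text \<open>If T(w) = T(w^2) = 0, the first two elementary symmetric functions of the conjugates
  vanish, so w^3 is the norm w^N = 1, and N = 1 mod 3 leaves w = 1. The exception is real: in
  characteristic 3 the point 1 lies on the conic and has trace 3 = 0.\<close>

lemma conic_trace_nonzero:
  assumes "w \<in> conic" "w \<noteq> 1" shows "T w \<noteq> 0"
proof
  assume T0: "T w = 0"
  define a b c where "a = w" "b = w ^ q" "c = (w ^ q) ^ q"
  have "a\<^sup>2 + b\<^sup>2 + c\<^sup>2 = 0" "a + b + c = 0"
    using T0 conic_T[OF assms(1)]
    by (simp_all add: T_def power2_eq_square[of w] power_mult_distrib a_b_c_def flip: pow_q_q)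
       (simp_all add: power2_eq_square)
  hence "2 * (a ^ 3 - a * b * c) = 0" by algebra
  hence "a ^ 3 = a * b * c" using two_nonzero by (simp only: mult_eq_0_iff right_minus_eq) simp
  also have "a * b * c = w ^ N"
    by (simp add: a_b_c_def N_def power_add pow_q_q)
  also have wN: "w ^ N = 1" using conic_W[OF assms(1)] by (simp add: W_def)
  finally have w3: "w ^ 3 = 1" by (simp add: a_b_c_def)
  obtain k where k: "N = 3 * k + 1" using N_mod_3 by (metis mod_div_mult_eq add.commute mult.commute)
  have "w ^ N = w" unfolding k by (simp add: power_mult w3)
  thus False using wN assms(2) by simp
qed

lemma Fu_sqrt_neg_1: obtains i where "i \<in> Fu" "i\<^sup>2 = - 1"
  using Fu_sqrt[OF Fu_minus[OF Fu_1] chi_neg_1] by metis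

text \<open>Along a line in an isotropic direction \<open>w\<close> the quadratic form \<open>T(y\<^sup>2)\<close> is either affine linear
  and non-constant, or constant; the latter happens exactly on \<open>w\<^sup>\<bottom>\<close>.\<close>
lemma card_T_square_eq_1: "card {y. T (y\<^sup>2) = 1} = q\<^sup>2 + q"
proof -
  have "\<not> conic \<subseteq> {1}"
  proof
    assume "conic \<subseteq> {1}"
    hence "card conic \<le> card {1 :: 'e}" by (intro card_mono) auto
    thus False using card_conic q_gt_1 by simp
  qed
  then obtain w where w: "w \<in> conic" "w \<noteq> 1" by blast
  have w0: "w \<noteq> 0" using w W_nonzero conic_W by blast
  define t where "t = T w"
  have t: "t \<noteq> 0" "t \<in> Fs" using conic_trace_nonzero[OF w] T_Fs by (simp_all add: t_def)
  \<comment> \<open>The cross product of (1,1,1) and the vector of w: it completes w to a basis of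
    the orthogonal complement of w. Lagrange's identity gives T(p^2) = -t^2, and t is nonzero
    because w was chosen different from 1.\<close>
  define p where "p = w ^ q - w ^ q\<^sup>2"
  have Tw2: "T (w * w) = 0" using conic_T[OF w(1)] by (simp add: power2_eq_square)
  have Twp: "T (w * p) = 0" unfolding p_def by (rule T_perp)
  have Tp: "T (p * p) = - t\<^sup>2"
  proof -
    define a b c where "a = w" "b = w ^ q" "c = (w ^ q) ^ q"
    have "a * a + b * b + c * c = 0" "T (p * p) = (b - c) * (b - c) + (c - a) * (c - a) + (a - b) * (a - b)"
      "t = a + b + c"
      using Tw2
      by (simp_all add: T_def p_def t_def power_mult_distrib frobenius_diff a_b_c_def pow_q_3 flip: pow_q_q)
    thus ?thesis by algebra
  qed
  have Tsq: "T ((x + y)\<^sup>2) = T (x * x) + 2 * T (x * y) + T (y * y)" for x y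
  proof -
    have "(x + y)\<^sup>2 = x * x + (x * y + x * y) + y * y" by (simp add: power2_eq_square algebra_simps)
    thus ?thesis by (simp only: T_add mult_2)
  qed
  define S\<^sub>1 where "S\<^sub>1 = {y. T (w * y) \<noteq> 0 \<and> T (y\<^sup>2) = 1}"
  define S\<^sub>2 where "S\<^sub>2 = {y. T (w * y) = 0 \<and> T (y\<^sup>2) = 1}"
  have shift: "T (w * (y + l * w)) = T (w * y)" "T ((y + l * w)\<^sup>2) = T (y\<^sup>2) + 2 * l * T (w * y)"
    if "l \<in> Fs" for y l
  proof -
    have "T (w * (l * w)) = l * T (w * w)" "T (y * (l * w)) = l * T (w * y)"
      "T ((l * w) * (l * w)) = l * (l * T (w * w))"
      using T_scale[OF that, of "w * w"] T_scale[OF that, of "w * y"] T_scale[OF that, of "l * (w * w)"]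
      by (simp_all add: ac_simps)
    thus "T (w * (y + l * w)) = T (w * y)" "T ((y + l * w)\<^sup>2) = T (y\<^sup>2) + 2 * l * T (w * y)"
      using Tw2 unfolding Tsq by (simp_all add: distrib_left T_add power2_eq_square)
  qed
  have "bij_betw (\<lambda>(y, l). y + l * w) (S\<^sub>1 \<times> Fs) (UNIV - {y. T (w * y) = 0})"
  \<comment> \<open>The coefficient in the inverse map solves T((z - l w)^2) = 1, which is linear in
    l as T(w^2) = 0.\<close>
  proof (rule bij_betw_byWitness[where f' = "\<lambda>z. (z - (T (z\<^sup>2) - 1) / (2 * T (w * z)) * w, (T (z\<^sup>2) - 1) / (2 * T (w * z)))"])
    show "\<forall>yl\<in>S\<^sub>1 \<times> Fs. (\<lambda>z. (z - (T (z\<^sup>2) - 1) / (2 * T (w * z)) * w, (T (z\<^sup>2) - 1) / (2 * T (w * z))))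
        ((\<lambda>(y, l). y + l * w) yl) = yl"
      using two_nonzero by (auto simp: S\<^sub>1_def shift)
    show "(\<lambda>(y, l). y + l * w) ` (S\<^sub>1 \<times> Fs) \<subseteq> UNIV - {y. T (w * y) = 0}"
      by (auto simp: S\<^sub>1_def shift)
    have "z - (T (z\<^sup>2) - 1) / (2 * T (w * z)) * w \<in> S\<^sub>1 \<and> (T (z\<^sup>2) - 1) / (2 * T (w * z)) \<in> Fs"
      if "T (w * z) \<noteq> 0" for z
    proof -
      define l where "l = (T (z\<^sup>2) - 1) / (2 * T (w * z))"
      have l: "l \<in> Fs" unfolding l_def by (intro Fs_divide Fs_diff Fs_mult T_Fs Fs_1 Fs_2)
      have "2 * l * T (w * z) = T (z\<^sup>2) - 1" using that two_nonzero by (simp add: l_def)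
      hence "z - l * w \<in> S\<^sub>1"
        using shift[OF Fs_minus[OF l], of z] that by (simp add: S\<^sub>1_def)
      thus ?thesis using l by (simp add: l_def)
    qed
    thus "(\<lambda>z. (z - (T (z\<^sup>2) - 1) / (2 * T (w * z)) * w, (T (z\<^sup>2) - 1) / (2 * T (w * z)))) `
       (UNIV - {y. T (w * y) = 0}) \<subseteq> S\<^sub>1 \<times> Fs" by auto
  qed auto
  hence "card S\<^sub>1 * q = q ^ 3 - q\<^sup>2"
    using card_T_scaled_fiber[OF w0 Fs_0]
    by (auto dest!: bij_betw_same_card simp: card_cartesian_product card_Fs card_Diff_subset card_E)
  also have "\<dots> = (q\<^sup>2 - q) * q" by (simp add: power2_eq_square power3_eq_cube diff_mult_distrib)
  finally have S\<^sub>1: "card S\<^sub>1 = q\<^sup>2 - q" using q_gt_1 by simp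
  have comb: "T (w * (l * w + m * p)) = 0" "T ((l * w + m * p)\<^sup>2) = - (m * t)\<^sup>2"
    "T (p * (l * w + m * p)) = - m * t\<^sup>2" if "l \<in> Fs" "m \<in> Fs" for l m
  proof -
    have "T (w * (l * w)) = l * T (w * w)" "T (w * (m * p)) = m * T (w * p)"
      "T (p * (l * w)) = l * T (w * p)" "T (p * (m * p)) = m * T (p * p)"
      "T (l * w * (m * p)) = l * (m * T (w * p))"
      "T (l * w * (l * w)) = l * (l * T (w * w))" "T (m * p * (m * p)) = m * (m * T (p * p))"
      using T_scale[OF that(1), of "w * w"] T_scale[OF that(2), of "w * p"] T_scale[OF that(1), of "w * p"]
       T_scale[OF that(2), of "p * p"] T_scale[OF that(1), of "m * (w * p)"]
       T_scale[OF that(1), of "l * (w * w)"] T_scale[OF that(2), of "m * (p * p)"]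
      by (simp_all add: ac_simps)
    thus "T (w * (l * w + m * p)) = 0" "T ((l * w + m * p)\<^sup>2) = - (m * t)\<^sup>2"
      "T (p * (l * w + m * p)) = - m * t\<^sup>2"
      unfolding Tsq distrib_left T_add Tw2 Twp Tp by (simp_all add: power2_eq_square)
  qed
  have inj: "inj_on (\<lambda>(l, m). l * w + m * p) (Fs \<times> Fs)"
  proof (rule inj_onI, clarify)
    fix l m l' m' assume *: "l \<in> Fs" "m \<in> Fs" "l' \<in> Fs" "m' \<in> Fs" "l * w + m * p = l' * w + m' * p"
    hence "- m * t\<^sup>2 = - m' * t\<^sup>2" using comb(3)[OF *(1,2)] comb(3)[OF *(3,4)] by metis
    hence "m = m'" using t by simp
    thus "l = l' \<and> m = m'" using * w0 by simp
  qed
  have perp: "(\<lambda>(l, m). l * w + m * p) ` (Fs \<times> Fs) = {y. T (w * y) = 0}"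
  proof (rule card_seteq)
    show "card {y. T (w * y) = 0} \<le> card ((\<lambda>(l, m). l * w + m * p) ` (Fs \<times> Fs))"
      unfolding card_image[OF inj] card_T_scaled_fiber[OF w0 Fs_0] card_cartesian_product card_Fs
      by (simp add: power2_eq_square)
  qed (auto simp: comb)
  obtain i where i: "i \<in> Fu" "i\<^sup>2 = - 1" by (rule Fu_sqrt_neg_1)
  \<comment> \<open>On the complement spanned by w and p the form is -(m t)^2. The value 1 fixes m
    up to sign and leaves l free: 2 q solutions besides the q^2 - q outside the complement.\<close>
  have "S\<^sub>2 = (\<lambda>(l, m). l * w + m * p) ` (Fs \<times> {i / t, - (i / t)})"
  proof (intro equalityI subsetI)
    fix y assume y: "y \<in> S\<^sub>2"
    hence "y \<in> {y. T (w * y) = 0}" by (simp add: S\<^sub>2_def)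
    then obtain l m where lm: "l \<in> Fs" "m \<in> Fs" "y = l * w + m * p" unfolding perp[symmetric] by auto
    have "- (m * t)\<^sup>2 = 1" using y comb(2)[OF lm(1,2)] by (simp add: S\<^sub>2_def lm(3))
    hence "(m * t)\<^sup>2 = i\<^sup>2" unfolding i(2) by (metis minus_minus)
    hence "m * t = i \<or> m * t = - i" by (simp only: power2_eq_iff)
    hence "m = i / t \<or> m = - (i / t)" using t(1) by (auto simp: field_simps)
    thus "y \<in> (\<lambda>(l, m). l * w + m * p) ` (Fs \<times> {i / t, - (i / t)})" using lm by auto
  next
    fix y assume "y \<in> (\<lambda>(l, m). l * w + m * p) ` (Fs \<times> {i / t, - (i / t)})"
    then obtain l m where lm: "l \<in> Fs" "m = i / t \<or> m = - (i / t)" "y = l * w + m * p" by auto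
    have m: "m \<in> Fs" using lm(2) Fs_divide[OF Fu_Fs[OF i(1)] t(2)] Fs_minus by blast
    have "m * t = i \<or> m * t = - i" using lm(2) t(1) by auto
    hence "(m * t)\<^sup>2 = - 1" using i(2) by auto
    thus "y \<in> S\<^sub>2" using comb[OF lm(1) m] lm(3) by (simp add: S\<^sub>2_def)
  qed
  moreover have "inj_on (\<lambda>(l, m). l * w + m * p) (Fs \<times> {i / t, - (i / t)})"
    by (rule inj_on_subset[OF inj]) (use Fs_divide[OF Fu_Fs[OF i(1)] t(2)] Fs_minus in auto)
  moreover have "card {i / t, - (i / t)} = 2"
  proof -
    have "i / t \<noteq> 0" using i(1) t(1) Fu_nonzero by simp
    hence "i / t \<noteq> - (i / t)" using two_nonzero by (metis add.right_inverse mult_2 mult_eq_0_iff)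
    thus ?thesis by simp
  qed
  ultimately have S\<^sub>2: "card S\<^sub>2 = q * 2" by (simp add: card_image card_cartesian_product card_Fs)
  have "{y. T (y\<^sup>2) = 1} = S\<^sub>1 \<union> S\<^sub>2" "S\<^sub>1 \<inter> S\<^sub>2 = {}" by (auto simp: S\<^sub>1_def S\<^sub>2_def)
  hence "card {y. T (y\<^sup>2) = 1} = card S\<^sub>1 + card S\<^sub>2" by (simp add: card_Un_disjoint)
  thus ?thesis unfolding S\<^sub>1 S\<^sub>2 using q_gt_1 by (simp add: power2_eq_square)
qed

text \<open>For s = 0, scaling by the nonsquare \<open>\<omega> ^ N\<close> of F reverses the sign.
  For s = 1, counting y with T(y^2) = 1 by their squares gives q^2 + q = q^2 + (the sum); any other
  s is a multiple of 1.\<close>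

lemma sum_chi_trace: assumes "s \<in> Fs" shows "(\<Sum>x | T x = s. chi x) = of_nat q * chi s"
proof (cases "s = 0")
  case True
  define S where "S = (\<Sum>x | T x = 0. chi x)"
  have nz: "\<omega> ^ N \<noteq> 0" using omega_nonzero by simp
  have "bij_betw (\<lambda>x. \<omega> ^ N * x) {x. T x = 0} {x. T x = 0}"
    by (rule bij_betw_byWitness[where f' = "\<lambda>x. inverse (\<omega> ^ N) * x"])
       (use nz in \<open>auto simp: T_scale[OF Fu_Fs[OF omega_N_Fu]]
          T_scale[OF Fu_Fs[OF Fu_inverse[OF omega_N_Fu]]]\<close>)
  from sum.reindex_bij_betw[OF this, of chi] have "(\<Sum>x | T x = 0. chi (\<omega> ^ N * x)) = S"
    by (simp add: S_def)
  hence "- S = S" by (simp add: chi_mult chi_omega_N sum_negf S_def)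
  thus ?thesis using True by (simp add: S_def)
next
  case False
  have "of_nat (card {y. T (y\<^sup>2) = 1}) = (of_nat (\<Sum>x | T x = 1. card {y. y\<^sup>2 = x}) :: complex)"
  proof -
    have "{y. T (y\<^sup>2) = 1} = (\<Union>x\<in>{x. T x = 1}. {y. y\<^sup>2 = x})" by auto
    also have "card \<dots> = (\<Sum>x | T x = 1. card {y. y\<^sup>2 = x})"
      by (rule card_UN_disjoint) auto
    finally show ?thesis by simp
  qed
  also have "\<dots> = (\<Sum>x | T x = 1. 1 + chi x)" by (simp add: card_sqrt)
  also have "\<dots> = of_nat (q\<^sup>2) + (\<Sum>x | T x = 1. chi x)"
    by (simp add: sum.distrib card_T_fiber[OF Fs_1])
  finally have 1: "(\<Sum>x | T x = 1. chi x) = of_nat q" by (simp add: card_T_square_eq_1)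
  have "bij_betw (\<lambda>x. s * x) {x. T x = 1} {x. T x = s}"
  proof (rule bij_betw_byWitness[where f' = "\<lambda>x. inverse s * x"])
    show "(\<lambda>x. inverse s * x) ` {x. T x = s} \<subseteq> {x. T x = 1}"
      using False by (intro image_subsetI) (simp add: T_scale[OF Fs_inverse[OF assms]])
  qed (use False in \<open>auto simp: T_scale[OF assms]\<close>)
  from sum.reindex_bij_betw[OF this, of chi] have "(\<Sum>x | T x = s. chi x) = (\<Sum>x | T x = 1. chi (s * x))"
    by (rule sym)
  also have "\<dots> = chi s * (\<Sum>x | T x = 1. chi x)" by (simp add: chi_mult sum_distrib_left)
  finally show ?thesis by (simp add: 1)
qed

section \<open>Correlation sums of the quartic character\<close>

text \<open>A solution satisfies (g + 1)^2 = g (r + 2), so chi(g) = chi(r + 2) unless g = -1. Two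
  solutions exist when the discriminant (r + 2) (r - 2) is a nonzero square, none when it is a
  nonsquare and the two terms on the right cancel; r = 2 and r = -2 give a double root.\<close>

lemma sum_chi_quadratic:
  "(\<Sum>g | g \<noteq> 0 \<and> g + 1 / g = r. chi g) = chi (r + 2) + chi (r - 2)"
proof -
  have roots: "{g. g \<noteq> 0 \<and> g + 1 / g = r} = {g. (2 * g - r)\<^sup>2 = r\<^sup>2 - 4}" (is "?S = _")
  proof (intro Collect_cong)
    fix g
    have "(2 * g - r)\<^sup>2 - (r\<^sup>2 - 4) = 4 * (g * g + 1 - r * g)" by algebra
    moreover have "(4 :: 'e) \<noteq> 0" using two_nonzero by (metis mult_eq_0_iff numeral_Bit0 mult_2)
    ultimately have "(2 * g - r)\<^sup>2 = r\<^sup>2 - 4 \<longleftrightarrow> g * g + 1 - r * g = 0"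
      by (metis eq_iff_diff_eq_0 mult_eq_0_iff)
    also have "\<dots> \<longleftrightarrow> g \<noteq> 0 \<and> g + 1 / g = r"
      by (cases "g = 0") (auto simp: field_simps)
    finally show "g \<noteq> 0 \<and> g + 1 / g = r \<longleftrightarrow> (2 * g - r)\<^sup>2 = r\<^sup>2 - 4" by simp
  qed
  have prod: "r\<^sup>2 - 4 = (r + 2) * (r - 2)" by algebra
  have chi4: "chi 4 = 1"
    using chi_square[of 2] two_nonzero by (simp add: power2_eq_square)
  consider "r = 2" | "r = - 2" | "r \<noteq> 2" "r \<noteq> - 2" by blast
  thus ?thesis
  proof cases
    case 1
    have "?S = {1}" unfolding roots using two_nonzero 1 by auto
    thus ?thesis using 1 chi4 by simp
  next
    case 2
    have "(2 * g - r)\<^sup>2 = r\<^sup>2 - 4 \<longleftrightarrow> (2 * (g + 1))\<^sup>2 = 0" for g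
      by (simp add: 2 algebra_simps)
    moreover have "(2 * (g + 1))\<^sup>2 = 0 \<longleftrightarrow> g \<in> {- 1}" for g :: 'e
      unfolding power2_eq_square mult_eq_0_iff using two_nonzero eq_neg_iff_add_eq_0[of g 1] by simp
    ultimately have "?S = {- 1}" unfolding roots by (intro set_eqI) (simp only: mem_Collect_eq)
    thus ?thesis using 2 chi4 chi_minus[of 4] chi_neg_1 by simp
  next
    case 3
    hence nz: "r + 2 \<noteq> 0" "r - 2 \<noteq> 0" by (auto simp: eq_neg_iff_add_eq_0[symmetric])
    show ?thesis
    proof (cases "chi (r\<^sup>2 - 4) = 1")
      case True
      then obtain d where d: "d \<noteq> 0" "r\<^sup>2 - 4 = d\<^sup>2" by (rule chi_eq_1_imp_square)
      have S: "?S = {(r + d) / 2, (r - d) / 2}"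
        unfolding roots d(2) using two_nonzero by (auto simp: power2_eq_iff field_simps)
      have chig: "chi g = chi (r + 2)" if "g \<in> ?S" for g
      proof -
        have g: "g \<noteq> 0" "g + 1 / g = r" using that by auto
        have "(g + 1)\<^sup>2 = g * (r + 2)" unfolding g(2)[symmetric] using g(1)
          by (simp add: power2_eq_square field_simps)
        moreover have "g + 1 \<noteq> 0"
        proof
          assume "g + 1 = 0"
          hence "g = - 1" by (simp only: eq_neg_iff_add_eq_0)
          thus False using g 3 by simp
        qed
        ultimately have "chi g * chi (r + 2) = 1" using chi_square[of "g + 1"] by (simp add: chi_mult)
        thus ?thesis using chi_cases[OF g(1)] chi_cases[OF nz(1)] by auto
      qed
      have "(r + d) / 2 \<noteq> (r - d) / 2"
      proof
        assume "(r + d) / 2 = (r - d) / 2"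
        hence "r + d = r - d" using two_nonzero by (metis divide_cancel_right)
        hence "2 * d = 0" by algebra
        thus False using two_nonzero d(1) by simp
      qed
      hence "card ?S = 2" unfolding S by simp
      moreover have "(\<Sum>g\<in>?S. chi g) = of_nat (card ?S) * chi (r + 2)"
        unfolding sum_constant[symmetric] by (rule sum.cong[OF refl chig])
      moreover have "chi (r - 2) = chi (r + 2)"
        using True chi_cases[OF nz(1)] chi_cases[OF nz(2)] unfolding prod chi_mult by auto
      ultimately show ?thesis by simp
    next
      case False
      have "?S = {}" unfolding roots
      proof (intro equals0I)
        fix g assume "g \<in> {g. (2 * g - r)\<^sup>2 = r\<^sup>2 - 4}"
        hence g: "(2 * g - r)\<^sup>2 = r\<^sup>2 - 4" by simp
        hence "2 * g - r \<noteq> 0" using nz prod by auto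
        thus False using chi_square[of "2 * g - r"] g False by simp
      qed
      moreover have "chi (r + 2) * chi (r - 2) = - 1"
        using False chi_cases[of "r\<^sup>2 - 4"] nz unfolding prod chi_mult by auto
      hence "chi (r + 2) + chi (r - 2) = 0" using chi_cases[OF nz(1)] chi_cases[OF nz(2)] by auto
      ultimately show ?thesis by (simp only: sum.empty)
    qed
  qed
qed

text \<open>With an additive character for \<open>\<phi>\<close> this is the evaluation of Salie sums.\<close>
lemma sum_chi_reciprocal:
  fixes \<phi> :: "'e \<Rightarrow> complex"
  shows "(\<Sum>g\<in>UNIV - {0}. \<phi> (g + 1 / g) * chi g) = (\<Sum>r\<in>UNIV. \<phi> r * (chi (r + 2) + chi (r - 2)))"
proof -
  have "(\<Sum>g\<in>UNIV - {0}. \<phi> (g + 1 / g) * chi g)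
      = (\<Sum>r\<in>UNIV. \<Sum>g | g \<in> UNIV - {0} \<and> g + 1 / g = r. \<phi> (g + 1 / g) * chi g)"
    by (rule sum.group[symmetric]) auto
  also have "\<dots> = (\<Sum>r\<in>UNIV. \<phi> r * (\<Sum>g | g \<noteq> 0 \<and> g + 1 / g = r. chi g))"
    unfolding sum_distrib_left by (intro sum.cong) auto
  finally show ?thesis unfolding sum_chi_quadratic .
qed

text \<open>For nonzero a and b, each f determines f' = -f a / b. Read from right to left, the
  identity trades the character values of two traces for a linear condition on them, so that the two
  traces can be merged into one.\<close>

lemma sum_pairs_linear:
  assumes "a \<in> Fs" "b \<in> Fs"
  shows "(\<Sum>f\<in>Fu. \<Sum>f'\<in>Fu. of_bool (f * a + f' * b = 0) * (cnj (Psi f) * Psi f'))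
    = of_nat (q - 1) * (Psi (- 1) * (Psi a * cnj (Psi b)))"
proof -
  consider "a = 0" "b = 0" | "a = 0" "b \<noteq> 0" | "a \<noteq> 0" "b = 0" | "a \<noteq> 0" "b \<noteq> 0" by blast
  thus ?thesis
  proof cases
    case 1
    thus ?thesis by (simp add: sum_Psi_Fu flip: sum_distrib_left sum_distrib_right)
  next
    case 2
    thus ?thesis by (auto simp: Fu_nonzero intro!: sum.neutral)
  next
    case 3
    thus ?thesis by (auto simp: Fu_nonzero intro!: sum.neutral)
  next
    case 4
    have "(\<Sum>f'\<in>Fu. of_bool (f * a + f' * b = 0) * (cnj (Psi f) * Psi f'))
      = Psi (- 1) * (Psi a * cnj (Psi b))" if f: "f \<in> Fu" for f
    proof -
      have eq: "f * a + f' * b = 0 \<longleftrightarrow> f' = - (f * a / b)" for f'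
        using 4 by (auto simp: field_simps add_eq_0_iff2 add_eq_0_iff)
      have mem: "- (f * a / b) \<in> Fu"
        using 4 by (intro Fu_minus Fu_divide Fu_mult[OF f] Fu_I assms)
      have "(\<Sum>f'\<in>Fu. of_bool (f * a + f' * b = 0) * (cnj (Psi f) * Psi f'))
        = (\<Sum>f'\<in>Fu. if f' = - (f * a / b) then cnj (Psi f) * Psi f' else 0)"
        unfolding eq by (intro sum.cong) auto
      also have "\<dots> = cnj (Psi f) * Psi (- (f * a / b))" using mem by simp
      also have "\<dots> = (Psi f * cnj (Psi f)) * (Psi (- 1) * (Psi a * cnj (Psi b)))"
        by (subst Psi_minus) (simp add: Psi_divide Psi_mult)
      finally show ?thesis using Psi_cnj_self[OF Fu_nonzero[OF f]] by simp
    qed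
    thus ?thesis by (simp add: card_Fu)
  qed
qed

text \<open>The substitution x = m (r + s) leads to the trace fibre over s T(m), and chi(m) = 1
  because m lies in W.\<close>

lemma sum_chi_trace_shift:
  assumes "m \<in> W" "s \<in> Fs"
  shows "(\<Sum>r\<in>UNIV. of_bool (T (m * r) = 0) * chi (r + s)) = of_nat q * chi (s * T m)"
proof -
  have m: "m \<noteq> 0" using assms W_nonzero by blast
  have Tms: "T (m * s) = s * T m" using T_scale[OF assms(2), of m] by (simp add: mult.commute)
  have "bij_betw (\<lambda>r. m * (r + s)) {r. T (m * r) = 0} {x. T x = s * T m}"
  proof (rule bij_betw_byWitness[where f' = "\<lambda>x. x / m - s"])
    show "(\<lambda>r. m * (r + s)) ` {r. T (m * r) = 0} \<subseteq> {x. T x = s * T m}"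
      by (auto simp: distrib_left T_add Tms)
    show "(\<lambda>x. x / m - s) ` {x. T x = s * T m} \<subseteq> {r. T (m * r) = 0}"
      using m by (auto simp: right_diff_distrib T_diff Tms)
  qed (use m in auto)
  from sum.reindex_bij_betw[OF this, of chi]
  have "(\<Sum>r | T (m * r) = 0. chi (m * (r + s))) = of_nat q * chi (s * T m)"
    using sum_chi_trace[OF Fs_mult[OF assms(2) T_Fs]] by simp
  also have "(\<Sum>r | T (m * r) = 0. chi (m * (r + s))) = (\<Sum>r | T (m * r) = 0. chi (r + s))"
    by (simp add: chi_mult chi_W[OF assms(1)])
  also have "\<dots> = (\<Sum>r\<in>UNIV. of_bool (T (m * r) = 0) * chi (r + s))"
    by (intro sum.mono_neutral_cong_left) auto
  finally show ?thesis .
qed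

lemma sum_chi_Fu_half: "(\<Sum>c\<in>Fu. (1 + chi c) / 2) = of_nat (q - 1) / 2"
  by (simp add: sum_chi_Fu card_Fu sum.distrib flip: sum_divide_distrib)

text \<open>Multiplying by q - 1 makes room for a pair f, f' in F*. Grouped by the product c = f f',
  the triples t, f, f' turn into \<alpha> = f t running over all of E*. The half of the c that are
  squares each contribute \<open>Y\<close>, which has two equal terms from the shifts 2 and
  -2.\<close>

lemma sum_Psi_correlation:
  assumes m: "m \<in> W"
  shows "(\<Sum>t\<in>W. Psi (T (m * t)) * cnj (Psi (T (m / t)))) = of_nat q * (Psi (- 1) * chi (2 * T m))"
proof -
  define K where "K = (\<Sum>t\<in>W. Psi (T (m * t)) * cnj (Psi (T (m / t))))"
  define \<phi> where "\<phi> r = (of_bool (T (m * r) = 0) :: complex)" for r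
  define Y where "Y = (\<Sum>g\<in>UNIV - {0}. \<phi> (g + 1 / g) * chi g)"
  have Y: "Y = 2 * of_nat q * chi (2 * T m)"
  proof -
    have "Y = (\<Sum>r\<in>UNIV. \<phi> r * chi (r + 2)) + (\<Sum>r\<in>UNIV. \<phi> r * chi (r + - 2))"
      unfolding Y_def sum_chi_reciprocal by (simp add: distrib_left sum.distrib)
    also have "\<dots> = of_nat q * chi (2 * T m) + of_nat q * chi (- (2 * T m))"
      unfolding \<phi>_def sum_chi_trace_shift[OF m Fs_2] sum_chi_trace_shift[OF m Fs_minus[OF Fs_2]] by simp
    finally show ?thesis by (simp add: chi_minus)
  qed
  define I where "I c = (\<Sum>\<alpha>\<in>UNIV - {0}. \<phi> (\<alpha> + c / \<alpha>) * chi \<alpha>)" for c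
  \<comment> \<open>If c = h^2, scaling by h gives \<open>I c\<close> = chi(h) \<open>Y\<close>, and
    Psi(c) = chi(h) removes the sign. If c is a nonsquare, the involution a -> c / a reverses the
    sign of \<open>I c\<close>.\<close>
  have I: "Psi c * I c = Y * ((1 + chi c) / 2)" if c: "c \<in> Fu" for c
  proof (cases "chi c = 1")
    case True
    obtain h where h: "h \<in> Fu" "c = h\<^sup>2" using Fu_sqrt[OF c True] by blast
    have h0: "h \<noteq> 0" using h Fu_nonzero by blast
    have "bij_betw (\<lambda>g. h * g) (UNIV - {0}) (UNIV - {0})"
      by (rule bij_betw_byWitness[where f' = "\<lambda>g. g / h"]) (use h0 in auto)
    from sum.reindex_bij_betw[OF this, of "\<lambda>\<alpha>. \<phi> (\<alpha> + c / \<alpha>) * chi \<alpha>"]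
    have "I c = (\<Sum>g\<in>UNIV - {0}. \<phi> (h * g + c / (h * g)) * chi (h * g))"
      by (simp add: I_def)
    also have "\<dots> = (\<Sum>g\<in>UNIV - {0}. chi h * (\<phi> (g + 1 / g) * chi g))"
    proof (rule sum.cong[OF refl])
      fix g :: 'e assume "g \<in> UNIV - {0}"
      have "m * (h * g + c / (h * g)) = h * (m * (g + 1 / g))"
        using h0 by (simp add: h(2) power2_eq_square field_simps)
      hence "T (m * (h * g + c / (h * g))) = h * T (m * (g + 1 / g))"
        using T_scale[OF Fu_Fs[OF h(1)]] by metis
      thus "\<phi> (h * g + c / (h * g)) * chi (h * g) = chi h * (\<phi> (g + 1 / g) * chi g)"
        using h0 by (simp add: \<phi>_def chi_mult)
    qed
    also have "\<dots> = chi h * Y" by (simp add: Y_def sum_distrib_left)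
    finally show ?thesis using chi_self[OF h0] True by (simp add: h(2) Psi_square)
  next
    case False
    have c0: "c \<noteq> 0" using c Fu_nonzero by blast
    have c1: "chi c = - 1" using False chi_cases[OF c0] by blast
    have "bij_betw (\<lambda>a. c / a) (UNIV - {0}) (UNIV - {0})"
      by (rule bij_betw_byWitness[where f' = "\<lambda>a. c / a"]) (use c0 in auto)
    from sum.reindex_bij_betw[OF this, of "\<lambda>\<alpha>. \<phi> (\<alpha> + c / \<alpha>) * chi \<alpha>"]
    have "I c = (\<Sum>a\<in>UNIV - {0}. \<phi> (c / a + c / (c / a)) * chi (c / a))"
      by (simp add: I_def)
    also have "\<dots> = (\<Sum>a\<in>UNIV - {0}. - (\<phi> (a + c / a) * chi a))"
      using c0 c1 by (intro sum.cong) (auto simp: chi_divide add.commute)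
    also have "\<dots> = - I c" by (simp add: I_def sum_negf)
    finally show ?thesis using c1 by simp
  qed
  have "of_nat (q - 1) * (Psi (- 1) * K)
      = (\<Sum>t\<in>W. of_nat (q - 1) * (Psi (- 1) * (Psi (T (m * t)) * cnj (Psi (T (m / t))))))"
    by (simp add: K_def sum_distrib_left)
  also have "\<dots> = (\<Sum>t\<in>W. \<Sum>f\<in>Fu. \<Sum>f'\<in>Fu.
      of_bool (f * T (m * t) + f' * T (m / t) = 0) * (cnj (Psi f) * Psi f'))"
    by (rule sum.cong[OF refl sum_pairs_linear[OF T_Fs T_Fs, symmetric]])
  \<comment> \<open>Put f' = c / f. The linear condition becomes that m (f t + c / (f t)) has trace
    zero, and the character values become Psi(c) chi(f t), since \<open>chi\<close> is real and
    trivial on W.\<close>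
  also have "\<dots> = (\<Sum>t\<in>W. \<Sum>f\<in>Fu. \<Sum>c\<in>Fu. Psi c * (\<phi> (f * t + c / (f * t)) * chi (f * t)))"
  proof (rule sum.cong[OF refl], rule sum.cong[OF refl])
    fix t f assume t: "t \<in> W" and f: "f \<in> Fu"
    have f0: "f \<noteq> 0" using f Fu_nonzero by blast
    have "bij_betw (\<lambda>c. c / f) Fu Fu"
      by (rule bij_betw_byWitness[where f' = "\<lambda>c. c * f"]) (use f f0 in \<open>auto intro: Fu_mult Fu_divide\<close>)
    from sum.reindex_bij_betw[OF this, of "\<lambda>f'. of_bool (f * T (m * t) + f' * T (m / t) = 0) * (cnj (Psi f) * Psi f')"]
    have "(\<Sum>f'\<in>Fu. of_bool (f * T (m * t) + f' * T (m / t) = 0) * (cnj (Psi f) * Psi f'))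
      = (\<Sum>c\<in>Fu. of_bool (f * T (m * t) + c / f * T (m / t) = 0) * (cnj (Psi f) * Psi (c / f)))"
      by (rule sym)
    also have "\<dots> = (\<Sum>c\<in>Fu. Psi c * (\<phi> (f * t + c / (f * t)) * chi (f * t)))"
    proof (rule sum.cong[OF refl])
      fix c assume c: "c \<in> Fu"
      have "m * (f * t + c / (f * t)) = f * (m * t) + c / f * (m / t)"
        using f0 W_nonzero[OF t] by (simp add: field_simps)
      hence "T (m * (f * t + c / (f * t))) = f * T (m * t) + c / f * T (m / t)"
        by (simp only: T_add T_scale[OF Fu_Fs[OF f]] T_scale[OF Fu_Fs[OF Fu_divide[OF c f]]])
      moreover have "cnj (Psi f) * Psi (c / f) = Psi c * chi (f * t)"
        using cnj_chi[of f] by (simp add: Psi_divide chi_mult chi_W[OF t]) (simp add: chi_def power2_eq_square)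
      ultimately show "of_bool (f * T (m * t) + c / f * T (m / t) = 0) * (cnj (Psi f) * Psi (c / f))
          = Psi c * (\<phi> (f * t + c / (f * t)) * chi (f * t))"
        by (simp add: \<phi>_def)
    qed
    finally show "(\<Sum>f'\<in>Fu. of_bool (f * T (m * t) + f' * T (m / t) = 0) * (cnj (Psi f) * Psi f'))
      = (\<Sum>c\<in>Fu. Psi c * (\<phi> (f * t + c / (f * t)) * chi (f * t)))" .
  qed
  also have "\<dots> = (\<Sum>c\<in>Fu. \<Sum>f\<in>Fu. \<Sum>t\<in>W. Psi c * (\<phi> (f * t + c / (f * t)) * chi (f * t)))"
    by (subst sum.swap, subst (2) sum.swap, subst sum.swap) (rule refl)
  also have "\<dots> = (\<Sum>c\<in>Fu. Psi c * I c)"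
  proof (rule sum.cong[OF refl])
    fix c
    have "(\<Sum>f\<in>Fu. \<Sum>t\<in>W. Psi c * (\<phi> (f * t + c / (f * t)) * chi (f * t)))
      = (\<Sum>(f, t)\<in>Fu \<times> W. Psi c * (\<phi> (f * t + c / (f * t)) * chi (f * t)))"
      by (rule sum.cartesian_product)
    also have "\<dots> = (\<Sum>\<alpha>\<in>UNIV - {0}. Psi c * (\<phi> (\<alpha> + c / \<alpha>) * chi \<alpha>))"
      using sum.reindex_bij_betw[OF Fu_W_bij, of "\<lambda>\<alpha>. Psi c * (\<phi> (\<alpha> + c / \<alpha>) * chi \<alpha>)"]
      by (simp add: case_prod_unfold)
    finally show "(\<Sum>f\<in>Fu. \<Sum>t\<in>W. Psi c * (\<phi> (f * t + c / (f * t)) * chi (f * t))) = Psi c * I c"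
      by (simp add: I_def sum_distrib_left)
  qed
  also have "\<dots> = Y * (\<Sum>c\<in>Fu. (1 + chi c) / 2)"
    unfolding sum_distrib_left by (rule sum.cong[OF refl I])
  also have "\<dots> = of_nat (q - 1) * (of_nat q * chi (2 * T m))"
    unfolding sum_chi_Fu_half Y by simp
  finally have "Psi (- 1) * K = of_nat q * chi (2 * T m)"
    using q_gt_1 by simp
  hence "Psi (- 1) * (Psi (- 1) * K) = of_nat q * (Psi (- 1) * chi (2 * T m))" by simp
  thus ?thesis using Psi_neg_1_self by (simp add: K_def flip: mult.assoc)
qed

end

section \<open>Counting perpendicular vectors\<close>

text \<open>The sign condition says that chi(h(w)) is an eigenvector, for the eigenvalue q, of the
  matrix with entries chi(2 T(w w')), whose diagonal is zero. The concrete h is supplied by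
  \<open>conic_weights_trace\<close>.\<close>

locale conic_weights = cubic_trace +
  fixes h :: "'a \<Rightarrow> 'a"
  assumes h_Fu: "\<And>w. w \<in> conic \<Longrightarrow> h w \<in> Fu"
    and h_sign: "\<And>w w'. w \<in> conic \<Longrightarrow> w' \<in> conic \<Longrightarrow> w \<noteq> w' \<Longrightarrow>
      chi (h w) * chi (2 * T (w * w')) = chi (h w')"
begin

lemma real_card_eq_sum: "finite S \<Longrightarrow> real (card {z \<in> S. P z}) = (\<Sum>z\<in>S. of_bool (P z))"
  by (simp add: sum_of_bool_eq Int_def)

text \<open>Keeps sums of indicators as sums, the form in which they are swapped and expanded
  below.\<close>

declare sum_of_bool_eq [simp del]

lemma W_scale_bij: "c \<in> W \<Longrightarrow> bij_betw (\<lambda>t. t * c) W W"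
  by (rule bij_betw_byWitness[where f' = "\<lambda>t. t / c"])
     (auto simp: W_nonzero intro: W_mult W_divide)

lemma card_W_line_inverse: assumes "c \<noteq> 0" shows "card {y \<in> W. T (c / y) = 0} = q + 1"
proof -
  have "bij_betw inverse {y \<in> W. T (c / y) = 0} {y \<in> W. T (c * y) = 0}"
    by (rule bij_betw_byWitness[where f' = inverse]) (auto simp: divide_inverse intro: W_inverse)
  thus ?thesis using card_W_line[OF assms] by (simp add: bij_betw_same_card)
qed

text \<open>The first condition puts y on a line with q + 1 points, among them 1. For y = 1 the
  second condition holds on the whole conic; for each of the other q points, squaring turns the
  count into that of two distinct lines meeting once.\<close>

lemma card_both_zero:
  assumes "w' \<in> conic"
  shows "(\<Sum>y\<in>W. \<Sum>w\<in>conic. of_bool (T (y * w'\<^sup>2) = 0 \<and> T (w\<^sup>2 / y) = 0)) = 2 * real q + 1"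
proof -
  define L where "L = {y \<in> W. T (w'\<^sup>2 * y) = 0}"
  have w'0: "w'\<^sup>2 \<noteq> 0" using assms conic_W W_nonzero by force
  have cL: "card L = q + 1" unfolding L_def by (rule card_W_line[OF w'0])
  have L1: "1 \<in> L" using conic_T[OF assms] by (simp add: L_def W_1)
  have inner: "(\<Sum>w\<in>conic. of_bool (T (w\<^sup>2 / y) = 0)) = (if y = 1 then real q + 1 else 1)"
    if y: "y \<in> W" for y
  proof (cases "y = 1")
    case True
    thus ?thesis by (simp add: conic_T card_conic)
  next
    case False
    have "(\<Sum>w\<in>conic. of_bool (T (w\<^sup>2 / y) = 0)) = (\<Sum>v | v \<in> W \<and> T v = 0. of_bool (T (v / y) = 0) :: real)"
      by (rule sum.reindex_bij_betw[OF conic_square_bij, of "\<lambda>v. of_bool (T (v / y) = 0)"])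
    also have "\<dots> = real (card {v \<in> {v \<in> W. T v = 0}. T (v / y) = 0})"
      by (subst real_card_eq_sum) auto
    also have "{v \<in> {v \<in> W. T v = 0}. T (v / y) = 0} = {v \<in> W. T v = 0 \<and> T (inverse y * v) = 0}"
      by (auto simp: divide_inverse mult.commute)
    also have "card \<dots> = 1"
    proof (rule card_W_two_lines)
      show "inverse y \<notin> Fs"
        using W_eq_of_ratio[OF W_1 y] False by (auto simp: divide_inverse)
    qed
    finally show ?thesis using False by simp
  qed
  have "(\<Sum>y\<in>W. \<Sum>w\<in>conic. of_bool (T (y * w'\<^sup>2) = 0 \<and> T (w\<^sup>2 / y) = 0) :: real)
      = (\<Sum>y\<in>W. of_bool (y \<in> L) * (\<Sum>w\<in>conic. of_bool (T (w\<^sup>2 / y) = 0)))"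
    unfolding sum_distrib_left
    by (intro sum.cong refl) (auto simp: L_def mult.commute)
  also have "\<dots> = (\<Sum>y\<in>W. of_bool (y \<in> L) * (if y = 1 then real q + 1 else 1))"
    by (intro sum.cong refl) (simp add: inner)
  also have "\<dots> = (\<Sum>y\<in>L. if y = 1 then real q + 1 else 1)"
    by (rule sum.mono_neutral_cong_right) (auto simp: L_def)
  also have "\<dots> = (\<Sum>y\<in>L. (if y = 1 then real q else 0) + 1)"
    by (intro sum.cong) auto
  also have "\<dots> = 2 * real q + 1"
    using L1 by (simp add: sum.distrib cL)
  finally show ?thesis .
qed

text \<open>Inclusion-exclusion over the N (q + 1) pairs: for each w either condition alone puts y
  on a line, which excludes (q + 1)^2 pairs.\<close>

lemma card_both_nonzero:
  assumes "w' \<in> conic"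
  shows "(\<Sum>y\<in>W. \<Sum>w\<in>conic. of_bool (T (y * w'\<^sup>2) \<noteq> 0 \<and> T (w\<^sup>2 / y) \<noteq> 0))
    = real N * (real q + 1) - 2 * (real q + 1)\<^sup>2 + (2 * real q + 1)"
proof -
  have w'0: "w'\<^sup>2 \<noteq> 0" using assms conic_W W_nonzero by force
  have 1: "(\<Sum>y\<in>W. \<Sum>w\<in>conic. of_bool (T (y * w'\<^sup>2) = 0)) = (real q + 1)\<^sup>2"
  proof -
    have "(\<Sum>y\<in>W. of_bool (T (y * w'\<^sup>2) = 0)) = real (q + 1)"
      using card_W_line[OF w'0] real_card_eq_sum[of W "\<lambda>y. T (y * w'\<^sup>2) = 0"]
      by (simp add: mult.commute)
    thus ?thesis by (subst sum.swap) (simp only: sum_constant card_conic power2_eq_square of_nat_add of_nat_1)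
  qed
  have 2: "(\<Sum>y\<in>W. \<Sum>w\<in>conic. of_bool (T (w\<^sup>2 / y) = 0)) = (real q + 1)\<^sup>2"
  proof -
    have "(\<Sum>y\<in>W. of_bool (T (w\<^sup>2 / y) = 0)) = real (q + 1)" if "w \<in> conic" for w
    proof -
      have "w\<^sup>2 \<noteq> 0" using that conic_W W_nonzero by force
      from card_W_line_inverse[OF this] show ?thesis
        using real_card_eq_sum[of W "\<lambda>y. T (w\<^sup>2 / y) = 0"] by simp
    qed
    hence "(\<Sum>w\<in>conic. \<Sum>y\<in>W. of_bool (T (w\<^sup>2 / y) = 0)) = (\<Sum>w\<in>conic. real (q + 1))"
      by (rule sum.cong[OF refl])
    thus ?thesis by (subst sum.swap) (simp only: sum_constant card_conic power2_eq_square of_nat_add of_nat_1)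
  qed
  have "(\<Sum>y\<in>W. \<Sum>w\<in>conic. of_bool (T (y * w'\<^sup>2) \<noteq> 0 \<and> T (w\<^sup>2 / y) \<noteq> 0) :: real)
    = (\<Sum>y\<in>W. \<Sum>w\<in>conic. 1 - of_bool (T (y * w'\<^sup>2) = 0) - of_bool (T (w\<^sup>2 / y) = 0)
        + of_bool (T (y * w'\<^sup>2) = 0 \<and> T (w\<^sup>2 / y) = 0))"
    by (intro sum.cong refl) auto
  also have "\<dots> = real N * (real q + 1) - 2 * (real q + 1)\<^sup>2 + (2 * real q + 1)"
    unfolding sum.distrib sum_subtractf 1 2 card_both_zero[OF assms] by (simp add: card_W card_conic)
  finally show ?thesis .
qed

text \<open>The correlation sums reduce the left side to row w' of the eigenvector relation. The
  term w = w' vanishes as T(w^2) = 0, and the q others are equal.\<close>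

lemma sum_Psi_conic:
  assumes "w' \<in> conic"
  shows "(\<Sum>y\<in>W. \<Sum>w\<in>conic. chi (h w) * (Psi (T (y * w'\<^sup>2)) * cnj (Psi (T (w\<^sup>2 / y)))))
    = of_nat (q\<^sup>2) * (Psi (- 1) * chi (h w'))"
proof -
  have w': "w' \<in> W" "w' \<noteq> 0" using assms conic_W W_nonzero by blast+
  have "(\<Sum>y\<in>W. \<Sum>w\<in>conic. chi (h w) * (Psi (T (y * w'\<^sup>2)) * cnj (Psi (T (w\<^sup>2 / y)))))
      = (\<Sum>w\<in>conic. chi (h w) * (\<Sum>y\<in>W. Psi (T (y * w'\<^sup>2)) * cnj (Psi (T (w\<^sup>2 / y)))))"
    by (subst sum.swap) (simp add: sum_distrib_left)
  also have "\<dots> = (\<Sum>w\<in>conic. chi (h w) * (of_nat q * (Psi (- 1) * chi (2 * T (w * w')))))"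
  proof (rule sum.cong[OF refl])
    fix w assume "w \<in> conic"
    hence w: "w \<in> W" "w \<noteq> 0" using conic_W W_nonzero by blast+
    \<comment> \<open>The substitution y = t w / w' makes the two arguments symmetric: m t and m / t
      with m = w w'.\<close>
    have "(\<Sum>y\<in>W. Psi (T (y * w'\<^sup>2)) * cnj (Psi (T (w\<^sup>2 / y))))
        = (\<Sum>t\<in>W. Psi (T (t * (w / w') * w'\<^sup>2)) * cnj (Psi (T (w\<^sup>2 / (t * (w / w'))))))"
      using sum.reindex_bij_betw[OF W_scale_bij[OF W_divide[OF w(1) w'(1)]],
        of "\<lambda>y. Psi (T (y * w'\<^sup>2)) * cnj (Psi (T (w\<^sup>2 / y)))"] by (rule sym)
    also have "\<dots> = (\<Sum>t\<in>W. Psi (T (w * w' * t)) * cnj (Psi (T (w * w' / t))))"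
    proof (rule sum.cong[OF refl])
      fix t assume "t \<in> W"
      hence "t \<noteq> 0" by (rule W_nonzero)
      hence "t * (w / w') * w'\<^sup>2 = w * w' * t" "w\<^sup>2 / (t * (w / w')) = w * w' / t"
        using w w' by (simp_all add: field_simps power2_eq_square)
      thus "Psi (T (t * (w / w') * w'\<^sup>2)) * cnj (Psi (T (w\<^sup>2 / (t * (w / w')))))
          = Psi (T (w * w' * t)) * cnj (Psi (T (w * w' / t)))" by simp
    qed
    also have "\<dots> = of_nat q * (Psi (- 1) * chi (2 * T (w * w')))"
      by (rule sum_Psi_correlation[OF W_mult[OF w(1) w'(1)]])
    finally show "chi (h w) * (\<Sum>y\<in>W. Psi (T (y * w'\<^sup>2)) * cnj (Psi (T (w\<^sup>2 / y))))
      = chi (h w) * (of_nat q * (Psi (- 1) * chi (2 * T (w * w'))))" by simp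
  qed
  also have "\<dots> = (\<Sum>w\<in>conic. if w = w' then 0 else of_nat q * (Psi (- 1) * chi (h w')))"
  proof (rule sum.cong[OF refl])
    fix w assume w: "w \<in> conic"
    show "chi (h w) * (of_nat q * (Psi (- 1) * chi (2 * T (w * w'))))
      = (if w = w' then 0 else of_nat q * (Psi (- 1) * chi (h w')))"
    proof (cases "w = w'")
      case True
      have "T (w * w') = 0" using conic_T[OF w] True by (simp add: power2_eq_square)
      thus ?thesis using True by simp
    next
      case False
      thus ?thesis using h_sign[OF w assms False] by (simp add: mult_ac)
    qed
  qed
  also have "\<dots> = (\<Sum>w\<in>conic - {w'}. of_nat q * (Psi (- 1) * chi (h w')))"
    by (rule sum.mono_neutral_cong_right) auto
  also have "\<dots> = of_nat (q\<^sup>2) * (Psi (- 1) * chi (h w'))"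
    using assms card_conic by (simp add: card_Diff_subset power2_eq_square)
  finally show ?thesis .
qed

lemma real_card_R: "real (card R) = (real q - 1) / 2"
proof -
  have "2 * real (card R) = real (q - 1)" unfolding card_R[symmetric] by simp
  thus ?thesis using q_gt_1 by (simp add: of_nat_diff)
qed

text \<open>For fixed y and w the equation is linear in r: two zero traces admit all of
  \<open>R\<close>, exactly one admits nothing, and otherwise there is a unique solution z in F*,
  tested by \<open>indicator_R\<close>. There are q^3 pairs of the last kind, and the
  \<open>Psi\<close> part adds q^2 times the indicator minus 1/2.\<close>

lemma count_solutions:
  assumes w': "w' \<in> conic" and g: "g \<in> Fu"
  shows "(\<Sum>y\<in>W. \<Sum>w\<in>conic. \<Sum>r\<in>R. of_bool (g * T (y * w'\<^sup>2) + (h w)\<^sup>2 * r * T (w\<^sup>2 / y) = 0))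
    = (real q ^ 2 - 1) * (real q + 1) / 2 + real q ^ 2 * of_bool (g / (h w')\<^sup>2 \<in> R)"
proof -
  define \<alpha> where "\<alpha> = (1 + \<i>) / 2"
  have "(\<Sum>r\<in>R. of_bool (g * T (y * w'\<^sup>2) + (h w)\<^sup>2 * r * T (w\<^sup>2 / y) = 0))
    = of_bool (T (y * w'\<^sup>2) \<noteq> 0 \<and> T (w\<^sup>2 / y) \<noteq> 0) / 2
      + of_bool (T (y * w'\<^sup>2) = 0 \<and> T (w\<^sup>2 / y) = 0) * ((real q - 1) / 2)
      + Re (\<alpha> * (Psi (- 1) * Psi g) * (chi (h w) * (Psi (T (y * w'\<^sup>2)) * cnj (Psi (T (w\<^sup>2 / y))))))"
    (is "?S = ?rhs") if w: "w \<in> conic" for y w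
  proof -
    define a where "a = T (y * w'\<^sup>2)"
    define b where "b = T (w\<^sup>2 / y)"
    have ab: "a \<in> Fs" "b \<in> Fs" by (simp_all add: a_def b_def T_Fs)
    have hw: "h w \<in> Fu" "h w \<noteq> 0" using h_Fu[OF w] Fu_nonzero by blast+
    have g0: "g \<noteq> 0" using g Fu_nonzero by blast
    consider "a = 0" "b = 0" | "a = 0" "b \<noteq> 0" | "a \<noteq> 0" "b = 0" | "a \<noteq> 0" "b \<noteq> 0" by blast
    hence "(\<Sum>r\<in>R. of_bool (g * a + (h w)\<^sup>2 * r * b = 0))
      = of_bool (a \<noteq> 0 \<and> b \<noteq> 0) / 2 + of_bool (a = 0 \<and> b = 0) * ((real q - 1) / 2)
      + Re (\<alpha> * (Psi (- 1) * Psi g) * (chi (h w) * (Psi a * cnj (Psi b))))"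
    proof cases
      case 1
      thus ?thesis by (simp add: real_card_R)
    next
      case 2
      have "r \<in> R \<Longrightarrow> r \<noteq> 0" for r using R_Fu Fu_nonzero by blast
      thus ?thesis using 2 hw by (auto intro!: sum.neutral)
    next
      case 3
      thus ?thesis using g0 by (auto intro!: sum.neutral)
    next
      case 4
      define z where "z = - (g * a / ((h w)\<^sup>2 * b))"
      have z: "z \<in> Fu" unfolding z_def
        using 4 by (intro Fu_minus Fu_divide Fu_mult[OF g] Fu_mult[OF Fu_power[OF hw(1)]] Fu_I ab)
      have eq: "g * a + (h w)\<^sup>2 * r * b = 0 \<longleftrightarrow> r = z" for r
      proof -
        have "g * a = - z * ((h w)\<^sup>2 * b)" using 4 hw by (simp add: z_def)
        hence "g * a + (h w)\<^sup>2 * r * b = (r - z) * ((h w)\<^sup>2 * b)" by (simp add: algebra_simps)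
        thus ?thesis using 4 hw by simp
      qed
      have "(\<Sum>r\<in>R. of_bool (g * a + (h w)\<^sup>2 * r * b = 0)) = (\<Sum>r\<in>R. if r = z then 1 else 0 :: real)"
        unfolding eq by (intro sum.cong) auto
      also have "\<dots> = of_bool (z \<in> R)" by simp
      also have "\<dots> = 1 / 2 + Re (\<alpha> * Psi z)" unfolding \<alpha>_def by (rule indicator_R[OF z])
      also have "Psi z = Psi (- 1) * Psi g * (chi (h w) * (Psi a * cnj (Psi b)))"
        unfolding z_def by (subst Psi_minus) (simp add: Psi_divide Psi_mult Psi_square cnj_chi)
      finally show ?thesis using 4 by (simp add: mult.assoc)
    qed
    thus ?thesis by (simp add: a_def b_def)
  qed
  hence "(\<Sum>y\<in>W. \<Sum>w\<in>conic. \<Sum>r\<in>R. of_bool (g * T (y * w'\<^sup>2) + (h w)\<^sup>2 * r * T (w\<^sup>2 / y) = 0))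
    = (\<Sum>y\<in>W. \<Sum>w\<in>conic. of_bool (T (y * w'\<^sup>2) \<noteq> 0 \<and> T (w\<^sup>2 / y) \<noteq> 0)) / 2
      + (\<Sum>y\<in>W. \<Sum>w\<in>conic. of_bool (T (y * w'\<^sup>2) = 0 \<and> T (w\<^sup>2 / y) = 0)) * ((real q - 1) / 2)
      + Re (\<alpha> * (Psi (- 1) * Psi g) *
          (\<Sum>y\<in>W. \<Sum>w\<in>conic. chi (h w) * (Psi (T (y * w'\<^sup>2)) * cnj (Psi (T (w\<^sup>2 / y))))))"
    unfolding sum_divide_distrib sum_distrib_right sum_distrib_left Re_sum
    by (simp only: sum.distrib cong: sum.cong)
  also have "\<dots> = (real N * (real q + 1) - 2 * (real q + 1)\<^sup>2 + (2 * real q + 1)) / 2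
      + (2 * real q + 1) * ((real q - 1) / 2)
      + Re (\<alpha> * (Psi (- 1) * Psi g) * (of_nat (q\<^sup>2) * (Psi (- 1) * chi (h w'))))"
    unfolding card_both_nonzero[OF w'] card_both_zero[OF w'] sum_Psi_conic[OF w'] by (rule refl)
  \<comment> \<open>One factor Psi(-1) comes from the sign of z, the other from the correlation
    sums; they cancel.\<close>
  also have "\<alpha> * (Psi (- 1) * Psi g) * (of_nat (q\<^sup>2) * (Psi (- 1) * chi (h w')))
      = of_nat (q\<^sup>2) * (\<alpha> * ((Psi (- 1) * Psi (- 1)) * Psi (g / (h w')\<^sup>2)))"
    by (simp add: Psi_divide Psi_square cnj_chi)
  also have "Re \<dots> = real q ^ 2 * Re (\<alpha> * Psi (g / (h w')\<^sup>2))"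
    unfolding Psi_neg_1_self by simp
  also have "Re (\<alpha> * Psi (g / (h w')\<^sup>2)) = of_bool (g / (h w')\<^sup>2 \<in> R) - 1 / 2"
    unfolding \<alpha>_def using indicator_R[OF Fu_divide[OF g Fu_power[OF h_Fu[OF w']]]] by simp
  finally show ?thesis by (simp add: N_def field_simps power2_eq_square)
qed

section \<open>The vectors of D in coordinates, and the count of those perpendicular to a singular
  vector\<close>

definition tight_vector :: "'a \<Rightarrow> 'a \<Rightarrow> 'a \<Rightarrow> 'a \<Rightarrow> 'a \<times> 'a" where
  "tight_vector x y w r = (x * y, x * inverse y * (w\<^sup>2 * (h w)\<^sup>2 * r))"

definition tight_vectors :: "('a \<times> 'a) set" where
  "tight_vectors = {tight_vector x y w r |x y w r. x \<in> Fu \<and> y \<in> W \<and> w \<in> conic \<and> r \<in> R}"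

text \<open>The decomposition into F* and W is used twice: on the first coordinate it yields x and
  y, on the remaining factor of the second it yields h(w)^2 r and w^2.\<close>

lemma tight_vector_inj:
  assumes "tight_vector x y w r = tight_vector x' y' w' r'"
    and "x \<in> Fu" "y \<in> W" "w \<in> conic" "r \<in> R" "x' \<in> Fu" "y' \<in> W" "w' \<in> conic" "r' \<in> R"
  shows "x = x'" "y = y'" "w = w'" "r = r'"
proof -
  have "x * y = x' * y'" using assms(1) by (simp add: tight_vector_def)
  from Fu_W_unique[OF assms(2,3,6,7) this] show xy: "x = x'" "y = y'" by blast+
  have "x * inverse y \<noteq> 0" using assms Fu_nonzero W_nonzero by simp
  hence "((h w)\<^sup>2 * r) * w\<^sup>2 = ((h w')\<^sup>2 * r') * w'\<^sup>2"
    using assms(1) xy by (simp add: tight_vector_def mult_ac)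
  moreover have hr: "(h w)\<^sup>2 * r \<in> Fu" "(h w')\<^sup>2 * r' \<in> Fu"
    using assms Fu_mult[OF Fu_power[OF h_Fu]] R_Fu by blast+
  ultimately have "(h w)\<^sup>2 * r = (h w')\<^sup>2 * r'" "w\<^sup>2 = w'\<^sup>2"
    using Fu_W_unique[OF hr(1) W_power[OF conic_W[OF assms(4)]] hr(2) W_power[OF conic_W[OF assms(8)]]]
    by blast+
  thus "w = w'" using inj_onD[OF W_square_inj] conic_W assms(4,8) by blast
  thus "r = r'" using \<open>(h w)\<^sup>2 * r = (h w')\<^sup>2 * r'\<close> Fu_nonzero[OF h_Fu[OF assms(8)]] by simp
qed

lemma sum_tight_vectors:
  fixes f :: "'a \<times> 'a \<Rightarrow> 'b::comm_monoid_add"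
  shows "(\<Sum>v\<in>tight_vectors. f v)
    = (\<Sum>x\<in>Fu. \<Sum>y\<in>W. \<Sum>w\<in>conic. \<Sum>r\<in>R. f (tight_vector x y w r))"
proof -
  let ?P = "Fu \<times> W \<times> conic \<times> R"
  let ?t = "\<lambda>(x, y, w, r). tight_vector x y w r"
  have "inj_on ?t ?P"
  proof (rule inj_onI)
    fix z z' assume *: "z \<in> ?P" "z' \<in> ?P" "?t z = ?t z'"
    obtain x y w r x' y' w' r' where z: "z = (x, y, w, r)" "z' = (x', y', w', r')"
      by (cases z, cases z') blast
    have "tight_vector x y w r = tight_vector x' y' w' r'"
      "x \<in> Fu" "y \<in> W" "w \<in> conic" "r \<in> R" "x' \<in> Fu" "y' \<in> W" "w' \<in> conic" "r' \<in> R"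
      using * unfolding z by auto
    from tight_vector_inj[OF this] show "z = z'" unfolding z by blast
  qed
  moreover have "tight_vectors = ?t ` ?P" by (force simp: tight_vectors_def)
  ultimately have "(\<Sum>v\<in>tight_vectors. f v) = (\<Sum>z\<in>?P. f (?t z))" by (simp add: sum.reindex)
  also have "\<dots> = (\<Sum>x\<in>Fu. \<Sum>y\<in>W. \<Sum>w\<in>conic. \<Sum>r\<in>R. f (tight_vector x y w r))"
    by (simp add: sum.cartesian_product case_prod_unfold)
  finally show ?thesis .
qed

lemma card_tight_vectors: "2 * card tight_vectors = (q - 1) * ((q\<^sup>2 - 1) * N)"
proof -
  have "card tight_vectors = (q - 1) * (N * ((q + 1) * card R))"
    using sum_tight_vectors[of "\<lambda>v. 1 :: nat"] by (simp add: card_Fu card_W card_conic)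
  hence "2 * card tight_vectors = (q - 1) * (N * ((q + 1) * (2 * card R)))" by simp
  also have "(q + 1) * (2 * card R) = q\<^sup>2 - 1"
    unfolding card_R by (cases q) (auto simp: power2_eq_square)
  finally show ?thesis by (simp only: mult_ac)
qed

lemma tight_vector_isotropic:
  assumes "v \<in> tight_vectors" shows "fst v \<noteq> 0" "T (fst v * snd v) = 0"
proof -
  obtain x y w r where v: "v = tight_vector x y w r" and
    *: "x \<in> Fu" "y \<in> W" "w \<in> conic" "r \<in> R" using assms by (auto simp: tight_vectors_def)
  show "fst v \<noteq> 0" using * by (simp add: v tight_vector_def Fu_nonzero W_nonzero)
  have "fst v * snd v = (x\<^sup>2 * (h w)\<^sup>2 * r) * w\<^sup>2"
    using W_nonzero[OF *(2)] by (simp add: v tight_vector_def power2_eq_square field_simps)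
  moreover have "x\<^sup>2 * (h w)\<^sup>2 * r \<in> Fs"
    using * by (intro Fs_mult Fu_Fs[OF Fu_power] Fu_Fs[OF R_Fu] h_Fu)
  ultimately show "T (fst v * snd v) = 0" using conic_T[OF *(3)] by (simp only: T_scale) simp
qed

lemma tight_vectors_scale:
  assumes "c \<in> Fu" "(a, b) \<in> tight_vectors" shows "(c * a, c * b) \<in> tight_vectors"
proof -
  obtain x y w r where v: "(a, b) = tight_vector x y w r" and
    *: "x \<in> Fu" "y \<in> W" "w \<in> conic" "r \<in> R" using assms by (auto simp: tight_vectors_def)
  have "(c * a, c * b) = tight_vector (c * x) y w r"
    using v by (simp add: tight_vector_def mult.assoc)
  thus ?thesis using * Fu_mult[OF assms(1) *(1)] by (auto simp: tight_vectors_def)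
qed

lemma sum_W_line: "c \<noteq> 0 \<Longrightarrow> (\<Sum>y\<in>W. of_bool (T (y * c) = 0)) = real q + 1"
  using card_W_line[of c] real_card_eq_sum[of W "\<lambda>y. T (y * c) = 0"] by (simp add: mult.commute)

lemma sum_W_line_inverse: "c \<noteq> 0 \<Longrightarrow> (\<Sum>y\<in>W. of_bool (T (c / y) = 0)) = real q + 1"
  using card_W_line_inverse[of c] real_card_eq_sum[of W "\<lambda>y. T (c / y) = 0"] by simp

text \<open>The condition is perpendicularity for the polar form; it is homogeneous in the parameter
  x, whence the factor q - 1. If a or b is zero, only one trace survives and every choice of w and r
  leaves a line of q + 1 values of y. Otherwise the vector is normalised for
  \<open>count_solutions\<close>.\<close>

theorem card_tight_vectors_perp:
  assumes "(a, b) \<noteq> 0" "T (a * b) = 0"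
  shows "real (card {v \<in> tight_vectors. T (fst v * b + snd v * a) = 0})
    = real (q - 1) * ((real q ^ 2 - 1) * (real q + 1) / 2 + real q ^ 2 * of_bool ((a, b) \<in> tight_vectors))"
proof -
  define S where "S = (\<Sum>y\<in>W. \<Sum>w\<in>conic. \<Sum>r\<in>R. of_bool (T (y * b) + (h w)\<^sup>2 * r * T (w\<^sup>2 * a / y) = 0) :: real)"
  have "real (card {v \<in> tight_vectors. T (fst v * b + snd v * a) = 0})
      = (\<Sum>x\<in>Fu. \<Sum>y\<in>W. \<Sum>w\<in>conic. \<Sum>r\<in>R.
          of_bool (T (fst (tight_vector x y w r) * b + snd (tight_vector x y w r) * a) = 0))"
    by (simp add: real_card_eq_sum sum_tight_vectors)
  also have "\<dots> = (\<Sum>x\<in>Fu. S)"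
    unfolding S_def
  proof (intro sum.cong refl)
    fix x y w r assume *: "x \<in> Fu" "y \<in> W" "w \<in> conic" "r \<in> R"
    have hr: "(h w)\<^sup>2 * r \<in> Fs" using * by (intro Fs_mult Fu_Fs[OF Fu_power] Fu_Fs[OF R_Fu] h_Fu)
    have "fst (tight_vector x y w r) * b + snd (tight_vector x y w r) * a
        = x * (y * b + (h w)\<^sup>2 * r * (w\<^sup>2 * a / y))"
      using W_nonzero[OF *(2)] by (simp add: tight_vector_def field_simps)
    hence "T (fst (tight_vector x y w r) * b + snd (tight_vector x y w r) * a)
        = x * (T (y * b) + (h w)\<^sup>2 * r * T (w\<^sup>2 * a / y))"
      by (simp only: T_scale[OF Fu_Fs[OF *(1)]] T_scale[OF hr] T_add)
    thus "of_bool (T (fst (tight_vector x y w r) * b + snd (tight_vector x y w r) * a) = 0)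
        = (of_bool (T (y * b) + (h w)\<^sup>2 * r * T (w\<^sup>2 * a / y) = 0) :: real)"
      using Fu_nonzero[OF *(1)] by simp
  qed
  also have "\<dots> = real (q - 1) * S" by (simp add: card_Fu)
  also have "S = (real q ^ 2 - 1) * (real q + 1) / 2 + real q ^ 2 * of_bool ((a, b) \<in> tight_vectors)"
  proof -
    consider "a = 0" "b \<noteq> 0" | "a \<noteq> 0" "b = 0" | "a \<noteq> 0" "b \<noteq> 0" using assms(1) by (auto simp: zero_prod_def)
    thus ?thesis
    proof cases
      case 1
      hence "(a, b) \<notin> tight_vectors" using tight_vector_isotropic(1)[of "(a, b)"] by auto
      moreover have "S = (\<Sum>y\<in>W. of_bool (T (y * b) = 0)) * (real (card conic) * real (card R))"
        unfolding S_def sum_distrib_right using 1 by (simp add: mult_ac del: sum_of_bool_eq)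
      ultimately show ?thesis
        by (simp add: sum_W_line[OF 1(2)] card_conic real_card_R power2_eq_square field_simps)
    next
      case 2
      have notin: "(a, b) \<notin> tight_vectors"
      proof -
        have "b \<noteq> 0" if ab: "(a, b) \<in> tight_vectors"
        proof -
          obtain x y w r where "(a, b) = tight_vector x y w r" and
            *: "x \<in> Fu" "y \<in> W" "w \<in> conic" "r \<in> R" using ab by (auto simp: tight_vectors_def)
          thus "b \<noteq> 0" using Fu_nonzero[OF h_Fu[OF *(3)]] Fu_nonzero[OF R_Fu[OF *(4)]]
             Fu_nonzero[OF *(1)] W_nonzero[OF *(2)] W_nonzero[OF conic_W[OF *(3)]]
            by (simp add: tight_vector_def)
        qed
        thus ?thesis using 2 by blast
      qed
      have "S = (\<Sum>y\<in>W. \<Sum>w\<in>conic. \<Sum>r\<in>R. of_bool (T (w\<^sup>2 * a / y) = 0))"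
        unfolding S_def
      proof (intro sum.cong refl)
        fix y w r assume *: "w \<in> conic" "r \<in> R"
        show "of_bool (T (y * b) + (h w)\<^sup>2 * r * T (w\<^sup>2 * a / y) = 0) = (of_bool (T (w\<^sup>2 * a / y) = 0) :: real)"
          using 2 Fu_nonzero[OF h_Fu[OF *(1)]] Fu_nonzero[OF R_Fu[OF *(2)]] by simp
      qed
      also have "\<dots> = (\<Sum>w\<in>conic. (\<Sum>y\<in>W. of_bool (T (w\<^sup>2 * a / y) = 0)) * real (card R))"
      proof -
        have "(\<Sum>y\<in>W. \<Sum>w\<in>conic. \<Sum>r\<in>R. of_bool (T (w\<^sup>2 * a / y) = 0))
            = (\<Sum>y\<in>W. \<Sum>w\<in>conic. of_bool (T (w\<^sup>2 * a / y) = 0) * real (card R))"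
          by (simp add: mult.commute)
        also have "\<dots> = (\<Sum>w\<in>conic. \<Sum>y\<in>W. of_bool (T (w\<^sup>2 * a / y) = 0) * real (card R))"
          by (rule sum.swap)
        finally show ?thesis by (simp only: sum_distrib_right)
      qed
      also have "\<dots> = (\<Sum>w\<in>conic. (real q + 1) * real (card R))"
      proof (rule sum.cong[OF refl])
        fix w assume "w \<in> conic"
        hence "w\<^sup>2 * a \<noteq> 0" using 2 W_nonzero[OF conic_W] by simp
        from sum_W_line_inverse[OF this]
        show "(\<Sum>y\<in>W. of_bool (T (w\<^sup>2 * a / y) = 0)) * real (card R) = (real q + 1) * real (card R)"
          by simp
      qed
      finally show ?thesis using notin
        by (simp add: card_conic real_card_R power2_eq_square field_simps)
    next
      case 3
      \<comment> \<open>The vector is written like a tight vector, with a free g of F* in place of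
        h(w')^2 r. Singularity makes the W component of the second coordinate the square of a conic
        point w', and membership becomes g / h(w')^2 in \<open>R\<close>.\<close>
      obtain x\<^sub>0 y\<^sub>0 where a: "x\<^sub>0 \<in> Fu" "y\<^sub>0 \<in> W" "a = x\<^sub>0 * y\<^sub>0" using Fu_W_decomp[OF 3(1)] by blast
      have nz: "x\<^sub>0 \<noteq> 0" "y\<^sub>0 \<noteq> 0" using a Fu_nonzero W_nonzero by blast+
      have "b * y\<^sub>0 / x\<^sub>0 \<noteq> 0" using 3 nz by simp
      then obtain g v where gv: "g \<in> Fu" "v \<in> W" "b * y\<^sub>0 / x\<^sub>0 = g * v" using Fu_W_decomp by blast
      have b: "b = x\<^sub>0 * inverse y\<^sub>0 * (g * v)" using gv(3) nz by (simp add: field_simps)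
      have "a * b = (x\<^sub>0\<^sup>2 * g) * v" using nz by (simp add: a(3) b power2_eq_square field_simps)
      hence "(x\<^sub>0\<^sup>2 * g) * T v = 0"
        using assms(2) T_scale[OF Fu_Fs[OF Fu_mult[OF Fu_power[OF a(1), of 2] gv(1)]], of v] by simp
      hence "T v = 0" using nz Fu_nonzero[OF gv(1)] by simp
      moreover obtain w' where w': "w' \<in> W" "v = w'\<^sup>2" using W_sqrt[OF gv(2)] by blast
      ultimately have w'c: "w' \<in> conic" by (simp add: conic_def)
      have "S = (\<Sum>y\<in>W. \<Sum>w\<in>conic. \<Sum>r\<in>R.
          of_bool (T (y * y\<^sub>0 * b) + (h w)\<^sup>2 * r * T (w\<^sup>2 * a / (y * y\<^sub>0)) = 0))"
        unfolding S_def
        by (rule sum.reindex_bij_betw[OF W_scale_bij[OF a(2)], symmetric])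
      also have "\<dots> = (\<Sum>y\<in>W. \<Sum>w\<in>conic. \<Sum>r\<in>R.
          of_bool (g * T (y * w'\<^sup>2) + (h w)\<^sup>2 * r * T (w\<^sup>2 / y) = 0))"
      proof (intro sum.cong refl)
        fix y w r
        have "y * y\<^sub>0 * b = x\<^sub>0 * (g * (y * w'\<^sup>2))" using nz by (simp add: b w'(2) field_simps)
        moreover have "w\<^sup>2 * a / (y * y\<^sub>0) = x\<^sub>0 * (w\<^sup>2 / y)" using nz by (simp add: a(3))
        ultimately have "T (y * y\<^sub>0 * b) + (h w)\<^sup>2 * r * T (w\<^sup>2 * a / (y * y\<^sub>0))
            = x\<^sub>0 * (g * T (y * w'\<^sup>2) + (h w)\<^sup>2 * r * T (w\<^sup>2 / y))"
          by (simp only: T_scale[OF Fu_Fs[OF a(1)]] T_scale[OF Fu_Fs[OF gv(1)]] distrib_left mult_ac)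
        thus "of_bool (T (y * y\<^sub>0 * b) + (h w)\<^sup>2 * r * T (w\<^sup>2 * a / (y * y\<^sub>0)) = 0)
            = (of_bool (g * T (y * w'\<^sup>2) + (h w)\<^sup>2 * r * T (w\<^sup>2 / y) = 0) :: real)"
          using nz by simp
      qed
      also have "\<dots> = (real q ^ 2 - 1) * (real q + 1) / 2 + real q ^ 2 * of_bool (g / (h w')\<^sup>2 \<in> R)"
        by (rule count_solutions[OF w'c gv(1)])
      also have "g / (h w')\<^sup>2 \<in> R \<longleftrightarrow> (a, b) \<in> tight_vectors"
      proof
        assume R: "g / (h w')\<^sup>2 \<in> R"
        have "(a, b) = tight_vector x\<^sub>0 y\<^sub>0 w' (g / (h w')\<^sup>2)"
          using Fu_nonzero[OF h_Fu[OF w'c]] by (simp add: tight_vector_def a(3) b w'(2))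
        thus "(a, b) \<in> tight_vectors" using R a w'c by (auto simp: tight_vectors_def)
      next
        assume "(a, b) \<in> tight_vectors"
        then obtain x y w r where ab: "(a, b) = tight_vector x y w r" and
          *: "x \<in> Fu" "y \<in> W" "w \<in> conic" "r \<in> R" by (auto simp: tight_vectors_def)
        have xy: "x = x\<^sub>0" "y = y\<^sub>0"
          using Fu_W_unique[OF *(1,2) a(1,2)] ab a(3) by (auto simp: tight_vector_def)
        have "x\<^sub>0 * inverse y\<^sub>0 * (g * w'\<^sup>2) = x\<^sub>0 * inverse y\<^sub>0 * (w\<^sup>2 * (h w)\<^sup>2 * r)"
          using ab unfolding tight_vector_def xy by (simp add: b w'(2))
        hence eq: "g * w'\<^sup>2 = ((h w)\<^sup>2 * r) * w\<^sup>2" using nz by (simp add: mult_ac)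
        have hr: "(h w)\<^sup>2 * r \<in> Fu" using * Fu_mult[OF Fu_power[OF h_Fu]] R_Fu by blast
        from Fu_W_unique[OF gv(1) W_power[OF w'(1)] hr W_power[OF conic_W[OF *(3)]] eq]
        have "g = (h w)\<^sup>2 * r" "w' = w"
          using inj_onD[OF W_square_inj] w'(1) conic_W[OF *(3)] by blast+
        thus "g / (h w')\<^sup>2 \<in> R" using *(4) Fu_nonzero[OF h_Fu[OF *(3)]] by simp
      qed
      finally show ?thesis .
    qed
  qed
  finally show ?thesis .
qed

end

section \<open>The Klein correspondence\<close>

lemma exhaust_6:
  fixes x :: 6
  shows "x = 1 \<or> x = 2 \<or> x = 3 \<or> x = 4 \<or> x = 5 \<or> x = 6"
proof (induct x)
  case (of_int z)
  then have "0 \<le> z" and "z < 6" by simp_all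
  then have "z = 0 \<or> z = 1 \<or> z = 2 \<or> z = 3 \<or> z = 4 \<or> z = 5" by arith
  then show ?case by auto
qed

lemma forall_6: "(\<forall>i::6. P i) \<longleftrightarrow> P 1 \<and> P 2 \<and> P 3 \<and> P 4 \<and> P 5 \<and> P 6"
  by (metis exhaust_6)

lemmas vec6_eq = vec_eq_iff[where 'b = 6, unfolded forall_6]
lemmas vec4_eq = vec_eq_iff[where 'b = 4, unfolded forall_4]

lemma vector_4:
  "(vector [a, b, c, d] :: 'a::zero ^ 4) $ 1 = a" "(vector [a, b, c, d] :: 'a::zero ^ 4) $ 2 = b"
  "(vector [a, b, c, d] :: 'a::zero ^ 4) $ 3 = c" "(vector [a, b, c, d] :: 'a::zero ^ 4) $ 4 = d"
  by (simp_all add: vector_def)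

lemma pluecker_comps:
  "pluecker u v $ 1 = u$1 * v$2 - u$2 * v$1" "pluecker u v $ 2 = u$1 * v$3 - u$3 * v$1"
  "pluecker u v $ 3 = u$1 * v$4 - u$4 * v$1" "pluecker u v $ 4 = u$2 * v$3 - u$3 * v$2"
  "pluecker u v $ 5 = u$2 * v$4 - u$4 * v$2" "pluecker u v $ 6 = u$3 * v$4 - u$4 * v$3"
  by (simp_all add: pluecker_def vector_6)

definition klein_bilinear :: "'f::field ^ 6 \<Rightarrow> 'f ^ 6 \<Rightarrow> 'f" where
  "klein_bilinear p r = p$1 * r$6 + p$6 * r$1 - p$2 * r$5 - p$5 * r$2 + p$3 * r$4 + p$4 * r$3"

lemma klein_form_add: "klein_form (p + r) = klein_form p + klein_form r + klein_bilinear p r"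
  by (simp add: klein_form_def klein_bilinear_def algebra_simps)

text \<open>The coordinates 123, 124, 134, 234 of the exterior product \<open>p \<and> x\<close>, so that for decomposable
  \<open>p\<close> the kernel of \<open>wedge3 p\<close> is the line with Pluecker coordinates \<open>p\<close>.\<close>
definition wedge3 :: "'f::field ^ 6 \<Rightarrow> 'f ^ 4 \<Rightarrow> 'f ^ 4" where
  "wedge3 p x = vector [p$1 * x$3 - p$2 * x$2 + p$4 * x$1, p$1 * x$4 - p$3 * x$2 + p$5 * x$1,
                        p$2 * x$4 - p$3 * x$3 + p$6 * x$1, p$4 * x$4 - p$5 * x$3 + p$6 * x$2]"

lemma wedge3_comps:
  "wedge3 p x $ 1 = p$1 * x$3 - p$2 * x$2 + p$4 * x$1"
  "wedge3 p x $ 2 = p$1 * x$4 - p$3 * x$2 + p$5 * x$1"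
  "wedge3 p x $ 3 = p$2 * x$4 - p$3 * x$3 + p$6 * x$1"
  "wedge3 p x $ 4 = p$4 * x$4 - p$5 * x$3 + p$6 * x$2"
  by (simp_all add: wedge3_def vector_def)

lemma wedge3_linear: "wedge3 p (a *s x + b *s y) = a *s wedge3 p x + b *s wedge3 p y"
  by (simp add: vec4_eq wedge3_comps algebra_simps)

lemma pluecker_combination:
  "pluecker (a *s u + b *s v) (c *s u + d *s v) = (a * d - b * c) *s pluecker u v"
  by (simp add: vec6_eq pluecker_comps algebra_simps)

lemma wedge3_pluecker_combination: "wedge3 (pluecker u v) (a *s u + b *s v) = 0"
  by (simp add: vec4_eq wedge3_comps pluecker_comps algebra_simps)

text \<open>Some 2 by 2 minor is nonzero. Cramer's rule in its two coordinates gives a and b, and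
  the two components of \<open>wedge3\<close> that involve this minor give the other two coordinates
  of x.\<close>

lemma wedge3_pluecker_eq_0_imp:
  fixes u v :: "'f::field ^ 4"
  assumes "pluecker u v \<noteq> 0" "wedge3 (pluecker u v) x = 0"
  obtains (comb) a b where "x = a *s u + b *s v"
proof -
  have w0: "wedge3 (pluecker u v) x $ k = 0" for k using assms(2) by simp
  note w = w0[of 1, unfolded wedge3_comps pluecker_comps] w0[of 2, unfolded wedge3_comps pluecker_comps]
    w0[of 3, unfolded wedge3_comps pluecker_comps] w0[of 4, unfolded wedge3_comps pluecker_comps]
  have minor: thesis
    if "u$i * v$j - u$j * v$i \<noteq> 0"
      and "\<forall>k. (u$i * v$j - u$j * v$i) * x$k = (x$i * v$j - x$j * v$i) * u$k + (u$i * x$j - u$j * x$i) * v$k"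
    for i j
  proof -
    define p where "p = u$i * v$j - u$j * v$i"
    have "x $ k = (x$i * v$j - x$j * v$i) / p * u$k + (u$i * x$j - u$j * x$i) / p * v$k" for k
    proof -
      have "x $ k = p * x $ k / p" using that(1) by (simp add: p_def)
      thus ?thesis using that(2) by (simp add: p_def add_divide_distrib)
    qed
    hence "x = ((x$i * v$j - x$j * v$i) / p) *s u + ((u$i * x$j - u$j * x$i) / p) *s v"
      unfolding vec_eq_iff vector_add_component vector_smult_component by blast
    thus thesis by (rule comb)
  qed
  consider "u$1 * v$2 - u$2 * v$1 \<noteq> 0" | "u$1 * v$3 - u$3 * v$1 \<noteq> 0" | "u$1 * v$4 - u$4 * v$1 \<noteq> 0" | "u$2 * v$3 - u$3 * v$2 \<noteq> 0" | "u$2 * v$4 - u$4 * v$2 \<noteq> 0" | "u$3 * v$4 - u$4 * v$3 \<noteq> 0"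
    using assms(1) unfolding vec6_eq pluecker_comps zero_index by blast
  thus thesis
  proof cases
    case 1
    show thesis
      by (rule minor[OF 1], unfold forall_4) (intro conjI; (algebra | (use w(1) in algebra) | (use w(2) in algebra)))
  next
    case 2
    show thesis
      by (rule minor[OF 2], unfold forall_4) (intro conjI; (algebra | (use w(1) in algebra) | (use w(3) in algebra)))
  next
    case 3
    show thesis
      by (rule minor[OF 3], unfold forall_4) (intro conjI; (algebra | (use w(2) in algebra) | (use w(3) in algebra)))
  next
    case 4
    show thesis
      by (rule minor[OF 4], unfold forall_4) (intro conjI; (algebra | (use w(1) in algebra) | (use w(4) in algebra)))
  next
    case 5
    show thesis
      by (rule minor[OF 5], unfold forall_4) (intro conjI; (algebra | (use w(2) in algebra) | (use w(4) in algebra)))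
  next
    case 6
    show thesis
      by (rule minor[OF 6], unfold forall_4) (intro conjI; (algebra | (use w(3) in algebra) | (use w(4) in algebra)))
  qed
qed

text \<open>A nonzero coordinate of u, and the matching one of v with sign changed, serve as
  coefficients: the combination then has vanishing minors as coordinates.\<close>

lemma pluecker_eq_0_imp:
  fixes u v :: "'f::field ^ 4"
  assumes "pluecker u v = 0"
  obtains a b where "a \<noteq> 0 \<or> b \<noteq> 0" "a *s u + b *s v = 0"
proof (cases "u = 0")
  case True
  thus ?thesis using that[of 1 0] by simp
next
  case False
  then obtain i where i: "u $ i \<noteq> 0" by (auto simp: vec_eq_iff)
  have "u $ i * v $ k - u $ k * v $ i = 0" for k
    using assms exhaust_4[of i] exhaust_4[of k] by (auto simp: vec6_eq pluecker_comps)
  hence "(- v $ i) *s u + u $ i *s v = 0" by (simp add: vec_eq_iff algebra_simps)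
  thus ?thesis using that[of "- v $ i" "u $ i"] i by blast
qed

text \<open>Here \<open>klein_bilinear\<close> is the determinant of u, v, x, y. If it vanishes, x
  and y are dependent modulo u and v, and so are their exterior products with the bivector of u and
  v.\<close>

lemma pluecker_wedge3:
  assumes "p = pluecker u v" "klein_bilinear p (pluecker x y) = 0"
  shows "pluecker (wedge3 p x) (wedge3 p y) = 0"
  using assms(2) unfolding assms(1) vec6_eq klein_bilinear_def pluecker_comps wedge3_comps zero_index
  by (intro conjI; algebra)

section \<open>Lines of PG(3,q) as points of the Klein quadric\<close>

lemma span_pair: "vec.span {u, v} = {a *s u + b *s v |a b. True}"
  by (auto simp: vec.span_insert vec.span_singleton) (metis add.commute diff_add_cancel, metis add_diff_cancel_left')

lemma independent_pair:
  fixes u v :: "'f::field ^ 4"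
  assumes "pluecker u v \<noteq> 0"
  shows "vec.independent {u, v}" "u \<noteq> v"
proof -
  show uv: "u \<noteq> v"
    using assms by (auto simp: vec6_eq pluecker_comps)
  have "v \<noteq> 0" using assms by (auto simp: vec6_eq pluecker_comps)
  moreover have "u \<notin> vec.span {v}"
  proof
    assume "u \<in> vec.span {v}"
    then obtain c where "u = c *s v" by (auto simp: vec.span_singleton)
    thus False using assms by (auto simp: vec6_eq pluecker_comps)
  qed
  ultimately show "vec.independent {u, v}"
    by (intro vec.independent_insertI vec.independent_empty) (simp_all add: vec.span_empty)
qed

text \<open>Nonvanishing Pluecker coordinates stand for linear independence, which removes
  dimensions from the later arguments.\<close>

lemma pg_line_iff:
  "l \<in> pg_lines \<longleftrightarrow> (\<exists>u v. pluecker u v \<noteq> 0 \<and> l = vec.span {u, v})"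
proof
  assume "l \<in> pg_lines"
  hence l: "vec.subspace l" "vec.dim l = 2" by (auto simp: pg_lines_def)
  obtain B where B: "B \<subseteq> l" "vec.independent B" "l \<subseteq> vec.span B" "card B = vec.dim l"
    using vec.basis_exists by blast
  obtain u v where uv: "B = {u, v}" "u \<noteq> v" using B(4) l(2) by (auto simp: card_2_iff)
  have "l = vec.span {u, v}" using vec.span_subspace[OF B(1,3) l(1)] uv by simp
  moreover have "pluecker u v \<noteq> 0"
  proof
    assume "pluecker u v = 0"
    then obtain a b where ab: "a \<noteq> 0 \<or> b \<noteq> 0" "a *s u + b *s v = 0" by (rule pluecker_eq_0_imp)
    have "(\<Sum>x\<in>{u, v}. (if x = u then a else b) *s x) = 0" using ab(2) uv(2) by simp
    hence "vec.dependent {u, v}" unfolding vec.dependent_finite[OF finite.insertI[OF finite.insertI[OF finite.emptyI]]]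
      using ab(1) uv(2) by (intro exI[of _ "\<lambda>x. if x = u then a else b"]) auto
    thus False using B(2) uv(1) by simp
  qed
  ultimately show "\<exists>u v. pluecker u v \<noteq> 0 \<and> l = vec.span {u, v}" by blast
next
  assume "\<exists>u v. pluecker u v \<noteq> 0 \<and> l = vec.span {u, v}"
  then obtain u v where uv: "pluecker u v \<noteq> 0" "l = vec.span {u, v}" by blast
  have "vec.dim l = 2"
    unfolding uv(2) vec.dim_span_eq_card_independent[OF independent_pair(1)[OF uv(1)]]
    using independent_pair(2)[OF uv(1)] by simp
  thus "l \<in> pg_lines" by (simp add: pg_lines_def uv(2) vec.subspace_span)
qed

lemma klein_point_span:
  fixes u v :: "'f::field ^ 4"
  shows "klein_point (vec.span {u, v}) = range (\<lambda>c. c *s pluecker u v)"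
proof -
  have "{pluecker x y |x y. x \<in> vec.span {u, v} \<and> y \<in> vec.span {u, v}} = range (\<lambda>c. c *s pluecker u v)"
  proof (intro equalityI subsetI)
    fix p assume "p \<in> {pluecker x y |x y. x \<in> vec.span {u, v} \<and> y \<in> vec.span {u, v}}"
    thus "p \<in> range (\<lambda>c. c *s pluecker u v)"
      unfolding span_pair by (clarify, subst pluecker_combination) (rule rangeI)
  next
    fix p assume "p \<in> range (\<lambda>c. c *s pluecker u v)"
    then obtain c where "p = c *s pluecker u v" by blast
    hence "p = pluecker (c *s u + 0 *s v) (0 *s u + 1 *s v)" by (simp only: pluecker_combination) simp
    moreover have "c *s u + 0 *s v \<in> vec.span {u, v}" "0 *s u + 1 *s v \<in> vec.span {u, v}"
      unfolding span_pair by blast+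
    ultimately show "p \<in> {pluecker x y |x y. x \<in> vec.span {u, v} \<and> y \<in> vec.span {u, v}}" by blast
  qed
  moreover have "vec.span (range (\<lambda>c. c *s pluecker u v)) = range (\<lambda>c. c *s pluecker u v)"
    by (metis vec.span_singleton vec.span_span)
  ultimately show ?thesis by (simp add: klein_point_def)
qed

lemma klein_point_cases:
  assumes "l \<in> pg_lines" "p \<in> klein_point l" "p \<noteq> 0"
  obtains u v where "p = pluecker u v" "l = vec.span {u, v}"
proof -
  obtain u v where uv: "pluecker u v \<noteq> 0" "l = vec.span {u, v}" using assms(1) pg_line_iff by blast
  then obtain c where c: "p = c *s pluecker u v" using assms(2) klein_point_span by blast
  have c0: "c \<noteq> 0" using c assms(3) by auto
  have "vec.span {c *s u, v} = vec.span {u, v}"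
    unfolding span_pair
  proof (intro equalityI subsetI)
    fix z assume "z \<in> {a *s (c *s u) + b *s v |a b. True}"
    then obtain a b where "z = a *s (c *s u) + b *s v" by blast
    hence "z = (a * c) *s u + b *s v" by (simp add: vec_eq_iff)
    thus "z \<in> {a *s u + b *s v |a b. True}" by blast
  next
    fix z assume "z \<in> {a *s u + b *s v |a b. True}"
    then obtain a b where "z = a *s u + b *s v" by blast
    hence "z = (a / c) *s (c *s u) + b *s v" using c0 by (simp add: vec_eq_iff)
    thus "z \<in> {a *s (c *s u) + b *s v |a b. True}" by blast
  qed
  moreover have "p = pluecker (c *s u) v"
    using c by (simp add: vec6_eq pluecker_comps algebra_simps)
  ultimately show ?thesis using that uv by metis
qed

lemma klein_point_line:
  fixes l :: "('f::field ^ 4) set"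
  assumes "l \<in> pg_lines" "p \<in> klein_point l" "p \<noteq> 0"
  shows "l = {x. wedge3 p x = 0}"
proof -
  obtain u v where uv: "p = pluecker u v" "l = vec.span {u, v}" using klein_point_cases assms by blast
  show ?thesis unfolding uv(2) span_pair
    using wedge3_pluecker_combination[of u v] wedge3_pluecker_eq_0_imp[of u v] assms(3) unfolding uv(1)
    by blast
qed

lemma klein_point_nonzero:
  assumes "l \<in> pg_lines" obtains p where "p \<in> klein_point l" "p \<noteq> 0"
proof -
  obtain u v where uv: "pluecker u v \<noteq> 0" "l = vec.span {u, v}" using assms pg_line_iff by blast
  have "pluecker u v \<in> klein_point l" unfolding uv(2) klein_point_span by (rule range_eqI[of _ _ 1]) simp
  thus ?thesis using that uv by blast
qed

lemma klein_point_eq_range: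
  assumes "l \<in> pg_lines" "p \<in> klein_point l" "p \<noteq> 0"
  shows "klein_point l = range (\<lambda>c. c *s p)"
  using klein_point_cases[OF assms] klein_point_span by metis

lemma klein_form_klein_point:
  assumes "l \<in> pg_lines" "p \<in> klein_point l" shows "klein_form p = 0"
proof (cases "p = 0")
  case False
  thus ?thesis using klein_point_cases[OF assms] klein_form_pluecker by metis
qed (simp add: klein_form_def)

text \<open>The Klein form is the Pfaffian of the skew matrix with entries p_ij, so its vanishing
  means rank 2. If p_ij is nonzero, the witnesses are row i and row j of this matrix, the latter
  divided by -p_ij.\<close>

lemma line_exists_pluecker:
  fixes p :: "'f::field ^ 6"
  assumes "klein_form p = 0" "p \<noteq> 0"
  obtains u v where "p = pluecker u v"
proof -
  have k: "p$1 * p$6 - p$2 * p$5 + p$3 * p$4 = 0" using assms(1) by (simp add: klein_form_def)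
  have "\<exists>u v. p = pluecker u v"
  proof -
    consider "p$1 \<noteq> 0" | "p$2 \<noteq> 0" | "p$3 \<noteq> 0" | "p$4 \<noteq> 0" | "p$5 \<noteq> 0" | "p$6 \<noteq> 0"
      using assms(2) by (auto simp: vec6_eq)
    thus ?thesis
    proof cases
      case 1
      have "p = pluecker (vector [1, 0, - p$4 / p$1, - p$5 / p$1]) (vector [0, p$1, p$2, p$3])"
        using 1 k by (auto simp: vec6_eq pluecker_comps vector_4 field_simps; algebra)
      thus ?thesis by blast
    next
      case 2
      have "p = pluecker (vector [1, p$4 / p$2, 0, - p$6 / p$2]) (vector [0, p$1, p$2, p$3])"
        using 2 k by (auto simp: vec6_eq pluecker_comps vector_4 field_simps; algebra)
      thus ?thesis by blast
    next
      case 3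
      have "p = pluecker (vector [1, p$5 / p$3, p$6 / p$3, 0]) (vector [0, p$1, p$2, p$3])"
        using 3 k by (auto simp: vec6_eq pluecker_comps vector_4 field_simps; algebra)
      thus ?thesis by blast
    next
      case 4
      have "p = pluecker (vector [p$2 / p$4, 1, 0, - p$6 / p$4]) (vector [- p$1, 0, p$4, p$5])"
        using 4 k by (auto simp: vec6_eq pluecker_comps vector_4 field_simps; algebra)
      thus ?thesis by blast
    next
      case 5
      have "p = pluecker (vector [p$3 / p$5, 1, p$6 / p$5, 0]) (vector [- p$1, 0, p$4, p$5])"
        using 5 k by (auto simp: vec6_eq pluecker_comps vector_4 field_simps; algebra)
      thus ?thesis by blast
    next
      case 6
      have "p = pluecker (vector [p$3 / p$6, p$5 / p$6, 1, 0]) (vector [- p$2, - p$4, 0, p$6])"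
        using 6 k by (auto simp: vec6_eq pluecker_comps vector_4 field_simps; algebra)
      thus ?thesis by blast
    qed
  qed
  thus ?thesis using that by blast
qed

lemma klein_correspondence_surj:
  fixes p :: "'f::field ^ 6"
  assumes "klein_form p = 0" "p \<noteq> 0"
  obtains l where "l \<in> pg_lines" "p \<in> klein_point l"
proof -
  obtain u v where "p = pluecker u v" using line_exists_pluecker assms by blast
  hence "vec.span {u, v} \<in> pg_lines" "p \<in> klein_point (vec.span {u, v})"
    using assms(2) pg_line_iff unfolding klein_point_span by (blast, intro range_eqI[of _ _ 1]) simp
  thus ?thesis using that by blast
qed

text \<open>Both points are singular, so the form at the sum is the polar form, that is, the
  determinant of the four basis vectors. The case l = l' is included: a line counts as meeting
  itself.\<close>

lemma lines_meet_iff: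
  fixes l l' :: "('f::field ^ 4) set"
  assumes l: "l \<in> pg_lines" "p \<in> klein_point l" "p \<noteq> 0"
    and l': "l' \<in> pg_lines" "p' \<in> klein_point l'" "p' \<noteq> 0"
  shows "l \<inter> l' \<noteq> {0} \<longleftrightarrow> klein_form (p + p') = 0"
proof -
  obtain u v where uv: "p = pluecker u v" "l = vec.span {u, v}" using klein_point_cases[OF l] by blast
  obtain x y where xy: "p' = pluecker x y" "l' = vec.span {x, y}" using klein_point_cases[OF l'] by blast
  have "klein_form (p + p') = 0 \<longleftrightarrow> klein_bilinear p p' = 0"
    unfolding klein_form_add klein_form_klein_point[OF l(1,2)] klein_form_klein_point[OF l'(1,2)] by simp
  moreover have "klein_bilinear p p' = 0" if meet: "l \<inter> l' \<noteq> {0}"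
  proof -
    have "0 \<in> l \<inter> l'" unfolding uv(2) xy(2) by (simp add: vec.span_zero)
    then obtain z where z: "z \<in> l" "z \<in> l'" "z \<noteq> 0" using meet by blast
    obtain a b where ab: "z = a *s u + b *s v" using z(1) unfolding uv(2) span_pair by blast
    obtain c d where cd: "z = c *s x + d *s y" using z(2) unfolding xy(2) span_pair by blast
    have comp: "a * u$k + b * v$k = c * x$k + d * y$k" for k
      using ab cd by (metis vector_add_component vector_smult_component)
    \<comment> \<open>Multiplying the determinant of u, v, x, y by a amounts to replacing u by z,
      which depends on x and y; likewise for b and v.\<close>
    have "a * klein_bilinear p p' = 0" "b * klein_bilinear p p' = 0"
      using comp[of 1] comp[of 2] comp[of 3] comp[of 4]
      unfolding uv(1) xy(1) klein_bilinear_def pluecker_comps by algebra+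
    moreover have "a \<noteq> 0 \<or> b \<noteq> 0" using ab z(3) by auto
    ultimately show ?thesis by auto
  qed
  moreover have "l \<inter> l' \<noteq> {0}" if "klein_bilinear p p' = 0"
  proof -
    have "pluecker (wedge3 p x) (wedge3 p y) = 0"
      using pluecker_wedge3[OF uv(1)] that xy(1) by blast
    then obtain a b where ab: "a \<noteq> 0 \<or> b \<noteq> 0" "a *s wedge3 p x + b *s wedge3 p y = 0"
      by (rule pluecker_eq_0_imp)
    define z where "z = a *s x + b *s y"
    have "z \<in> l'" unfolding xy(2) span_pair z_def by blast
    moreover have "z \<in> l" unfolding klein_point_line[OF l] using ab(2) by (simp add: z_def wedge3_linear)
    moreover have "z \<noteq> 0"
    proof
      assume "z = 0"
      have "pluecker (a *s x + b *s y) (c *s x + d *s y) = 0" for c d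
        using \<open>z = 0\<close> by (simp add: z_def vec6_eq pluecker_comps)
      hence "(a * d - b * c) *s p' = 0" for c d unfolding pluecker_combination xy(1) .
      from this[of 1 0] this[of 0 1] show False using ab(1) l'(3) by simp
    qed
    ultimately show ?thesis by blast
  qed
  ultimately show ?thesis by blast
qed

section \<open>Spreads and Cameron--Liebler line classes\<close>

lemma pg_line_span_pair:
  assumes "l \<in> pg_lines" "x \<in> l" "y \<in> l" "pluecker x y \<noteq> 0"
  shows "l = {z. wedge3 (pluecker x y) z = 0}"
proof (rule klein_point_line[OF assms(1) _ assms(4)])
  show "pluecker x y \<in> klein_point l"
    unfolding klein_point_def using assms by (intro vec.span_base) blast
qed

lemma pg_line_0: "l \<in> pg_lines \<Longrightarrow> 0 \<in> l"
  and pg_line_scale: "l \<in> pg_lines \<Longrightarrow> x \<in> l \<Longrightarrow> c *s x \<in> l"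
  by (auto simp: pg_lines_def vec.subspace_0 vec.subspace_scale)

lemma card_pg_line:
  fixes l :: "('f::finite_field ^ 4) set"
  assumes "l \<in> pg_lines" shows "card l = CARD('f)\<^sup>2"
proof -
  obtain u v where uv: "pluecker u v \<noteq> 0" "l = vec.span {u, v}" using assms pg_line_iff by blast
  have "l = (\<lambda>(a, b). a *s u + b *s v) ` UNIV" unfolding uv(2) span_pair by auto
  moreover have "inj (\<lambda>(a, b). a *s u + b *s v)"
  proof (rule injI, clarify)
    fix a b c d assume eq: "a *s u + b *s v = c *s u + d *s v"
    have "a *s pluecker u v = c *s pluecker u v"
      using pluecker_combination[of a u b v 0 1] pluecker_combination[of c u d v 0 1] eq by simp
    moreover have "(- b) *s pluecker u v = (- d) *s pluecker u v"
      using pluecker_combination[of a u b v 1 0] pluecker_combination[of c u d v 1 0] eq by simp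
    ultimately show "a = c \<and> b = d" using uv(1) by (auto simp: vec.scale_right_imp_eq dest!: vec.scale_right_imp_eq[OF uv(1)])
  qed
  ultimately have "card l = card (UNIV :: ('f \<times> 'f) set)" by (simp add: card_image)
  thus ?thesis by (simp add: power2_eq_square flip: UNIV_Times_UNIV)
qed

lemma card_pg_lines_inter:
  fixes l l' :: "('f::finite_field ^ 4) set"
  assumes l: "l \<in> pg_lines" "l' \<in> pg_lines" "l \<noteq> l'" "l \<inter> l' \<noteq> {0}"
  shows "card (l \<inter> l' - {0}) = CARD('f) - 1"
proof -
  obtain z where z: "z \<in> l" "z \<in> l'" "z \<noteq> 0" using l pg_line_0 by blast
  have "l \<inter> l' = range (\<lambda>c. c *s z)"
  proof (intro equalityI subsetI)
    fix y assume y: "y \<in> l \<inter> l'"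
    hence "pluecker z y = 0" using pg_line_span_pair[of l z y] pg_line_span_pair[of l' z y] l z by blast
    then obtain a b where ab: "a \<noteq> 0 \<or> b \<noteq> 0" "a *s z + b *s y = 0" by (rule pluecker_eq_0_imp)
    have "b \<noteq> 0" using ab z(3) by auto
    have comp: "a * z $ k + b * y $ k = 0" for k
      using ab(2) by (metis vector_add_component vector_smult_component zero_index)
    have "y = (- a / b) *s z"
      unfolding vec_eq_iff vector_smult_component
    proof
      fix k
      have "b * y $ k = - (a * z $ k)" using comp[of k] by (simp add: eq_neg_iff_add_eq_0 add.commute)
      thus "y $ k = - a / b * z $ k" using \<open>b \<noteq> 0\<close> by (simp add: field_simps)
    qed
    thus "y \<in> range (\<lambda>c. c *s z)" by blast
  qed (use z l pg_line_scale in auto)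
  moreover have "inj (\<lambda>c. c *s z)" using z(3) by (intro injI) (rule vec.scale_right_imp_eq)
  ultimately have "card (l \<inter> l') = CARD('f)" by (simp add: card_image)
  moreover have "0 \<in> l \<inter> l'" using l pg_line_0 by blast
  ultimately show ?thesis by (simp add: card_Diff_singleton)
qed

lemma spread_cover:
  assumes "is_spread S" "x \<noteq> 0" shows "\<exists>!l. l \<in> S \<and> x \<in> l"
proof -
  have "vec.span {x} \<in> pg_points" using assms(2) by (simp add: pg_points_def vec.subspace_span)
  moreover have "vec.span {x} \<subseteq> l \<longleftrightarrow> x \<in> l" if "l \<in> S" for l
  proof
    assume "x \<in> l"
    thus "vec.span {x} \<subseteq> l" using assms(1) that
      by (intro vec.span_minimal) (auto simp: is_spread_def pg_lines_def)
  qed (use vec.span_base[of x "{x}"] in blast)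
  ultimately show ?thesis using assms(1) unfolding is_spread_def by (metis (no_types, lifting))
qed

lemma spread_unique:
  assumes "is_spread S" "x \<noteq> 0" "l \<in> S" "x \<in> l" "m \<in> S" "x \<in> m" shows "l = m"
  using spread_cover[OF assms(1,2)] assms(3-6) by auto

text \<open>A spread partitions the nonzero vectors. The set R is arbitrary, because it is the whole
  space in \<open>card_spread\<close> and a line in \<open>card_spread_meet\<close>.\<close>

lemma sum_spread:
  fixes S :: "('f::finite_field ^ 4) set set"
  assumes S: "is_spread S" shows "(\<Sum>l\<in>S. card (R \<inter> l - {0})) = card (R - {0})"
proof -
  have "R - {0} = (\<Union>l\<in>S. R \<inter> l - {0})" using spread_cover[OF S] by blast
  moreover have "card (\<Union>l\<in>S. R \<inter> l - {0}) = (\<Sum>l\<in>S. card (R \<inter> l - {0}))"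
    using spread_cover[OF S] by (intro card_UN_disjoint) auto
  ultimately show ?thesis by simp
qed

lemma field_card_gt_1: "CARD('f::finite_field) > 1"
proof -
  have "card {0, 1 :: 'f} \<le> CARD('f)" by (rule card_mono) auto
  thus ?thesis by simp
qed

lemma card_spread:
  fixes S :: "('f::finite_field ^ 4) set set"
  assumes S: "is_spread S" shows "card S = CARD('f)\<^sup>2 + 1"
proof -
  define q where "q = CARD('f)"
  have q: "q > 1" unfolding q_def by (rule field_card_gt_1)
  have "(\<Sum>l\<in>S. card (UNIV \<inter> l - {0})) = (\<Sum>l\<in>S. q\<^sup>2 - 1)"
  proof (rule sum.cong[OF refl])
    fix l assume "l \<in> S"
    hence "l \<in> pg_lines" using S by (auto simp: is_spread_def)
    thus "card (UNIV \<inter> l - {0}) = q\<^sup>2 - 1"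
      using pg_line_0[of l] card_pg_line[of l] by (simp add: card_Diff_singleton q_def)
  qed
  hence "card S * (q\<^sup>2 - 1) = card (UNIV - {0 :: 'f ^ 4})"
    using sum_spread[OF S, of UNIV] by simp
  also have "\<dots> = q ^ 4 - 1" by (simp add: card_Diff_singleton q_def)
  also have "\<dots> = (q\<^sup>2 + 1) * (q\<^sup>2 - 1)"
  proof -
    have "q ^ 4 = q\<^sup>2 * q\<^sup>2" by (simp add: power4_eq_xxxx power2_eq_square)
    thus ?thesis by (cases "q\<^sup>2") auto
  qed
  finally have "card S * (q\<^sup>2 - 1) = (q\<^sup>2 + 1) * (q\<^sup>2 - 1)" .
  moreover have "q\<^sup>2 - 1 \<noteq> 0"
  proof -
    have "1 < q\<^sup>2" unfolding power2_eq_square using q q by (rule less_1_mult)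
    thus ?thesis by linarith
  qed
  ultimately show ?thesis unfolding mult_cancel2 by (simp add: q_def)
qed

text \<open>The q^2 - 1 nonzero vectors of a line outside the spread are shared out among the spread
  lines, q - 1 to each one that it meets. A spread line meets only itself.\<close>

lemma card_spread_meet:
  fixes S :: "('f::finite_field ^ 4) set set"
  assumes S: "is_spread S" and R: "R \<in> pg_lines"
  shows "card {l \<in> S. R \<inter> l \<noteq> {0}} = (if R \<in> S then 1 else CARD('f) + 1)"
proof (cases "R \<in> S")
  case True
  have "R \<noteq> {0}"
    using card_pg_line[OF R] field_card_gt_1[where 'f = 'f] by (auto simp: power2_eq_square)
  moreover have "l = R" if l: "l \<in> S" "R \<inter> l \<noteq> {0}" for l
  proof -
    have "0 \<in> R \<inter> l" using S R l(1) pg_line_0 by (auto simp: is_spread_def)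
    then obtain z where z: "z \<in> R" "z \<in> l" "z \<noteq> 0" using l(2) by blast
    show ?thesis by (rule spread_unique[OF S z(3) l(1) z(2) True z(1)])
  qed
  ultimately have "{l \<in> S. R \<inter> l \<noteq> {0}} = {R}" using True by auto
  thus ?thesis using True by simp
next
  case False
  define q where "q = CARD('f)"
  have q: "q > 1" unfolding q_def by (rule field_card_gt_1)
  have "(\<Sum>l\<in>S. card (R \<inter> l - {0})) = (\<Sum>l\<in>S. if R \<inter> l \<noteq> {0} then q - 1 else 0)"
  proof (rule sum.cong[OF refl])
    fix l assume l: "l \<in> S"
    hence "l \<in> pg_lines" "R \<noteq> l" using S False by (auto simp: is_spread_def)
    thus "card (R \<inter> l - {0}) = (if R \<inter> l \<noteq> {0} then q - 1 else 0)"
      using card_pg_lines_inter[OF R, of l] by (simp add: q_def)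
  qed
  also have "\<dots> = card {l \<in> S. R \<inter> l \<noteq> {0}} * (q - 1)"
    by (simp add: sum.If_cases Int_def)
  finally have "card {l \<in> S. R \<inter> l \<noteq> {0}} * (q - 1) = card (R - {0})"
    unfolding sum_spread[OF S] by simp
  also have "\<dots> = q\<^sup>2 - 1" using card_pg_line[OF R] pg_line_0[OF R] by (simp add: card_Diff_singleton q_def)
  also have "\<dots> = (q + 1) * (q - 1)" by (cases q) (auto simp: power2_eq_square)
  finally have "card {l \<in> S. R \<inter> l \<noteq> {0}} = q + 1" unfolding mult_cancel2 using q by simp
  thus ?thesis using False by (simp add: q_def)
qed

text \<open>With s lines of L in the spread, the double count reads s + (card L - s) (q + 1) = (q^2
  + 1) x (q + 1) + q^2 s, which reduces to (q^2 + q) (s - x) = 0. Both sides count a common line as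
  meeting itself.\<close>

lemma cameron_lieblerI:
  fixes L :: "('f::finite_field ^ 4) set set"
  defines "q \<equiv> CARD('f)"
  assumes L: "L \<subseteq> pg_lines" "card L = x * (q\<^sup>2 + q + 1)"
    and meet: "\<And>l. l \<in> pg_lines \<Longrightarrow>
      card {R \<in> L. R \<inter> l \<noteq> {0}} = x * (q + 1) + q\<^sup>2 * of_bool (l \<in> L)"
  shows "cameron_liebler L x"
  unfolding cameron_liebler_def q_def[symmetric]
proof (intro conjI allI impI L)
  fix S :: "('f ^ 4) set set" assume S: "is_spread S"
  have q: "q > 1" unfolding q_def by (rule field_card_gt_1)
  have Sl: "S \<subseteq> pg_lines" using S by (simp add: is_spread_def)
  define s where "s = card (S \<inter> L)"
  have "(\<Sum>l\<in>S. card {R \<in> L. R \<inter> l \<noteq> {0}}) = (\<Sum>l\<in>S. \<Sum>R\<in>L. of_bool (R \<inter> l \<noteq> {0}))"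
    by (simp add: sum_of_bool_eq Int_def)
  also have "\<dots> = (\<Sum>R\<in>L. \<Sum>l\<in>S. of_bool (R \<inter> l \<noteq> {0}))" by (rule sum.swap)
  also have "\<dots> = (\<Sum>R\<in>L. card {l \<in> S. R \<inter> l \<noteq> {0}})"
    by (simp add: sum_of_bool_eq Int_def)
  also have "\<dots> = (\<Sum>R\<in>L. if R \<in> S then 1 else q + 1)"
    using L(1) card_spread_meet[OF S] by (intro sum.cong) (auto simp: q_def)
  also have "\<dots> = s + card (L - S) * (q + 1)"
    by (simp add: sum.If_cases s_def Int_commute Diff_eq)
  finally have "(\<Sum>l\<in>S. card {R \<in> L. R \<inter> l \<noteq> {0}}) = s + card (L - S) * (q + 1)" .
  moreover have "(\<Sum>l\<in>S. card {R \<in> L. R \<inter> l \<noteq> {0}}) = (\<Sum>l\<in>S. x * (q + 1) + q\<^sup>2 * of_bool (l \<in> L))"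
    using Sl meet by (intro sum.cong) auto
  moreover have "\<dots> = (q\<^sup>2 + 1) * (x * (q + 1)) + q\<^sup>2 * s"
    by (simp add: sum.distrib card_spread[OF S] q_def[symmetric] s_def sum_of_bool_eq Int_def flip: sum_distrib_left)
  moreover have "card (L - S) + s = x * (q\<^sup>2 + q + 1)"
  proof -
    have "card L = card ((L - S) \<union> (S \<inter> L))" by (intro arg_cong[of _ _ card]) blast
    also have "\<dots> = card (L - S) + s" unfolding s_def by (rule card_Un_disjoint) auto
    finally show ?thesis using L(2) by simp
  qed
  ultimately have eqs: "s + card (L - S) * (q + 1) = (q\<^sup>2 + 1) * (x * (q + 1)) + q\<^sup>2 * s"
    "card (L - S) + s = x * (q\<^sup>2 + q + 1)" by linarith+
  have "real s + real (card (L - S)) * (real q + 1) = (real q ^ 2 + 1) * (real x * (real q + 1)) + real q ^ 2 * real s"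
    using arg_cong[OF eqs(1), of real] by (simp only: of_nat_add of_nat_mult of_nat_power of_nat_1)
  moreover have "real (card (L - S)) = real x * (real q ^ 2 + real q + 1) - real s"
    using arg_cong[OF eqs(2), of real] by (simp only: of_nat_add of_nat_mult of_nat_power of_nat_1)
  ultimately have "(real q + real q ^ 2) * (real s - real x) = 0" by algebra
  moreover have "real q + real q ^ 2 > 0" using q by (simp add: add_pos_pos)
  ultimately have "real s = real x" by simp
  thus "card (S \<inter> L) = x" by (simp add: s_def)
qed

text \<open>The counts are of vectors, q - 1 for each projective point, and this factor cancels.
  Perpendicularity to p is stated as singularity of v + p, a condition that any identification
  \<phi> transports because it is additive and matches the two quadrics.\<close>

lemma cameron_liebler_of_tight_vectors:
  fixes \<iota> :: "'f::finite_field \<Rightarrow> 'e::finite_field" and D :: "('e \<times> 'e) set"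
  defines "q \<equiv> CARD('f)"
  assumes emb: "field_embedding \<iota>" and id: "klein_identification \<iota> \<phi>"
    and singular: "\<And>v. v \<in> D \<Longrightarrow> v \<noteq> 0 \<and> quad_form \<iota> v = 0"
    and scale: "\<And>c v. c \<noteq> 0 \<Longrightarrow> v \<in> D \<Longrightarrow> ext_scale \<iota> c v \<in> D"
    and card_D: "card D = (q - 1) * (x * (q\<^sup>2 + q + 1))"
    and tight: "\<And>p. p \<noteq> 0 \<Longrightarrow> quad_form \<iota> p = 0 \<Longrightarrow>
      card {v \<in> D. quad_form \<iota> (v + p) = 0} = (q - 1) * (x * (q + 1) + q\<^sup>2 * of_bool (p \<in> D))"
  shows "cameron_liebler (klein_lines \<phi> {ext_point \<iota> v |v. v \<in> D}) x"
proof -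
  define L where "L = klein_lines \<phi> {ext_point \<iota> v |v. v \<in> D}"
  have q: "q > 1" unfolding q_def by (rule field_card_gt_1)
  have lin: "Vector_Spaces.linear (*s) (ext_scale \<iota>) \<phi>" and bij: "bij \<phi>"
    and quad: "klein_form p = 0 \<longleftrightarrow> quad_form \<iota> (\<phi> p) = 0" for p
    using id by (auto simp: klein_identification_def)
  have \<phi>_scale: "\<phi> (c *s p) = ext_scale \<iota> c (\<phi> p)" for c p
    using lin by (simp add: Vector_Spaces.linear_iff)
  have \<phi>_add: "\<phi> (p + r) = \<phi> p + \<phi> r" for p r
    using lin by (simp add: Vector_Spaces.linear_iff)
  have \<phi>_0: "\<phi> p = 0 \<longleftrightarrow> p = 0" for p
  proof -
    have "\<phi> 0 = 0" using \<phi>_add[of 0 0] by simp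
    thus ?thesis using bij by (metis bij_def injD)
  qed
  have \<iota>0: "\<iota> 0 = 0" and \<iota>1: "\<iota> 1 = 1" using emb by (auto simp: field_embedding_def) (metis add_cancel_right_right)
  have scale1: "ext_scale \<iota> 1 v = v" for v by (simp add: ext_scale_def \<iota>1)
  have L_lines: "L \<subseteq> pg_lines" by (auto simp: L_def klein_lines_def)
  have in_L: "\<phi> p \<in> D \<longleftrightarrow> l \<in> L" if l: "l \<in> pg_lines" "p \<in> klein_point l" "p \<noteq> 0" for l p
  proof -
    have img: "\<phi> ` klein_point l = ext_point \<iota> (\<phi> p)"
      unfolding klein_point_eq_range[OF l] ext_point_def image_image \<phi>_scale by (rule refl)
    show ?thesis
    proof
      assume "\<phi> p \<in> D"
      thus "l \<in> L" using img l(1) unfolding L_def klein_lines_def by blast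
    next
      assume "l \<in> L"
      hence "\<phi> ` klein_point l \<in> {ext_point \<iota> v |v. v \<in> D}" unfolding L_def klein_lines_def by simp
      then obtain v where v: "ext_point \<iota> (\<phi> p) = ext_point \<iota> v" "v \<in> D"
        unfolding img by blast
      have "\<phi> p \<in> ext_point \<iota> (\<phi> p)"
        unfolding ext_point_def by (rule range_eqI[of _ _ 1]) (simp add: scale1)
      hence "\<phi> p \<in> ext_point \<iota> v" by (simp only: v(1))
      then obtain c where c: "\<phi> p = ext_scale \<iota> c v" unfolding ext_point_def by blast
      have "c \<noteq> 0" using c l(3) \<phi>_0[of p] by (auto simp: ext_scale_def \<iota>0 zero_prod_def)
      thus "\<phi> p \<in> D" using scale[OF _ v(2)] c by simp
    qed
  qed
  \<comment> \<open>The q - 1 nonzero vectors of the point of l. These sets partition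
    \<open>D\<close>, so every count on \<open>D\<close> splits over the lines in
    \<open>L\<close>.\<close>
  define V where "V l = \<phi> ` (klein_point l - {0})" for l
  have card_V: "card (V l) = q - 1" if l: "l \<in> pg_lines" for l
  proof -
    obtain p where p: "p \<in> klein_point l" "p \<noteq> 0" using klein_point_nonzero l by blast
    have "inj (\<lambda>c. c *s p)" using p(2) by (intro injI) (rule vec.scale_right_imp_eq)
    hence "card (klein_point l) = q"
      unfolding klein_point_eq_range[OF l p] by (simp add: card_image q_def)
    moreover have "0 \<in> klein_point l"
      unfolding klein_point_eq_range[OF l p] by (rule range_eqI[of _ _ 0]) simp
    moreover have "card (V l) = card (klein_point l - {0})"
      unfolding V_def using bij by (intro card_image inj_on_subset[OF bij_is_inj]) auto
    ultimately show ?thesis by (simp add: card_Diff_singleton)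
  qed
  have D_eq: "D = (\<Union>l\<in>L. V l)"
  proof (intro equalityI subsetI)
    fix d assume d: "d \<in> D"
    obtain p where p: "d = \<phi> p" using bij by (metis bij_pointE)
    have "klein_form p = 0" "p \<noteq> 0" using singular[OF d] quad \<phi>_0 p by auto
    then obtain l where l: "l \<in> pg_lines" "p \<in> klein_point l" using klein_correspondence_surj by blast
    hence "l \<in> L" using in_L[OF l \<open>p \<noteq> 0\<close>] d p by simp
    thus "d \<in> (\<Union>l\<in>L. V l)" using l \<open>p \<noteq> 0\<close> p by (auto simp: V_def)
  next
    fix d assume "d \<in> (\<Union>l\<in>L. V l)"
    then obtain l p where "l \<in> L" "p \<in> klein_point l" "p \<noteq> 0" "d = \<phi> p" by (auto simp: V_def)
    thus "d \<in> D" using in_L L_lines by blast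
  qed
  have disj: "V l \<inter> V l' = {}" if "l \<in> L" "l' \<in> L" "l \<noteq> l'" for l l'
  proof (rule ccontr)
    assume "V l \<inter> V l' \<noteq> {}"
    then obtain p p' where p: "p \<in> klein_point l" "p \<noteq> 0" "p' \<in> klein_point l'" "\<phi> p = \<phi> p'"
      unfolding V_def by blast
    hence "p = p'" using bij by (metis bij_def injD)
    thus False using klein_point_line[of l p] klein_point_line[of l' p] that p L_lines by blast
  qed
  have card_filter: "card {v \<in> D. P v} = (\<Sum>l\<in>L. card {v \<in> V l. P v})" for P
  proof -
    have "{v \<in> D. P v} = (\<Union>l\<in>L. {v \<in> V l. P v})" unfolding D_eq by blast
    also have "card \<dots> = (\<Sum>l\<in>L. card {v \<in> V l. P v})"
    proof (rule card_UN_disjoint)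
      show "\<forall>l\<in>L. \<forall>l'\<in>L. l \<noteq> l' \<longrightarrow> {v \<in> V l. P v} \<inter> {v \<in> V l'. P v} = {}"
      proof (intro ballI impI)
        fix l l' assume "l \<in> L" "l' \<in> L" "l \<noteq> l'"
        from disj[OF this] show "{v \<in> V l. P v} \<inter> {v \<in> V l'. P v} = {}" by blast
      qed
    qed auto
    finally show ?thesis .
  qed
  show ?thesis
    unfolding L_def[symmetric]
  proof (rule cameron_lieblerI[OF L_lines]; unfold q_def[symmetric])
    have "card D = card L * (q - 1)"
      using card_filter[of "\<lambda>_. True"] L_lines card_V by (simp add: subset_iff)
    hence "(q - 1) * card L = (q - 1) * (x * (q\<^sup>2 + q + 1))"
      unfolding card_D by (simp only: mult.commute[of "card L"])
    thus "card L = x * (q\<^sup>2 + q + 1)" unfolding mult_cancel1 using q by simp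
  next
    fix l :: "('f ^ 4) set" assume l: "l \<in> pg_lines"
    obtain p where p: "p \<in> klein_point l" "p \<noteq> 0" using klein_point_nonzero l by blast
    have "card {v \<in> V R. quad_form \<iota> (v + \<phi> p) = 0} = (q - 1) * of_bool (R \<inter> l \<noteq> {0})" if R: "R \<in> L" for R
    proof -
      have "quad_form \<iota> (v + \<phi> p) = 0 \<longleftrightarrow> R \<inter> l \<noteq> {0}" if v: "v \<in> V R" for v
      proof -
        obtain r where r: "r \<in> klein_point R" "r \<noteq> 0" "v = \<phi> r" using v unfolding V_def by blast
        have "R \<in> pg_lines" using R L_lines by blast
        from lines_meet_iff[OF this r(1,2) l p] show ?thesis
          unfolding quad \<phi>_add r(3) by blast
      qed
      hence "{v \<in> V R. quad_form \<iota> (v + \<phi> p) = 0} = (if R \<inter> l \<noteq> {0} then V R else {})" by auto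
      thus ?thesis using card_V R L_lines by auto
    qed
    hence "card {v \<in> D. quad_form \<iota> (v + \<phi> p) = 0} = (\<Sum>R\<in>L. (q - 1) * of_bool (R \<inter> l \<noteq> {0}))"
      unfolding card_filter by (rule sum.cong[OF refl])
    also have "\<dots> = (q - 1) * card {R \<in> L. R \<inter> l \<noteq> {0}}"
      by (simp add: sum_of_bool_eq Int_def flip: sum_distrib_left)
    finally have "(q - 1) * card {R \<in> L. R \<inter> l \<noteq> {0}} = (q - 1) * (x * (q + 1) + q\<^sup>2 * of_bool (\<phi> p \<in> D))"
      using tight[of "\<phi> p"] \<phi>_0[of p] p(2) quad[of p] klein_form_klein_point[OF l p(1)] by simp
    thus "card {R \<in> L. R \<inter> l \<noteq> {0}} = x * (q + 1) + q\<^sup>2 * of_bool (l \<in> L)"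
      unfolding mult_cancel1 in_L[OF l p] using q by simp
  qed
qed

section \<open>Identifying \<open>D\<close>\<close>

text \<open>Shifting the sum of all elements by 1 shows that the order of the field is zero in it,
  so the characteristic divides q and is the prime of which q is a power.\<close>

lemma frobenius_add_finite_field:
  fixes a b :: "'e::finite_field"
  assumes card: "CARD('e) = q ^ 3" and pp: "primepow q"
  shows "(a + b) ^ q = a ^ q + b ^ q"
proof -
  have prime: "prime CHAR('e)" using CHAR_pos_iff pos_char_exists prime_CHAR_semidom by blast
  have "bij_betw (\<lambda>y :: 'e. y + 1) UNIV UNIV"
    by (rule bij_betw_byWitness[where f' = "\<lambda>y. y - 1"]) auto
  from sum.reindex_bij_betw[OF this, of "\<lambda>y. y"] have "of_nat CARD('e) = (0 :: 'e)"
    by (simp add: sum.distrib)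
  hence "CHAR('e) dvd q ^ 3" by (simp only: card of_nat_eq_0_iff_char_dvd)
  hence dvd: "CHAR('e) dvd q" using prime prime_dvd_power by blast
  obtain p k where p: "prime p" "q = p ^ k" using pp by (auto simp: primepow_def)
  have "CHAR('e) = p" using dvd p prime prime_dvd_power primes_dvd_imp_eq by metis
  thus ?thesis using prime p(2) by (intro freshmans_dream') auto
qed

context cubic_trace
begin

lemma cyclic_subgroup_mult: "g \<noteq> 0 \<Longrightarrow> x \<in> cyclic_subgroup g \<Longrightarrow> y \<in> cyclic_subgroup g \<Longrightarrow> x * y \<in> cyclic_subgroup (g :: 'e)"
  unfolding cyclic_subgroup_def using power_int_add by (metis (no_types, lifting) rangeE rangeI)

lemma cyclic_subgroup_inverse: "x \<in> cyclic_subgroup g \<Longrightarrow> inverse x \<in> cyclic_subgroup (g :: 'e)"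
  unfolding cyclic_subgroup_def using power_int_minus by (metis (no_types, lifting) rangeE rangeI)

lemma W_eq_cyclic: "cyclic_subgroup (\<omega> ^ (q - 1)) = W"
proof -
  have g0: "\<omega> ^ (q - 1) \<noteq> 0" using omega_nonzero by simp
  have "(\<lambda>k::nat. (\<omega> ^ (q - 1)) ^ k) ` UNIV = W"
  proof (intro equalityI subsetI)
    fix x assume "x \<in> (\<lambda>k::nat. (\<omega> ^ (q - 1)) ^ k) ` UNIV"
    then obtain k where "x = (\<omega> ^ (q - 1)) ^ k" by blast
    hence "x ^ N = (\<omega> ^ ((q - 1) * N)) ^ k" by (simp only: ac_simps flip: power_mult)
    also have "\<dots> = 1" unfolding unit_group_card[symmetric] pow_card_minus_1[OF omega_nonzero] by simp
    finally show "x \<in> W" by (simp add: W_def)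
  next
    fix x assume x: "x \<in> W"
    note l = dlog[OF W_nonzero[OF x]]
    have "\<omega> ^ (dlog \<omega> x * N) = \<omega> ^ 0" using x l(2) by (simp add: power_mult W_def)
    hence "(q - 1) * N dvd dlog \<omega> x * N"
      unfolding omega_pow_eq_iff by (simp only: unit_group_card mod_0 mod_eq_0_iff_dvd)
    hence "q - 1 dvd dlog \<omega> x" using N_pos by (simp only: dvd_times_right_cancel_iff)
    then obtain k where "dlog \<omega> x = (q - 1) * k" by blast
    hence "x = (\<omega> ^ (q - 1)) ^ k" using l(2) by (simp only: power_mult)
    thus "x \<in> (\<lambda>k::nat. (\<omega> ^ (q - 1)) ^ k) ` UNIV" by blast
  qed
  thus ?thesis using cyclic_subgroup_pow[OF g0] by simp
qed

lemma omega_N_power_split: "(\<omega> ^ N) ^ (e + 4 * j) = (\<omega> ^ N) ^ e * (\<omega> ^ (4 * N)) ^ j"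
  by (simp only: power_add power_mult mult.commute[of 4 N])

lemma neg_i_power_split: "(- \<i>) ^ (e + 4 * j) = (- \<i>) ^ e"
  by (simp add: power_add power_mult)

text \<open>F* consists of the powers of \<open>\<omega> ^ N\<close>, which \<open>Psi\<close> sends
  to -\<i>; so \<open>R\<close> is described by the exponents 0 and 1 modulo 4, and the rest is a
  power of \<open>\<omega> ^ (4 * N)\<close>.\<close>

lemma R_eq: "R = {(\<omega> ^ N) ^ e * z |e z. e \<in> {0, 1} \<and> z \<in> cyclic_subgroup (\<omega> ^ (4 * N))}"
proof (intro equalityI subsetI)
  have g0: "\<omega> ^ (4 * N) \<noteq> 0" using omega_nonzero by simp
  fix x assume x: "x \<in> R"
  hence xF: "x \<in> Fu" by (rule R_Fu)
  note l = dlog[OF Fu_nonzero[OF xF]]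
  have "\<omega> ^ (dlog \<omega> x * (q - 1)) = \<omega> ^ 0" using xF l(2) by (simp add: power_mult Fu_alt)
  hence "N * (q - 1) dvd dlog \<omega> x * (q - 1)"
    unfolding omega_pow_eq_iff by (simp only: unit_group_card mod_0 mod_eq_0_iff_dvd mult.commute)
  moreover have "q - 1 \<noteq> 0" using q_gt_1 by simp
  ultimately have "N dvd dlog \<omega> x" using dvd_times_right_cancel_iff by blast
  then obtain k where k: "dlog \<omega> x = N * k" by blast
  hence xk: "x = (\<omega> ^ N) ^ k" using l(2) by (simp only: power_mult)
  define e where "e = k mod 4"
  define j where "j = k div 4"
  have k4: "k = e + 4 * j" by (simp add: e_def j_def)
  have x4: "x = (\<omega> ^ N) ^ e * (\<omega> ^ (4 * N)) ^ j"
    unfolding xk k4 by (rule omega_N_power_split)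
  have "Psi x = (- \<i>) ^ (e + 4 * j)" unfolding xk k4 Psi_power[of "\<omega> ^ N"] Psi_omega_N by (rule refl)
  also have "\<dots> = (- \<i>) ^ e" by (rule neg_i_power_split)
  finally have "(- \<i>) ^ e = 1 \<or> (- \<i>) ^ e = - \<i>" using x by (simp add: R_def)
  moreover have "e < 4" by (simp add: e_def)
  hence "e = 0 \<or> e = 1 \<or> e = 2 \<or> e = 3" by linarith
  ultimately have "e \<in> {0, 1}"
    by (auto simp: power2_eq_square power3_eq_cube complex_eq_iff)
  moreover have "(\<omega> ^ (4 * N)) ^ j \<in> cyclic_subgroup (\<omega> ^ (4 * N))"
    unfolding cyclic_subgroup_pow[OF g0] by blast
  ultimately show "x \<in> {(\<omega> ^ N) ^ e * z |e z. e \<in> {0, 1} \<and> z \<in> cyclic_subgroup (\<omega> ^ (4 * N))}"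
    using x4 by blast
next
  have g0: "\<omega> ^ (4 * N) \<noteq> 0" using omega_nonzero by simp
  fix x assume "x \<in> {(\<omega> ^ N) ^ e * z |e z. e \<in> {0, 1} \<and> z \<in> cyclic_subgroup (\<omega> ^ (4 * N))}"
  then obtain e k where e: "e \<in> {0, 1 :: nat}" and x: "x = (\<omega> ^ N) ^ e * (\<omega> ^ (4 * N)) ^ (k :: nat)"
    unfolding cyclic_subgroup_pow[OF g0] by blast
  have x': "x = (\<omega> ^ N) ^ (e + 4 * k)" unfolding x by (rule omega_N_power_split[symmetric])
  have "Psi x = (- \<i>) ^ e" unfolding x' Psi_power[of "\<omega> ^ N"] Psi_omega_N by (rule neg_i_power_split)
  thus "x \<in> R" using e Fu_power[OF omega_N_Fu] unfolding R_def x' by auto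
qed

text \<open>The exponents belong to x^2 and to x^2 times \<open>\<omega> ^ N\<close>. Their
  reduction modulo 4N is absorbed by z, and z together with the optional factor runs through
  \<open>R\<close>.\<close>

lemma exponent_set_eq:
  assumes X: "0 \<notin> X"
    and I: "I = {(2 * dlog \<omega> x) mod (4 * N) |x. x \<in> X} \<union> {(2 * dlog \<omega> x + N) mod (4 * N) |x. x \<in> X}"
  shows "{z * \<omega> ^ l |z l. z \<in> cyclic_subgroup (\<omega> ^ (4 * N)) \<and> l \<in> I} = {x\<^sup>2 * r |x r. x \<in> X \<and> r \<in> R}"
proof -
  let ?C = "cyclic_subgroup (\<omega> ^ (4 * N))"
  have g0: "\<omega> ^ (4 * N) \<noteq> 0" using omega_nonzero by simp
  have red: "\<exists>z'\<in>?C. \<omega> ^ n = z' * \<omega> ^ (n mod (4 * N))" for n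
  proof
    show "\<omega> ^ n = (\<omega> ^ (4 * N)) ^ (n div (4 * N)) * \<omega> ^ (n mod (4 * N))"
      by (simp flip: power_mult power_add)
    show "(\<omega> ^ (4 * N)) ^ (n div (4 * N)) \<in> ?C" unfolding cyclic_subgroup_pow[OF g0] by blast
  qed
  have C0: "z \<noteq> 0" if "z \<in> ?C" for z
    using that omega_nonzero unfolding cyclic_subgroup_pow[OF g0] by auto
  have I': "l \<in> I \<longleftrightarrow> (\<exists>x\<in>X. \<exists>e\<in>{0, 1}. l = (2 * dlog \<omega> x + e * N) mod (4 * N))" for l
    unfolding I by auto
  have pw: "\<omega> ^ (2 * dlog \<omega> x + e * N) = x\<^sup>2 * (\<omega> ^ N) ^ e" if "x \<in> X" for x and e :: nat
  proof -
    have "x \<noteq> 0" using that X by blast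
    from dlog(2)[OF this] show ?thesis by (simp only: power_add power_mult mult.commute[of _ N] mult.commute[of 2])
  qed
  show ?thesis
  proof (intro equalityI subsetI)
    fix y assume "y \<in> {z * \<omega> ^ l |z l. z \<in> ?C \<and> l \<in> I}"
    then obtain z x e where *: "z \<in> ?C" "x \<in> X" "e \<in> {0, 1 :: nat}"
      "y = z * \<omega> ^ ((2 * dlog \<omega> x + e * N) mod (4 * N))" unfolding I' by blast
    obtain z' where z': "z' \<in> ?C" "x\<^sup>2 * (\<omega> ^ N) ^ e = z' * \<omega> ^ ((2 * dlog \<omega> x + e * N) mod (4 * N))"
      using red[of "2 * dlog \<omega> x + e * N"] unfolding pw[OF *(2)] by blast
    have "y = z * (inverse z' * (x\<^sup>2 * (\<omega> ^ N) ^ e))"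
      unfolding z'(2) *(4) using C0[OF z'(1)] by simp
    hence "y = x\<^sup>2 * ((\<omega> ^ N) ^ e * (z * inverse z'))" by (simp only: mult_ac)
    moreover have "(\<omega> ^ N) ^ e * (z * inverse z') \<in> R"
      unfolding R_eq using *(1,3) z'(1) cyclic_subgroup_mult[OF g0] cyclic_subgroup_inverse by blast
    ultimately show "y \<in> {x\<^sup>2 * r |x r. x \<in> X \<and> r \<in> R}" using *(2) by blast
  next
    fix y assume "y \<in> {x\<^sup>2 * r |x r. x \<in> X \<and> r \<in> R}"
    then obtain x e z where *: "x \<in> X" "e \<in> {0, 1 :: nat}" "z \<in> ?C" "y = x\<^sup>2 * ((\<omega> ^ N) ^ e * z)"
      unfolding R_eq by blast
    obtain z' where z': "z' \<in> ?C" "x\<^sup>2 * (\<omega> ^ N) ^ e = z' * \<omega> ^ ((2 * dlog \<omega> x + e * N) mod (4 * N))"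
      using red[of "2 * dlog \<omega> x + e * N"] unfolding pw[OF *(1)] by blast
    have "y = (z' * \<omega> ^ ((2 * dlog \<omega> x + e * N) mod (4 * N))) * z"
      unfolding z'(2)[symmetric] *(4) by (simp only: mult_ac)
    hence "y = (z * z') * \<omega> ^ ((2 * dlog \<omega> x + e * N) mod (4 * N))" by (simp only: mult_ac)
    moreover have "z * z' \<in> ?C" using *(3) z'(1) by (rule cyclic_subgroup_mult[OF g0])
    moreover have "(2 * dlog \<omega> x + e * N) mod (4 * N) \<in> I" unfolding I' using *(1,2) by blast
    ultimately show "y \<in> {z * \<omega> ^ l |z l. z \<in> ?C \<and> l \<in> I}" by blast
  qed
qed

text \<open>Pairs containing \<open>w\<^sub>0\<close> satisfy the sign condition by the choice of 2
  b, as chi(b) = chi(2)^2 = 1. For every other pair it is \<open>conic_triple\<close> applied to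
  \<open>w\<^sub>0\<close>, w and w'.\<close>

lemma conic_weights_trace:
  assumes w\<^sub>0: "w\<^sub>0 \<in> conic" and b: "b \<in> Fu" "chi b = 1"
  shows "conic_weights q N \<omega> (\<lambda>w. if w = w\<^sub>0 then 2 * b else T (w\<^sub>0 * w))"
proof unfold_locales
  have 2: "2 \<in> Fu" using Fs_2 two_nonzero by (rule Fu_I)
  have T_Fu: "T (w * w') \<in> Fu" if "w \<in> conic" "w' \<in> conic" "w \<noteq> w'" for w w'
    using conic_nonorthogonal[OF that(1,2)] that(3) by (intro Fu_I T_Fs) blast
  fix w assume w: "w \<in> conic"
  show "(if w = w\<^sub>0 then 2 * b else T (w\<^sub>0 * w)) \<in> Fu"
    using T_Fu[OF w\<^sub>0 w] Fu_mult[OF 2 b(1)] by auto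
  fix w' assume w': "w' \<in> conic" and ne: "w \<noteq> w'"
  have sq: "chi x * chi x = 1" if "x \<in> Fu" for x using chi_self[OF Fu_nonzero[OF that]] .
  show "chi (if w = w\<^sub>0 then 2 * b else T (w\<^sub>0 * w)) * chi (2 * T (w * w'))
      = chi (if w' = w\<^sub>0 then 2 * b else T (w\<^sub>0 * w'))"
  proof -
    consider "w = w\<^sub>0" | "w' = w\<^sub>0" | "w \<noteq> w\<^sub>0" "w' \<noteq> w\<^sub>0" by blast
    thus ?thesis
    proof cases
      case 1
      hence "w' \<noteq> w\<^sub>0" using ne by blast
      thus ?thesis using 1 b(2) sq[OF 2] by (simp add: chi_mult)
    next
      case 2
      hence "w \<noteq> w\<^sub>0" using ne by blast
      thus ?thesis using 2 b(2) sq[OF T_Fu[OF w\<^sub>0 w]] by (simp add: chi_mult mult.commute)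
    next
      case 3
      have "chi (2 * T (w\<^sub>0 * w) * T (w * w') * T (w' * w\<^sub>0)) = 1"
        using conic_triple[OF w\<^sub>0 w w'] 3 ne by blast
      hence "chi (T (w\<^sub>0 * w)) * chi (2 * T (w * w')) * chi (T (w\<^sub>0 * w')) = 1"
        by (simp add: chi_mult mult_ac)
      hence "chi (T (w\<^sub>0 * w)) * chi (2 * T (w * w')) * (chi (T (w\<^sub>0 * w')) * chi (T (w\<^sub>0 * w')))
          = chi (T (w\<^sub>0 * w'))" by (simp flip: mult.assoc)
      thus ?thesis using 3 sq[OF T_Fu[OF w\<^sub>0 w']] by simp
    qed
  qed
qed

end

theorem theorem4p1:
  fixes \<iota> :: "'f::finite_field \<Rightarrow> 'e::finite_field"
    and q N :: nat and \<omega> w\<^sub>1 :: 'e and \<beta> :: 'f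
    and d :: "nat \<Rightarrow> nat" and I\<^sub>Q Xbar A B I\<^sub>X :: "nat set"
    and X :: "'e set" and D :: "('e \<times> 'e) set" and M :: "('e \<times> 'e) set set"
  assumes "primepow q" and "q mod 12 = 5 \<or> q mod 12 = 9"
    and "CARD('f) = q" and "CARD('e) = q ^ 3" and "field_embedding \<iota>"
    and "primitive_element \<omega>"
    and "N = q\<^sup>2 + q + 1"
    and "has_mult_order w\<^sub>1 N"
    and "I\<^sub>Q = {i. 0 \<le> i \<and> i \<le> N - 1 \<and> rel_trace \<iota> (w\<^sub>1 ^ (2 * i)) = 0}"
    and "bij_betw d {0..q} I\<^sub>Q"
    and "\<beta> \<noteq> 0" and "\<exists>c. \<beta> = c\<^sup>2"
    and "X = {w\<^sub>1 ^ d i * \<iota> (rel_trace \<iota> (w\<^sub>1 ^ (d 0 + d i))) | i. 1 \<le> i \<and> i \<le> q}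
             \<union> {2 * \<iota> \<beta> * w\<^sub>1 ^ d 0}"
    and "Xbar = {dlog \<omega> x mod (2 * N) | x. x \<in> X}"
    and "A \<subseteq> {0..<N}" and "B \<subseteq> {0..<N}"
    and "Xbar = {(2 * a) mod (2 * N) | a. a \<in> A} \<union> {(2 * b + N) mod (2 * N) | b. b \<in> B}"
    and "I\<^sub>X = {(4 * a) mod (4 * N) | a. a \<in> A} \<union> {(4 * a + N) mod (4 * N) | a. a \<in> A}
             \<union> {(4 * b + 2 * N) mod (4 * N) | b. b \<in> B} \<union> {(4 * b + 3 * N) mod (4 * N) | b. b \<in> B}"
    and "D = {(\<iota> x * y, \<iota> x * inverse y * z * \<omega> ^ l) | x y z l.
               x \<noteq> 0 \<and> y \<in> cyclic_subgroup (\<omega> ^ (q - 1)) \<and>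
               z \<in> cyclic_subgroup (\<omega> ^ (4 * N)) \<and> l \<in> I\<^sub>X}"
    and "M = {ext_point \<iota> v | v. v \<in> D}"
  shows "M \<subseteq> quadric \<iota> \<and>
    (\<forall>\<phi> :: 'f ^ 6 \<Rightarrow> 'e \<times> 'e. klein_identification \<iota> \<phi> \<longrightarrow>
       cameron_liebler (klein_lines \<phi> M) ((q\<^sup>2 - 1) div 2))"
proof -
  note q_pp = assms(1) and card_F = assms(3) and card_E = assms(4) and emb = assms(5)
  have q1: "q > 1" using q_pp by (rule primepow_gt_Suc_0[unfolded One_nat_def[symmetric]])
  have "q mod 4 = 1" "q mod 3 \<noteq> 1"
    using assms(2) by presburger+
  then interpret cubic_trace q N \<omega>
    using q1 card_E assms(6,7) frobenius_add_finite_field[OF card_E q_pp] by unfold_locales auto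
  have \<iota>_inj: "inj \<iota>" using emb by (rule field_embedding_inj)
  have \<iota>_1: "\<iota> 1 = 1" and \<iota>_mult: "\<iota> (x * y) = \<iota> x * \<iota> y"
    and \<iota>_add: "\<iota> (x + y) = \<iota> x + \<iota> y" for x y
    using emb by (auto simp: field_embedding_def)
  have \<iota>_0: "\<iota> 0 = 0" using \<iota>_add by (metis add.right_neutral add_left_cancel)
  have \<iota>_eq_0: "\<iota> x = 0 \<longleftrightarrow> x = 0" for x using \<iota>_inj \<iota>_0 by (metis injD)
  have \<iota>_T: "\<iota> (rel_trace \<iota> x) = T x" for x
    unfolding T_def by (rule embed_rel_trace[OF emb card_F card_E q_pp])
  have trace_0: "rel_trace \<iota> x = 0 \<longleftrightarrow> T x = 0" for x
    unfolding \<iota>_T[symmetric] \<iota>_eq_0 by (rule refl)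
  have Fs_range: "range \<iota> = Fs"
    unfolding field_embedding_range[OF emb] card_F Fs_def by (rule refl)
  have Fu_range: "f \<in> Fu \<longleftrightarrow> (\<exists>x. x \<noteq> 0 \<and> f = \<iota> x)" for f
    unfolding Fu_def Fs_range[symmetric] using \<iota>_eq_0 by auto

  have w\<^sub>1_N: "w\<^sub>1 ^ N = 1" and w\<^sub>1_min: "0 < m \<Longrightarrow> m < N \<Longrightarrow> w\<^sub>1 ^ m \<noteq> 1" for m
    using assms(8) by (auto simp: has_mult_order_def)
  have w\<^sub>1: "w\<^sub>1 \<in> W" using w\<^sub>1_N by (simp add: W_def)
  have w\<^sub>1_inj: "i = j" if "i < N" "j < N" "w\<^sub>1 ^ i = w\<^sub>1 ^ j" for i j
  proof -
    have "i = j" if "i \<le> j" "j < N" "w\<^sub>1 ^ i = w\<^sub>1 ^ j" for i j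
    proof -
      have "w\<^sub>1 ^ i * w\<^sub>1 ^ (j - i) = w\<^sub>1 ^ j" using that(1) by (simp flip: power_add)
      hence "w\<^sub>1 ^ i * w\<^sub>1 ^ (j - i) = w\<^sub>1 ^ i * 1" by (simp only: that(3) mult_1_right)
      hence 1: "w\<^sub>1 ^ (j - i) = 1" using W_nonzero[OF w\<^sub>1] by simp
      show ?thesis
      proof (rule ccontr)
        assume "i \<noteq> j"
        hence "0 < j - i" "j - i < N" using that(1,2) by auto
        thus False using w\<^sub>1_min 1 by blast
      qed
    qed
    thus ?thesis using that by (metis nle_le)
  qed
  \<comment> \<open>W has N elements, so the N distinct powers of \<open>w\<^sub>1\<close> fill it;
    the indices in \<open>I\<^sub>Q\<close> then correspond to the conic.\<close>
  have W_powers: "(\<lambda>i. w\<^sub>1 ^ i) ` {..<N} = W"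
  proof (rule card_seteq)
    have "inj_on (\<lambda>i. w\<^sub>1 ^ i) {..<N}" using w\<^sub>1_inj by (intro inj_onI) auto
    thus "card W \<le> card ((\<lambda>i. w\<^sub>1 ^ i) ` {..<N})" by (simp add: card_image card_W)
  qed (use W_power[OF w\<^sub>1] in auto)
  have I\<^sub>Q_eq: "i \<in> I\<^sub>Q \<longleftrightarrow> i < N \<and> w\<^sub>1 ^ i \<in> conic" for i
    using N_pos W_power[OF w\<^sub>1] unfolding assms(9) trace_0 conic_def
    by (auto simp: mult.commute[of i] simp flip: power_mult)
  have d_img: "d ` {0..q} = I\<^sub>Q" and d_inj: "inj_on d {0..q}"
    using assms(10) by (auto simp: bij_betw_def)
  have conic_eq: "conic = (\<lambda>i. w\<^sub>1 ^ d i) ` {0..q}"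
  proof -
    have "conic = (\<lambda>i. w\<^sub>1 ^ i) ` I\<^sub>Q"
    proof (intro equalityI subsetI)
      fix w assume w: "w \<in> conic"
      then obtain i where "i < N" "w = w\<^sub>1 ^ i" using conic_W W_powers by blast
      thus "w \<in> (\<lambda>i. w\<^sub>1 ^ i) ` I\<^sub>Q" using w I\<^sub>Q_eq by blast
    qed (use I\<^sub>Q_eq in blast)
    thus ?thesis unfolding d_img[symmetric] by (simp add: image_image)
  qed

  define w\<^sub>0 where "w\<^sub>0 = w\<^sub>1 ^ d 0"
  define h where "h = (\<lambda>w. if w = w\<^sub>0 then 2 * \<iota> \<beta> else T (w\<^sub>0 * w))"
  have w\<^sub>0: "w\<^sub>0 \<in> conic" unfolding conic_eq w\<^sub>0_def by auto
  have w_ne: "w\<^sub>1 ^ d i \<noteq> w\<^sub>0" if "1 \<le> i" "i \<le> q" for i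
  proof
    assume "w\<^sub>1 ^ d i = w\<^sub>0"
    moreover have "d j < N" if "j \<le> q" for j
    proof -
      have "d j \<in> I\<^sub>Q" unfolding d_img[symmetric] using that by simp
      thus ?thesis using I\<^sub>Q_eq by blast
    qed
    ultimately have "d i = d 0" using w\<^sub>1_inj that(2) unfolding w\<^sub>0_def by blast
    thus False using inj_onD[OF d_inj, of i 0] that by simp
  qed
  have "\<iota> \<beta> \<in> Fu" using Fu_range assms(11) by blast
  moreover have "chi (\<iota> \<beta>) = 1"
  proof -
    obtain c where c: "\<beta> = c\<^sup>2" using assms(12) by blast
    hence "\<iota> \<beta> = (\<iota> c)\<^sup>2" by (simp add: power2_eq_square \<iota>_mult)
    moreover have "\<iota> c \<noteq> 0" using c assms(11) \<iota>_eq_0 by auto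
    ultimately show ?thesis using chi_square by simp
  qed
  ultimately interpret conic_weights q N \<omega> h
    unfolding h_def by (rule conic_weights_trace[OF w\<^sub>0])

  have X_eq: "X = {w * h w |w. w \<in> conic}"
  proof -
    have "{0..q} = insert 0 {1..q}" by auto
    hence 1: "conic = insert w\<^sub>0 ((\<lambda>i. w\<^sub>1 ^ d i) ` {1..q})" unfolding conic_eq by (simp add: w\<^sub>0_def)
    have "{w * h w |w. w \<in> conic} = insert (w\<^sub>0 * h w\<^sub>0) {w\<^sub>1 ^ d i * h (w\<^sub>1 ^ d i) |i. i \<in> {1..q}}"
      unfolding 1 by blast
    also have "w\<^sub>0 * h w\<^sub>0 = 2 * \<iota> \<beta> * w\<^sub>1 ^ d 0" by (simp add: h_def w\<^sub>0_def)
    also have "{w\<^sub>1 ^ d i * h (w\<^sub>1 ^ d i) |i. i \<in> {1..q}}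
        = (\<lambda>i. w\<^sub>1 ^ d i * h (w\<^sub>1 ^ d i)) ` {1..q}" by blast
    also have "\<dots> = (\<lambda>i. w\<^sub>1 ^ d i * \<iota> (rel_trace \<iota> (w\<^sub>1 ^ (d 0 + d i)))) ` {1..q}"
    proof (rule image_cong[OF refl])
      fix i assume "i \<in> {1..q}"
      hence "h (w\<^sub>1 ^ d i) = T (w\<^sub>0 * w\<^sub>1 ^ d i)" using w_ne[of i] by (simp add: h_def)
      also have "\<dots> = \<iota> (rel_trace \<iota> (w\<^sub>1 ^ (d 0 + d i)))"
        unfolding \<iota>_T by (simp add: w\<^sub>0_def power_add)
      finally show "w\<^sub>1 ^ d i * h (w\<^sub>1 ^ d i) = w\<^sub>1 ^ d i * \<iota> (rel_trace \<iota> (w\<^sub>1 ^ (d 0 + d i)))"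
        by (rule arg_cong)
    qed
    also have "\<dots> = {w\<^sub>1 ^ d i * \<iota> (rel_trace \<iota> (w\<^sub>1 ^ (d 0 + d i))) |i. 1 \<le> i \<and> i \<le> q}"
      unfolding image_def Bex_def atLeastAtMost_iff by blast
    finally show ?thesis unfolding assms(13) by simp
  qed
  have X_0: "0 \<notin> X"
    unfolding X_eq using W_nonzero[OF conic_W] Fu_nonzero[OF h_Fu] by auto

  \<comment> \<open>The four families are 2k and 2k + N for k in \<open>Xbar\<close>: k = 2a gives
    those of \<open>A\<close>, and k = 2b + N those of \<open>B\<close>. Doubling is well defined
    from residues modulo 2N to residues modulo 4N, so \<open>A\<close> and \<open>B\<close>
    disappear.\<close>
  have I_eq: "I\<^sub>X = {(2 * dlog \<omega> x) mod (4 * N) |x. x \<in> X} \<union> {(2 * dlog \<omega> x + N) mod (4 * N) |x. x \<in> X}"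
  proof -
    have dbl: "(2 * (k mod (2 * N)) + r) mod (4 * N) = (2 * k + r) mod (4 * N)" for k r
    proof -
      have "2 * (k mod (2 * N)) = (2 * k) mod (4 * N)" using mult_mod_right[of 2 k "2 * N"] by simp
      thus ?thesis by (simp add: mod_add_left_eq)
    qed
    have "I\<^sub>X = (\<Union>k\<in>Xbar. {(2 * k + 0) mod (4 * N), (2 * k + N) mod (4 * N)})"
      unfolding assms(17) assms(18) UN_Un
    proof -
      have *: "{(4 * a) mod (4 * N) |a. a \<in> A} \<union> {(4 * a + N) mod (4 * N) |a. a \<in> A}
          = (\<Union>k\<in>{(2 * a) mod (2 * N) |a. a \<in> A}. {(2 * k + 0) mod (4 * N), (2 * k + N) mod (4 * N)})"
      proof -
        have "(\<Union>k\<in>{(2 * a) mod (2 * N) |a. a \<in> A}. {(2 * k + 0) mod (4 * N), (2 * k + N) mod (4 * N)})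
          = (\<Union>a\<in>A. {(2 * ((2 * a) mod (2 * N)) + 0) mod (4 * N), (2 * ((2 * a) mod (2 * N)) + N) mod (4 * N)})" by blast
        also have "\<dots> = (\<Union>a\<in>A. {(4 * a) mod (4 * N), (4 * a + N) mod (4 * N)})"
          unfolding dbl by simp
        finally show ?thesis by blast
      qed
      have **: "{(4 * b + 2 * N) mod (4 * N) |b. b \<in> B} \<union> {(4 * b + 3 * N) mod (4 * N) |b. b \<in> B}
          = (\<Union>k\<in>{(2 * b + N) mod (2 * N) |b. b \<in> B}. {(2 * k + 0) mod (4 * N), (2 * k + N) mod (4 * N)})"
      proof -
        have "(\<Union>k\<in>{(2 * b + N) mod (2 * N) |b. b \<in> B}. {(2 * k + 0) mod (4 * N), (2 * k + N) mod (4 * N)})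
          = (\<Union>b\<in>B. {(2 * ((2 * b + N) mod (2 * N)) + 0) mod (4 * N), (2 * ((2 * b + N) mod (2 * N)) + N) mod (4 * N)})" by blast
        also have "\<dots> = (\<Union>b\<in>B. {(4 * b + 2 * N) mod (4 * N), (4 * b + 3 * N) mod (4 * N)})"
          unfolding dbl by (simp add: algebra_simps)
        finally show ?thesis by blast
      qed
      show "{(4 * a) mod (4 * N) |a. a \<in> A} \<union> {(4 * a + N) mod (4 * N) |a. a \<in> A}
          \<union> {(4 * b + 2 * N) mod (4 * N) |b. b \<in> B} \<union> {(4 * b + 3 * N) mod (4 * N) |b. b \<in> B}
        = (\<Union>k\<in>{(2 * a) mod (2 * N) |a. a \<in> A}. {(2 * k + 0) mod (4 * N), (2 * k + N) mod (4 * N)})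
          \<union> (\<Union>k\<in>{(2 * b + N) mod (2 * N) |b. b \<in> B}. {(2 * k + 0) mod (4 * N), (2 * k + N) mod (4 * N)})"
        unfolding *[symmetric] **[symmetric] by (simp only: Un_assoc)
    qed
    also have "\<dots> = (\<Union>x\<in>X. {(2 * (dlog \<omega> x mod (2 * N)) + 0) mod (4 * N), (2 * (dlog \<omega> x mod (2 * N)) + N) mod (4 * N)})"
      unfolding assms(14) by blast
    also have "\<dots> = (\<Union>x\<in>X. {(2 * dlog \<omega> x) mod (4 * N), (2 * dlog \<omega> x + N) mod (4 * N)})"
      unfolding dbl by simp
    finally show ?thesis by blast
  qed

  have D_eq: "D = tight_vectors"
  proof -
    have "D = {(\<iota> x * y, \<iota> x * inverse y * t) |x y t. x \<noteq> 0 \<and> y \<in> W \<and>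
        t \<in> {z * \<omega> ^ l |z l. z \<in> cyclic_subgroup (\<omega> ^ (4 * N)) \<and> l \<in> I\<^sub>X}}"
      unfolding assms(19) W_eq_cyclic mem_Collect_eq mult.assoc by blast
    also have "\<dots> = tight_vectors"
      unfolding exponent_set_eq[OF X_0 I_eq] X_eq
    proof (intro equalityI subsetI)
      fix v assume "v \<in> {(\<iota> x * y, \<iota> x * inverse y * t) |x y t. x \<noteq> 0 \<and> y \<in> W \<and>
        t \<in> {x\<^sup>2 * r |x r. x \<in> {w * h w |w. w \<in> conic} \<and> r \<in> R}}"
      then obtain x y w r where *: "v = (\<iota> x * y, \<iota> x * inverse y * ((w * h w)\<^sup>2 * r))"
        "x \<noteq> 0" "y \<in> W" "w \<in> conic" "r \<in> R" by blast
      have "v = tight_vector (\<iota> x) y w r" by (simp add: *(1) tight_vector_def power_mult_distrib)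
      thus "v \<in> tight_vectors" using *(2-5) Fu_range unfolding tight_vectors_def by blast
    next
      fix v assume "v \<in> tight_vectors"
      then obtain f y w r where *: "v = tight_vector f y w r" "f \<in> Fu" "y \<in> W" "w \<in> conic" "r \<in> R"
        unfolding tight_vectors_def by blast
      then obtain x where x: "f = \<iota> x" "x \<noteq> 0" using Fu_range by blast
      have "v = (\<iota> x * y, \<iota> x * inverse y * ((w * h w)\<^sup>2 * r))"
        by (simp add: *(1) x(1) tight_vector_def power_mult_distrib)
      thus "v \<in> {(\<iota> x * y, \<iota> x * inverse y * t) |x y t. x \<noteq> 0 \<and> y \<in> W \<and>
        t \<in> {x\<^sup>2 * r |x r. x \<in> {w * h w |w. w \<in> conic} \<and> r \<in> R}}"
        using *(3-5) x(2) by blast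
    qed
    finally show ?thesis .
  qed

  have quad: "quad_form \<iota> v = 0 \<longleftrightarrow> T (fst v * snd v) = 0" for v
    unfolding quad_form_def by (rule trace_0)
  have singular: "v \<noteq> 0 \<and> quad_form \<iota> v = 0" if "v \<in> D" for v
    using tight_vector_isotropic[of v] that unfolding D_eq quad by (auto simp: zero_prod_def)
  have scale: "ext_scale \<iota> c v \<in> D" if "c \<noteq> 0" "v \<in> D" for c v
    using tight_vectors_scale[of "\<iota> c" "fst v" "snd v"] that Fu_range
    unfolding D_eq ext_scale_def by auto
  define x where "x = (q\<^sup>2 - 1) div 2"
  have x: "2 * x = q\<^sup>2 - 1" using odd_q by (simp add: x_def)
  \<comment> \<open>Doubled on both sides, so that neither the size of \<open>R\<close> nor x calls
    for a division of natural numbers.\<close>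
  have "2 * card D = (q - 1) * (2 * x * N)" unfolding D_eq x by (rule card_tight_vectors)
  hence "2 * card D = 2 * ((q - 1) * (x * N))" by (simp only: mult_ac)
  hence "card D = (q - 1) * (x * N)" by linarith
  hence card_D: "card D = (CARD('f) - 1) * (x * ((CARD('f))\<^sup>2 + CARD('f) + 1))"
    by (simp only: card_F N_def)
  have tight: "card {v \<in> D. quad_form \<iota> (v + p) = 0}
      = (CARD('f) - 1) * (x * (CARD('f) + 1) + (CARD('f))\<^sup>2 * of_bool (p \<in> D))"
    if p: "p \<noteq> 0" "quad_form \<iota> p = 0" for p
  proof -
    \<comment> \<open>For singular v and p, expanding the form at v + p leaves the polar form, which
      is the condition counted in \<open>card_tight_vectors_perp\<close>.\<close>
    have "quad_form \<iota> (v + p) = 0 \<longleftrightarrow> T (fst v * snd p + snd v * fst p) = 0" if "v \<in> D" for v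
    proof -
      have "fst (v + p) * snd (v + p) = fst v * snd v + (fst v * snd p + snd v * fst p) + fst p * snd p"
        by (simp add: algebra_simps)
      moreover have "T (fst v * snd v) = 0" "T (fst p * snd p) = 0"
        using singular[OF that] p(2) by (simp_all add: quad)
      ultimately show ?thesis unfolding quad by (simp only: T_add) simp
    qed
    hence "{v \<in> D. quad_form \<iota> (v + p) = 0} = {v \<in> tight_vectors. T (fst v * snd p + snd v * fst p) = 0}"
      unfolding D_eq by blast
    hence "real (card {v \<in> D. quad_form \<iota> (v + p) = 0})
        = real (q - 1) * ((real q ^ 2 - 1) * (real q + 1) / 2 + real q ^ 2 * of_bool (p \<in> D))"
      using card_tight_vectors_perp[of "fst p" "snd p"] p by (simp add: D_eq quad)
    also have "(real q ^ 2 - 1) * (real q + 1) / 2 = real (x * (q + 1))"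
    proof -
      have "q\<^sup>2 \<ge> 1" using q1 by (simp add: Suc_le_eq)
      hence sq: "real q ^ 2 - 1 = 2 * real x"
        using arg_cong[OF x, of real] by (simp add: of_nat_diff)
      show ?thesis unfolding sq by (simp add: algebra_simps)
    qed
    also have "real (q - 1) * (real (x * (q + 1)) + real q ^ 2 * of_bool (p \<in> D))
        = real ((q - 1) * (x * (q + 1) + q\<^sup>2 * of_bool (p \<in> D)))"
      by (simp only: of_nat_mult of_nat_add of_nat_power of_nat_of_bool)
    finally show ?thesis unfolding card_F of_nat_eq_iff .
  qed
  show ?thesis
    unfolding x_def[symmetric]
  proof (intro conjI allI impI)
    show "M \<subseteq> quadric \<iota>" unfolding assms(20) quadric_def using singular by blast
  next
    fix \<phi> :: "'f ^ 6 \<Rightarrow> 'e \<times> 'e" assume "klein_identification \<iota> \<phi>"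
    thus "cameron_liebler (klein_lines \<phi> M) x"
      unfolding assms(20) using cameron_liebler_of_tight_vectors[OF emb _ singular scale card_D tight] by blast
  qed
qed

end
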